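(* Let $R$ and $A$ be von Neumann algebras, let $\omega$ be a normal state on $A$ with GNS construction $(H,\gamma)$, and let $(R_*^+)_1$ denote the set of normal states on $R$. Let $\Delta:R\to R\otimes R$ and $\alpha:A\to R\otimes A$ be normal $*$-homomorphisms such that $$(\iota_R\otimes\alpha)\circ\alpha=(\Delta\otimes\iota_A)\circ\alpha$$ and $$(\theta\otimes\omega)\circ\alpha=\omega\quad\text{for all }\theta\in(R_*^+)_1 .$$ Assume there exists a net $(\varphi_\lambda)$ in $(R_*^+)_1$ such that $\|\theta*\varphi_\lambda-\varphi_\lambda\|\to 0$ for all $\theta\in(R_*^+)_1$. Let $P$ be the projection of $H$ onto $$V:=\{x\in H:\tilde{\theta}^{\alpha}x=x\text{ for all }\theta\in(R_*^+)_1\}.$$ Then $$\lim_\lambda\langle x,\tilde{\varphi}_\lambda^{\alpha}y\rangle=\langle x,Py\rangle\quad\text{for all }x,y\in H.$$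
   Context: Conventions: $R\otimes A$ denotes the von Neumann algebraic tensor product. A $*$-homomorphism between von Neumann algebras is normal if it is $\sigma$-weakly continuous; $*$-homomorphisms are not assumed unital. $\iota_R,\iota_A$ are the identity maps and $1_R$ is the unit of $R$. Tensor products of normal functionals and normal $*$-homomorphisms denote the usual normal (i.e. $\sigma$-weakly continuous) extensions to the von Neumann algebraic tensor product. $R_*^+$ is the set of positive normal linear functionals on $R$. GNS construction: $(H,\gamma)$ consists of a Hilbert space $H$ and a linear map $\gamma:A\to H$ with dense range such that $\langle\gamma(a),\gamma(b)\rangle=\omega(a^*b)$ for all $a,b\in A$ (inner products are conjugate-linear in the first variable and linear in the second). Convolution: for normal positive linear functionals $\mu,\nu$ on $R$, $\mu*\nu:=(\mu\otimes\nu)\circ\Delta$. The norm $\|\theta*\varphi_\lambda-\varphi_\lambda\|$ is the functional norm on $R_*$. The map $\tilde\mu$: for a normal positive linear functional $\mu$ on $R$, $\tilde\mu:R\otimes A\to H$ is the unique function satisfying $\langle\gamma(d),\tilde\mu(T)\rangle=(\mu\otimes\omega)\big((1_R\otimes d)^*T\big)$ for all $T\in R\otimes A$, $d\in A$. The operator $\tilde\mu^\alpha$: if $\mu$ is a normal positive linear functional on $R$ with $(\mu\otimes\omega)\circ\alpha=\mu(1_R)\,\omega$, then $\tilde\mu^\alpha:H\to H$ is the unique bounded linear operator with $\tilde\mu^\alpha(\gamma(a))=\tilde\mu(\alpha(a))$ for all $a\in A$. Equivalently, $\langle\gamma(d),\tilde\mu^\alpha\gamma(a)\rangle=(\mu\otimes\omega)\big((1_R\otimes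 d)^*\alpha(a)\big)$ for all $a,d\in A$. $P$ is the orthogonal projection onto the closed subspace $V$. *)

theory Defs
  imports "HOL-Analysis.Analysis" "HOL-Library.Nonpos_Ints"
begin

section \<open>Complex Hilbert spaces\<close>

class scaleC =
  fixes scaleC :: "complex \<Rightarrow> 'a \<Rightarrow> 'a"  (infixr "*\<^sub>C" 75)

text \<open>The inner product is conjugate-linear in the first variable and linear in the second.
  The norm and topology are those of the underlying real Hilbert space, whose inner product is
  the real part of the complex one.\<close>

class complex_hilbert_space = real_inner + complete_space + scaleC +
  fixes cinner :: "'a \<Rightarrow> 'a \<Rightarrow> complex"
  assumes scaleC_of_real: "complex_of_real r *\<^sub>C x = r *\<^sub>R x"
    and scaleC_add_right: "c *\<^sub>C (x + y) = c *\<^sub>C x + c *\<^sub>C y"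
    and scaleC_add_left: "(c + d) *\<^sub>C x = c *\<^sub>C x + d *\<^sub>C x"
    and scaleC_scaleC: "c *\<^sub>C (d *\<^sub>C x) = (c * d) *\<^sub>C x"
    and cinner_commute: "cinner x y = cnj (cinner y x)"
    and cinner_add_right: "cinner x (y + z) = cinner x y + cinner x z"
    and cinner_scaleC_right: "cinner x (c *\<^sub>C y) = c * cinner x y"
    and inner_eq_Re_cinner: "inner x y = Re (cinner x y)"

instantiation complex :: complex_hilbert_space
begin

definition "scaleC_complex c x = c * (x :: complex)"

definition "cinner_complex x y = cnj x * (y :: complex)"

instance
  by standard
    (simp_all add: scaleC_complex_def cinner_complex_def scaleR_conv_of_real inner_complex_def
      algebra_simps)

end

lemma norm_scaleC: "norm (c *\<^sub>C x) = cmod c * norm x" for x :: "'a::complex_hilbert_space"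
proof -
  have "cinner (c *\<^sub>C x) (c *\<^sub>C x) = c * cnj c * cinner x x"
    by (metis cinner_commute cinner_scaleC_right complex_cnj_mult mult.assoc)
  also have "c * cnj c = complex_of_real ((cmod c)\<^sup>2)"
    by (rule complex_norm_square [symmetric])
  finally have "inner (c *\<^sub>C x) (c *\<^sub>C x) = (cmod c)\<^sup>2 * inner x x"
    by (simp add: inner_eq_Re_cinner)
  then have "(norm (c *\<^sub>C x))\<^sup>2 = (cmod c * norm x)\<^sup>2"
    by (simp add: power2_norm_eq_inner power_mult_distrib)
  then show ?thesis
    by (simp add: power2_eq_iff_nonneg)
qed

lemma bounded_linear_scaleC: "bounded_linear ((*\<^sub>C) c :: 'a::complex_hilbert_space \<Rightarrow> 'a)"
proof (rule bounded_linear_intro)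
  show "c *\<^sub>C (r *\<^sub>R x) = r *\<^sub>R (c *\<^sub>C x)" for r and x :: 'a
    by (simp add: scaleC_of_real [symmetric] scaleC_scaleC mult.commute)
  show "norm (c *\<^sub>C x) \<le> norm x * cmod c" for x :: 'a
    by (simp add: norm_scaleC mult.commute)
qed (simp add: scaleC_add_right)

instantiation blinfun :: (real_normed_vector, complex_hilbert_space) scaleC
begin

lift_definition scaleC_blinfun :: "complex \<Rightarrow> 'a \<Rightarrow>\<^sub>L 'b \<Rightarrow> 'a \<Rightarrow>\<^sub>L 'b" is "\<lambda>c f x. c *\<^sub>C f x"
  by (rule bounded_linear_compose [OF bounded_linear_scaleC])

instance ..

end

definition clinear_on :: "'a::{plus,scaleC} set \<Rightarrow> ('a \<Rightarrow> 'b::{plus,scaleC}) \<Rightarrow> bool" where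
  "clinear_on X f \<longleftrightarrow>
     (\<forall>x\<in>X. \<forall>y\<in>X. f (x + y) = f x + f y) \<and> (\<forall>c. \<forall>x\<in>X. f (c *\<^sub>C x) = c *\<^sub>C f x)"

definition orth_proj :: "'h::complex_hilbert_space set \<Rightarrow> 'h \<Rightarrow> 'h" where
  "orth_proj V x = (THE p. p \<in> V \<and> (\<forall>v\<in>V. cinner v (x - p) = 0))"


section \<open>Operators and von Neumann algebras\<close>

text \<open>The library type of bounded operators only knows real linearity; the bounded operators
  on a complex Hilbert space are its complex linear members.\<close>

definition bounded_ops :: "('a::complex_hilbert_space \<Rightarrow>\<^sub>L 'a) set" where
  "bounded_ops = {T. clinear_on UNIV (blinfun_apply T)}"

definition adj :: "('a::complex_hilbert_space \<Rightarrow>\<^sub>L 'a) \<Rightarrow> 'a \<Rightarrow>\<^sub>L 'a" where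
  "adj T = (THE S. \<forall>x y. cinner (blinfun_apply S x) y = cinner x (blinfun_apply T y))"

definition commutant :: "('a::complex_hilbert_space \<Rightarrow>\<^sub>L 'a) set \<Rightarrow> ('a \<Rightarrow>\<^sub>L 'a) set" where
  "commutant M = {T \<in> bounded_ops. \<forall>S\<in>M. T o\<^sub>L S = S o\<^sub>L T}"

definition von_neumann_algebra :: "('a::complex_hilbert_space \<Rightarrow>\<^sub>L 'a) set \<Rightarrow> bool" where
  "von_neumann_algebra M \<longleftrightarrow>
     M \<subseteq> bounded_ops \<and> (\<forall>T\<in>M. adj T \<in> M) \<and> commutant (commutant M) = M"

text \<open>The \<open>\<sigma>\<close>-weak topology on the bounded operators: the initial topology for the functionals
  \<open>T \<mapsto> \<Sum>n. \<langle>\<xi> n, T (\<eta> n)\<rangle>\<close> with square-summable sequences \<open>\<xi>\<close>, \<open>\<eta>\<close>.\<close>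

definition sigma_weak :: "('a::complex_hilbert_space \<Rightarrow>\<^sub>L 'a) topology" where
  "sigma_weak = subtopology
     (topology_generated_by
       {{T. (\<Sum>n. cinner (\<xi> n) (blinfun_apply T (\<eta> n))) \<in> U} | (\<xi> :: nat \<Rightarrow> 'a) \<eta> U.
         summable (\<lambda>n. (norm (\<xi> n))\<^sup>2) \<and> summable (\<lambda>n. (norm (\<eta> n))\<^sup>2) \<and> open U})
     bounded_ops"

definition normal_functional ::
  "('a::complex_hilbert_space \<Rightarrow>\<^sub>L 'a) set \<Rightarrow> (('a \<Rightarrow>\<^sub>L 'a) \<Rightarrow> complex) \<Rightarrow> bool" where
  "normal_functional M f \<longleftrightarrow>
     clinear_on M f \<and> continuous_map (subtopology sigma_weak M) euclidean f"

text \<open>Functionals on \<open>M\<close> are represented by functions on the whole operator type, whose values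
  outside \<open>M\<close> are irrelevant.\<close>

definition normal_states ::
  "('a::complex_hilbert_space \<Rightarrow>\<^sub>L 'a) set \<Rightarrow> (('a \<Rightarrow>\<^sub>L 'a) \<Rightarrow> complex) set" where
  "normal_states M =
     {f. normal_functional M f \<and> (\<forall>T\<in>M. f (adj T o\<^sub>L T) \<in> \<real>\<^sub>\<ge>\<^sub>0) \<and> f id_blinfun = 1}"

definition functional_norm ::
  "('a::complex_hilbert_space \<Rightarrow>\<^sub>L 'a) set \<Rightarrow> (('a \<Rightarrow>\<^sub>L 'a) \<Rightarrow> complex) \<Rightarrow> real" where
  "functional_norm M f = (SUP T\<in>{T \<in> M. norm T \<le> 1}. cmod (f T))"

definition normal_star_hom ::
  "('a::complex_hilbert_space \<Rightarrow>\<^sub>L 'a) set \<Rightarrow> ('b::complex_hilbert_space \<Rightarrow>\<^sub>L 'b) set \<Rightarrow>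
     (('a \<Rightarrow>\<^sub>L 'a) \<Rightarrow> ('b \<Rightarrow>\<^sub>L 'b)) \<Rightarrow> bool" where
  "normal_star_hom M N \<Phi> \<longleftrightarrow>
     \<Phi> \<in> M \<rightarrow> N \<and> clinear_on M \<Phi> \<and>
     (\<forall>S\<in>M. \<forall>T\<in>M. \<Phi> (S o\<^sub>L T) = \<Phi> S o\<^sub>L \<Phi> T) \<and>
     (\<forall>T\<in>M. \<Phi> (adj T) = adj (\<Phi> T)) \<and>
     continuous_map (subtopology sigma_weak M) (subtopology sigma_weak N) \<Phi>"


section \<open>Tensor products\<close>

text \<open>\<open>hilbert_tensor t\<close> says that \<open>'c\<close>, together with \<open>t x y = x \<otimes> y\<close>, is a Hilbert space tensor
  product of \<open>'a\<close> and \<open>'b\<close>; this determines \<open>('c, t)\<close> up to a unique unitary.  The real span is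
  already a complex subspace, since \<open>c *\<^sub>C t x y = t (c *\<^sub>C x) y\<close>.\<close>

definition hilbert_tensor ::
  "('a::complex_hilbert_space \<Rightarrow> 'b::complex_hilbert_space \<Rightarrow> 'c::complex_hilbert_space) \<Rightarrow> bool"
  where
  "hilbert_tensor t \<longleftrightarrow>
     (\<forall>x. clinear_on UNIV (t x)) \<and> (\<forall>y. clinear_on UNIV (\<lambda>x. t x y)) \<and>
     (\<forall>x y x' y'. cinner (t x y) (t x' y') = cinner x x' * cinner y y') \<and>
     closure (span {t x y | x y. True}) = UNIV"

definition op_tensor ::
  "('a::complex_hilbert_space \<Rightarrow> 'b::complex_hilbert_space \<Rightarrow> 'c::complex_hilbert_space) \<Rightarrow>
     ('a \<Rightarrow>\<^sub>L 'a) \<Rightarrow> ('b \<Rightarrow>\<^sub>L 'b) \<Rightarrow> ('c \<Rightarrow>\<^sub>L 'c)" where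
  "op_tensor t S T = (THE U. U \<in> bounded_ops \<and>
     (\<forall>x y. blinfun_apply U (t x y) = t (blinfun_apply S x) (blinfun_apply T y)))"

text \<open>The von Neumann algebra generated by the algebraic tensor product, obtained as its
  \<open>\<sigma>\<close>-weak closure.\<close>

definition vn_tensor ::
  "('a::complex_hilbert_space \<Rightarrow> 'b::complex_hilbert_space \<Rightarrow> 'c::complex_hilbert_space) \<Rightarrow>
     ('a \<Rightarrow>\<^sub>L 'a) set \<Rightarrow> ('b \<Rightarrow>\<^sub>L 'b) set \<Rightarrow> ('c \<Rightarrow>\<^sub>L 'c) set" where
  "vn_tensor t M N = sigma_weak closure_of (span {op_tensor t S T | S T. S \<in> M \<and> T \<in> N})"

text \<open>The normal extension of \<open>S \<otimes> T \<mapsto> \<mu> S * \<nu> T\<close>; it is unique on \<open>vn_tensor t M N\<close>.\<close>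

definition functional_tensor ::
  "('a::complex_hilbert_space \<Rightarrow> 'b::complex_hilbert_space \<Rightarrow> 'c::complex_hilbert_space) \<Rightarrow>
     ('a \<Rightarrow>\<^sub>L 'a) set \<Rightarrow> ('b \<Rightarrow>\<^sub>L 'b) set \<Rightarrow>
     (('a \<Rightarrow>\<^sub>L 'a) \<Rightarrow> complex) \<Rightarrow> (('b \<Rightarrow>\<^sub>L 'b) \<Rightarrow> complex) \<Rightarrow> ('c \<Rightarrow>\<^sub>L 'c) \<Rightarrow> complex" where
  "functional_tensor t M N \<mu> \<nu> =
     (SOME f. normal_functional (vn_tensor t M N) f \<and>
       (\<forall>S\<in>M. \<forall>T\<in>N. f (op_tensor t S T) = \<mu> S * \<nu> T))"

text \<open>\<open>is_hom_tensor t M N t' M' N' \<Phi> \<Psi> \<Theta>\<close>: the map \<open>\<Theta>\<close> is the tensor product \<open>\<Phi> \<otimes> \<Psi>\<close> of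
  \<open>\<Phi> : M \<rightarrow> M'\<close> and \<open>\<Psi> : N \<rightarrow> N'\<close>.\<close>

definition is_hom_tensor ::
  "('a::complex_hilbert_space \<Rightarrow> 'b::complex_hilbert_space \<Rightarrow> 'c::complex_hilbert_space) \<Rightarrow>
     ('a \<Rightarrow>\<^sub>L 'a) set \<Rightarrow> ('b \<Rightarrow>\<^sub>L 'b) set \<Rightarrow>
   ('d::complex_hilbert_space \<Rightarrow> 'e::complex_hilbert_space \<Rightarrow> 'f::complex_hilbert_space) \<Rightarrow>
     ('d \<Rightarrow>\<^sub>L 'd) set \<Rightarrow> ('e \<Rightarrow>\<^sub>L 'e) set \<Rightarrow>
   (('a \<Rightarrow>\<^sub>L 'a) \<Rightarrow> ('d \<Rightarrow>\<^sub>L 'd)) \<Rightarrow> (('b \<Rightarrow>\<^sub>L 'b) \<Rightarrow> ('e \<Rightarrow>\<^sub>L 'e)) \<Rightarrow>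
   (('c \<Rightarrow>\<^sub>L 'c) \<Rightarrow> ('f \<Rightarrow>\<^sub>L 'f)) \<Rightarrow> bool" where
  "is_hom_tensor t M N t' M' N' \<Phi> \<Psi> \<Theta> \<longleftrightarrow>
     normal_star_hom (vn_tensor t M N) (vn_tensor t' M' N') \<Theta> \<and>
     (\<forall>S\<in>M. \<forall>T\<in>N. \<Theta> (op_tensor t S T) = op_tensor t' (\<Phi> S) (\<Psi> T))"

definition convolution ::
  "('r::complex_hilbert_space \<Rightarrow> 'r \<Rightarrow> 'rr::complex_hilbert_space) \<Rightarrow> ('r \<Rightarrow>\<^sub>L 'r) set \<Rightarrow>
     (('r \<Rightarrow>\<^sub>L 'r) \<Rightarrow> ('rr \<Rightarrow>\<^sub>L 'rr)) \<Rightarrow>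
     (('r \<Rightarrow>\<^sub>L 'r) \<Rightarrow> complex) \<Rightarrow> (('r \<Rightarrow>\<^sub>L 'r) \<Rightarrow> complex) \<Rightarrow> ('r \<Rightarrow>\<^sub>L 'r) \<Rightarrow> complex" where
  "convolution t R \<Delta> \<mu> \<nu> = functional_tensor t R R \<mu> \<nu> \<circ> \<Delta>"


section \<open>The GNS construction and the operators it carries\<close>

definition gns_construction ::
  "('a::complex_hilbert_space \<Rightarrow>\<^sub>L 'a) set \<Rightarrow> (('a \<Rightarrow>\<^sub>L 'a) \<Rightarrow> complex) \<Rightarrow>
     (('a \<Rightarrow>\<^sub>L 'a) \<Rightarrow> 'h::complex_hilbert_space) \<Rightarrow> bool" where
  "gns_construction A \<omega> \<gamma> \<longleftrightarrow>
     clinear_on A \<gamma> \<and> closure (\<gamma> ` A) = UNIV \<and>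
     (\<forall>a\<in>A. \<forall>b\<in>A. cinner (\<gamma> a) (\<gamma> b) = \<omega> (adj a o\<^sub>L b))"

text \<open>The map \<open>\<mu>\<close>-tilde from \<open>R \<otimes> A\<close> to \<open>H\<close>.\<close>

definition gns_slice ::
  "('r::complex_hilbert_space \<Rightarrow> 'a::complex_hilbert_space \<Rightarrow> 'ra::complex_hilbert_space) \<Rightarrow>
     ('r \<Rightarrow>\<^sub>L 'r) set \<Rightarrow> ('a \<Rightarrow>\<^sub>L 'a) set \<Rightarrow> (('a \<Rightarrow>\<^sub>L 'a) \<Rightarrow> complex) \<Rightarrow>
     (('a \<Rightarrow>\<^sub>L 'a) \<Rightarrow> 'h::complex_hilbert_space) \<Rightarrow> (('r \<Rightarrow>\<^sub>L 'r) \<Rightarrow> complex) \<Rightarrow>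
     ('ra \<Rightarrow>\<^sub>L 'ra) \<Rightarrow> 'h" where
  "gns_slice t R A \<omega> \<gamma> \<mu> T =
     (THE h. \<forall>d\<in>A. cinner (\<gamma> d) h =
        functional_tensor t R A \<mu> \<omega> (adj (op_tensor t id_blinfun d) o\<^sub>L T))"

text \<open>The operator \<open>\<mu>\<close>-tilde-\<open>\<alpha>\<close> on \<open>H\<close>.\<close>

definition gns_slice_op ::
  "('r::complex_hilbert_space \<Rightarrow> 'a::complex_hilbert_space \<Rightarrow> 'ra::complex_hilbert_space) \<Rightarrow>
     ('r \<Rightarrow>\<^sub>L 'r) set \<Rightarrow> ('a \<Rightarrow>\<^sub>L 'a) set \<Rightarrow> (('a \<Rightarrow>\<^sub>L 'a) \<Rightarrow> complex) \<Rightarrow>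
     (('a \<Rightarrow>\<^sub>L 'a) \<Rightarrow> 'h::complex_hilbert_space) \<Rightarrow> (('a \<Rightarrow>\<^sub>L 'a) \<Rightarrow> ('ra \<Rightarrow>\<^sub>L 'ra)) \<Rightarrow>
     (('r \<Rightarrow>\<^sub>L 'r) \<Rightarrow> complex) \<Rightarrow> 'h \<Rightarrow>\<^sub>L 'h" where
  "gns_slice_op t R A \<omega> \<gamma> \<alpha> \<mu> =
     (THE S. S \<in> bounded_ops \<and> (\<forall>a\<in>A. blinfun_apply S (\<gamma> a) = gns_slice t R A \<omega> \<gamma> \<mu> (\<alpha> a)))"

end

theory Submission
  imports Defs
begin

text \<open>Coassociativity of \<open>\<alpha>\<close> makes \<open>\<theta> \<mapsto> T\<^sub>\<theta>\<close> (the operator \<open>\<theta>\<close>-tilde-\<open>\<alpha>\<close>) multiplicative for the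
  convolution, \<open>T\<^sub>\<phi> T\<^sub>\<theta> = T\<^sub>\<theta>\<^sub>*\<^sub>\<phi>\<close>, and invariance of \<open>\<omega>\<close> makes every \<open>T\<^sub>\<theta>\<close> a contraction.
  A matrix coefficient of \<open>T\<^sub>\<nu>\<close> has the form \<open>\<nu> r\<close> with a slice \<open>r \<in> R\<close>, so asymptotic invariance of the
  net gives \<open>T\<^sub>\<phi>\<^sub>i (T\<^sub>\<theta> - 1) \<rightarrow> 0\<close> weakly.  Since the \<open>T\<^sub>\<theta>\<close> are contractions, the orthogonal
  complement of \<open>V\<close> is the closed span of the ranges of all \<open>T\<^sub>\<theta> - 1\<close>, as in the mean ergodic theorem.
  Every normal functional on an operator space is a sum of vector functionals, which makes tensor
  products of normal functionals explicit.\<close>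

section \<open>Hilbert space preliminaries\<close>

text \<open>The objects defined by \<open>THE\<close> and \<open>SOME\<close> carry no information
  until existence and uniqueness are shown, and the main obstacle is the existence of
  \<open>gns_slice\<close>. The functional defining it has to be bounded by the norm of
  \<open>\<gamma> d\<close>; this is Cauchy-Schwarz for the form sending V, W to the value of
  \<theta> \<otimes> \<omega> at \<open>adj V o\<^sub>L W\<close>, so positivity is needed on the
  whole von Neumann tensor product. On sums of elementary tensors positivity is the Schur product
  theorem. The same theorem also gives the boundedness of S \<otimes> 1. The hypothesis on the net
  concerns functional norms on R. A matrix coefficient therefore has to be an evaluation at one
  element of R that serves all functionals simultaneously. Only normality of the convolution of
  \<theta> and \<phi> is established: \<Delta> is not assumed unital, so the product formula is
  proved for matrix coefficients and no operator is attached to the convolution.\<close>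

lemma cinner_add_left: "cinner (x + y) z = cinner x z + cinner y z"
  by (metis cinner_commute cinner_add_right complex_cnj_add)

lemma cinner_scaleC_left: "cinner (c *\<^sub>C x) y = cnj c * cinner x y"
  by (metis cinner_commute cinner_scaleC_right complex_cnj_mult)

lemma cinner_self: "cinner x x = of_real ((norm x)\<^sup>2)"
proof (rule complex_eqI)
  show "Im (cinner x x) = Im (of_real ((norm x)\<^sup>2))"
    using cinner_commute[of x x] by (simp add: complex_eq_iff)
qed (simp add: inner_eq_Re_cinner [symmetric] power2_norm_eq_inner)

text \<open>Rotating \<open>y\<close> by a unimodular \<open>c\<close> makes the inner product real,
  so the real Cauchy-Schwarz inequality applies.\<close>

lemma cmod_cinner_le: "cmod (cinner x y) \<le> norm x * norm y"
proof (cases "cinner x y = 0")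
  case False
  define c where "c = cnj (cinner x y) / cmod (cinner x y)"
  have c: "cmod c = 1"
    using False by (simp add: c_def norm_divide)
  have "c * cinner x y = cmod (cinner x y)"
    using False
    by (simp add: c_def complex_norm_square [symmetric] power2_eq_square mult.commute [of "cnj _"])
  then have "cmod (cinner x y) = inner x (c *\<^sub>C y)"
    by (simp add: inner_eq_Re_cinner cinner_scaleC_right)
  also have "\<dots> \<le> norm x * norm (c *\<^sub>C y)"
    by (rule norm_cauchy_schwarz)
  finally show ?thesis
    by (simp add: norm_scaleC c)
qed simp

interpretation cinner: bounded_bilinear "cinner :: 'a::complex_hilbert_space \<Rightarrow> 'a \<Rightarrow> complex"
proof
  show "cinner (r *\<^sub>R a) b = r *\<^sub>R cinner a b" "cinner a (r *\<^sub>R b) = r *\<^sub>R cinner a b"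
    for r and a b :: 'a
    by (simp_all flip: scaleC_of_real
        add: cinner_scaleC_left cinner_scaleC_right scaleC_complex_def)
  show "\<exists>K. \<forall>a b :: 'a. cmod (cinner a b) \<le> norm a * norm b * K"
    using cmod_cinner_le by (metis mult.right_neutral)
qed (simp_all add: cinner_add_left cinner_add_right)

interpretation scaleC: bounded_bilinear
  "scaleC :: complex \<Rightarrow> 'a \<Rightarrow> 'a::complex_hilbert_space"
proof
  show "(r *\<^sub>R c) *\<^sub>C x = r *\<^sub>R (c *\<^sub>C x)" for r c and x :: 'a
    by (simp flip: scaleC_of_real add: scaleC_scaleC scaleC_complex_def)
  show "c *\<^sub>C (r *\<^sub>R x) = r *\<^sub>R (c *\<^sub>C x)" for r c and x :: 'a
    by (simp flip: scaleC_of_real add: scaleC_scaleC mult.commute)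
  show "\<exists>K. \<forall>a. \<forall>b :: 'a. norm (a *\<^sub>C b) \<le> norm a * norm b * K"
    by (intro exI [of _ 1]) (simp add: norm_scaleC)
qed (simp_all add: scaleC_add_left scaleC_add_right)

lemma scaleC_one [simp]: "1 *\<^sub>C x = (x :: 'a::complex_hilbert_space)"
  using scaleC_of_real [of 1 x] by simp

declare cinner.zero_left [simp] cinner.zero_right [simp] scaleC.zero_right [simp]

lemma cinner_eqI: "(\<And>x. cinner x a = cinner x b) \<Longrightarrow> a = b"
  using cinner_self [of "a - b"] by (simp add: cinner.diff_right)

lemma cinner_eqI_left: "(\<And>x. cinner a x = cinner b x) \<Longrightarrow> a = b"
  using cinner_self [of "a - b"] by (simp add: cinner.diff_left)

lemma cinner_dense_eqI:
  assumes "closure X = UNIV" and "\<And>x. x \<in> X \<Longrightarrow> cinner x a = cinner x b"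
  shows "a = b"
proof (rule cinner_eqI)
  fix x :: 'a
  have "closed {x. cinner x a = cinner x b}"
    by (intro closed_Collect_eq continuous_intros cinner.continuous_on)
  moreover have "X \<subseteq> {x. cinner x a = cinner x b}"
    using assms(2) by blast
  ultimately have "closure X \<subseteq> {x. cinner x a = cinner x b}"
    by (rule closure_minimal [rotated])
  then show "cinner x a = cinner x b"
    using assms(1) by blast
qed

section \<open>Orthogonal projections and the Riesz representation\<close>

lemma subspace_closure:
  fixes S :: "'a::real_normed_vector set"
  assumes "subspace S"
  shows "subspace (closure S)"
proof (rule subspaceI)
  show "0 \<in> closure S"
    using subspace_0 [OF assms] closure_subset by blast
  show "x + y \<in> closure S" if xy: "x \<in> closure S" "y \<in> closure S" for x y
  proof -
    obtain u v where "\<And>n. u n \<in> S" "u \<longlonglongrightarrow> x" "\<And>n. v n \<in> S" "v \<longlonglongrightarrow> y"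
      using xy unfolding closure_sequential by metis
    then show ?thesis
      unfolding closure_sequential
      by (intro exI [of _ "\<lambda>n. u n + v n"]) (auto intro: subspace_add [OF assms] tendsto_add)
  qed
  show "c *\<^sub>R x \<in> closure S" if x: "x \<in> closure S" for c x
  proof -
    obtain u where "\<And>n. u n \<in> S" "u \<longlonglongrightarrow> x"
      using x unfolding closure_sequential by metis
    then show ?thesis
      unfolding closure_sequential
      by (intro exI [of _ "\<lambda>n. c *\<^sub>R u n"]) (auto intro: subspace_scale [OF assms] tendsto_intros)
  qed
qed

text \<open>A minimizing sequence for the distance to \<open>V\<close> is Cauchy. Only the real
  structure enters, so the lemma serves \<open>riesz_real\<close> and \<open>amp_in_closure\<close>
  as well as the complex projection.\<close>

lemma hilbert_projection:
  fixes V :: "'a::{real_inner,complete_space} set"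
  assumes V: "subspace V" "closed V"
  obtains p where "p \<in> V" "\<And>v. v \<in> V \<Longrightarrow> inner v (x - p) = 0"
proof -
  define D where "D = (INF v\<in>V. (norm (x - v))\<^sup>2)"
  have bdd: "bdd_below ((\<lambda>v. (norm (x - v))\<^sup>2) ` V)"
    by (rule bdd_belowI [of _ 0]) auto
  have ne: "V \<noteq> {}"
    using subspace_0 [OF V(1)] by blast
  have D: "D \<le> (norm (x - v))\<^sup>2" if "v \<in> V" for v
    unfolding D_def by (rule cINF_lower [OF bdd that])
  have "\<exists>v\<in>V. (norm (x - v))\<^sup>2 < D + inverse (real (Suc n))" for n
    using cINF_less_iff [OF ne bdd, of "D + inverse (real (Suc n))"] by (simp add: D_def)
  then obtain v where v: "\<And>n. v n \<in> V" "\<And>n. (norm (x - v n))\<^sup>2 < D + inverse (real (Suc n))"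
    by metis
  have par: "(dist (v m) (v n))\<^sup>2 \<le> 2 * inverse (real (Suc m)) + 2 * inverse (real (Suc n))" for m n
  proof -
    \<comment> \<open>The midpoint lies in \<open>V\<close>, hence is no closer to \<open>x\<close>
      than \<open>D\<close> permits; the parallelogram law turns this into closeness of
      \<open>v m\<close> and \<open>v n\<close>.\<close>
    have "D \<le> (norm (x - (1/2) *\<^sub>R (v m + v n)))\<^sup>2"
      by (intro D subspace_scale subspace_add V v)
    moreover have "(dist (v m) (v n))\<^sup>2 + 4 * (norm (x - (1/2) *\<^sub>R (v m + v n)))\<^sup>2
        = 2 * (norm (x - v m))\<^sup>2 + 2 * (norm (x - v n))\<^sup>2"
      by (simp add: dist_norm power2_norm_eq_inner algebra_simps inner_commute)
    ultimately show ?thesis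
      using v(2) [of m] v(2) [of n] by linarith
  qed
  have "Cauchy v"
  proof (rule metric_CauchyI)
    fix e :: real
    assume "0 < e"
    then obtain N where N: "inverse (real (Suc N)) < e\<^sup>2 / 4"
      using reals_Archimedean by (metis zero_less_divide_iff zero_less_numeral zero_less_power)
    have "dist (v m) (v n) < e" if "N \<le> m" "N \<le> n" for m n
    proof -
      have "inverse (real (Suc m)) \<le> inverse (real (Suc N))"
        "inverse (real (Suc n)) \<le> inverse (real (Suc N))"
        using that by (auto intro!: le_imp_inverse_le)
      then have "(dist (v m) (v n))\<^sup>2 < e\<^sup>2"
        using par [of m n] N by linarith
      then show ?thesis
        using \<open>0 < e\<close> by (simp add: power2_less_imp_less)
    qed
    then show "\<exists>M. \<forall>m\<ge>M. \<forall>n\<ge>M. dist (v m) (v n) < e"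
      by blast
  qed
  then obtain p where p: "v \<longlonglongrightarrow> p"
    using Cauchy_convergent_iff convergent_def by blast
  have pV: "p \<in> V"
    using V(2) v(1) p closed_sequentially by blast
  have "(\<lambda>n. (norm (x - v n))\<^sup>2) \<longlonglongrightarrow> (norm (x - p))\<^sup>2"
    by (intro tendsto_intros p)
  moreover have "(\<lambda>n. D + inverse (real (Suc n))) \<longlonglongrightarrow> D + 0"
    by (intro tendsto_intros LIMSEQ_inverse_real_of_nat)
  ultimately have le: "(norm (x - p))\<^sup>2 \<le> D"
    unfolding add_0_right by (rule LIMSEQ_le) (use v(2) less_imp_le in blast)
  have "inner u (x - p) = 0" if u: "u \<in> V" for u
  proof (cases "u = 0")
    case False
    \<comment> \<open>This value minimizes the distance from \<open>x\<close> to
      \<open>p + t *\<^sub>R u\<close>, so a nonzero inner product would beat the minimum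
      \<open>D\<close>.\<close>
    define t where "t = inner u (x - p) / (norm u)\<^sup>2"
    have "(norm (x - p))\<^sup>2 \<le> (norm (x - (p + t *\<^sub>R u)))\<^sup>2"
      by (rule order_trans [OF le D]) (intro subspace_add subspace_scale V pV u)
    also have "\<dots> = (norm (x - p))\<^sup>2 - 2 * t * inner u (x - p) + t\<^sup>2 * (norm u)\<^sup>2"
      unfolding diff_diff_eq [symmetric] power2_norm_eq_inner
      by (simp add: inner_diff_left inner_diff_right inner_commute power2_eq_square algebra_simps)
    also have "\<dots> = (norm (x - p))\<^sup>2 - (inner u (x - p))\<^sup>2 / (norm u)\<^sup>2"
      using False by (simp add: t_def field_simps power2_eq_square)
    finally have "(inner u (x - p))\<^sup>2 / (norm u)\<^sup>2 \<le> 0"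
      by simp
    then show ?thesis
      using False by (simp add: divide_le_0_iff)
  qed simp
  then show thesis
    using that pV by blast
qed

lemma riesz_real:
  fixes f :: "'a::{real_inner,complete_space} \<Rightarrow> real"
  assumes f: "bounded_linear f"
  obtains h where "\<And>x. f x = inner h x"
proof (cases "\<forall>x. f x = 0")
  case True
  then show thesis
    using that [of 0] by simp
next
  case False
  interpret f: bounded_linear f by (rule f)
  obtain x0 where x0: "f x0 \<noteq> 0"
    using False by blast
  have "subspace {x. f x = 0}"
    by (auto simp: subspace_def f.add f.scaleR f.zero)
  moreover have "closed {x. f x = 0}"
    by (intro closed_Collect_eq continuous_intros linear_continuous_on f)
  ultimately obtain p where p: "f p = 0" "\<And>v. f v = 0 \<Longrightarrow> inner v (x0 - p) = 0"
    using hilbert_projection [of "{x. f x = 0}" x0] by auto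
  define w where "w = x0 - p"
  have fw: "f w \<noteq> 0"
    using x0 p by (simp add: w_def f.diff)
  then have w: "w \<noteq> 0"
    using f.zero by blast
  have "f x = inner ((f w / (norm w)\<^sup>2) *\<^sub>R w) x" for x
  proof -
    have "f (x - (f x / f w) *\<^sub>R w) = 0"
      using fw by (simp add: f.diff f.scaleR)
    then have "inner (x - (f x / f w) *\<^sub>R w) w = 0"
      using p(2) w_def by blast
    then have "inner w x = (f x / f w) * (norm w)\<^sup>2"
      by (simp add: inner_diff_left inner_diff_right inner_commute power2_norm_eq_inner)
    then show ?thesis
      using fw w by simp
  qed
  then show thesis
    using that by blast
qed

text \<open>A complex linear functional is determined by its real part: the imaginary part at x is
  minus the real part at \<i> x. The real Riesz vector therefore works unchanged.\<close>

lemma riesz_complex: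
  fixes f :: "'a::complex_hilbert_space \<Rightarrow> complex"
  assumes lin: "clinear_on UNIV f" and bound: "\<And>x. cmod (f x) \<le> K * norm x"
  obtains h where "\<And>x. f x = cinner h x"
proof -
  have add: "f (x + y) = f x + f y" and scale: "f (c *\<^sub>C x) = c * f x" for x y c
    using lin by (auto simp: clinear_on_def scaleC_complex_def)
  have "bounded_linear (\<lambda>x. Re (f x))"
  proof (rule bounded_linear_intro)
    show "Re (f (r *\<^sub>R x)) = r *\<^sub>R Re (f x)" for r x
      using scale [of "of_real r" x] by (simp add: scaleC_of_real)
    show "norm (Re (f x)) \<le> norm x * K" for x
      using bound [of x] abs_Re_le_cmod [of "f x"] by (simp add: mult.commute)
  qed (simp add: add)
  then obtain h where h: "\<And>x. Re (f x) = Re (cinner h x)"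
    using riesz_real by (metis inner_eq_Re_cinner)
  have "f x = cinner h x" for x
    using h [of x] h [of "\<i> *\<^sub>C x"] by (simp add: complex_eq_iff scale cinner_scaleC_right)
  then show thesis
    using that by blast
qed

section \<open>Bounded operators, adjoints and extension by continuity\<close>

lemma bounded_opsI:
  assumes "\<And>x y. blinfun_apply T (x + y) = blinfun_apply T x + blinfun_apply T y"
    and "\<And>c x. blinfun_apply T (c *\<^sub>C x) = c *\<^sub>C blinfun_apply T x"
  shows "T \<in> bounded_ops"
  using assms by (simp add: bounded_ops_def clinear_on_def)

lemma bounded_ops_scaleC: "T \<in> bounded_ops \<Longrightarrow> blinfun_apply T (c *\<^sub>C x) = c *\<^sub>C blinfun_apply T x"
  by (simp add: bounded_ops_def clinear_on_def)

text \<open>Source of both adjoints and slices. Riesz is applied to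
  \<open>\<lambda>x. cnj (B x y)\<close>, because \<open>B\<close> is conjugate-linear in its first
  argument.\<close>

lemma sesquilinear_op:
  fixes B :: "'a::complex_hilbert_space \<Rightarrow> 'a \<Rightarrow> complex"
  assumes add_left: "\<And>x y z. B (x + y) z = B x z + B y z"
    and add_right: "\<And>x y z. B x (y + z) = B x y + B x z"
    and scale_left: "\<And>c x y. B (c *\<^sub>C x) y = cnj c * B x y"
    and scale_right: "\<And>c x y. B x (c *\<^sub>C y) = c * B x y"
    and bound: "\<And>x y. cmod (B x y) \<le> K * norm x * norm y"
  obtains T where "T \<in> bounded_ops" "\<And>x y. cinner x (blinfun_apply T y) = B x y"
proof -
  have "\<exists>h. \<forall>x. cinner x h = B x y" for y
  proof -
    have "clinear_on UNIV (\<lambda>x. cnj (B x y))"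
      by (simp add: clinear_on_def scaleC_complex_def add_left scale_left)
    moreover have "cmod (cnj (B x y)) \<le> (K * norm y) * norm x" for x
      using bound [of x y] by (simp add: mult_ac)
    ultimately obtain h where "\<And>x. cnj (B x y) = cinner h x"
      using riesz_complex by blast
    then have "\<forall>x. cinner x h = B x y"
      by (metis cinner_commute complex_cnj_cnj)
    then show ?thesis ..
  qed
  then obtain h where h: "\<And>x y. cinner x (h y) = B x y"
    by metis
  have add: "h (x + y) = h x + h y" for x y
    by (rule cinner_eqI) (simp add: h add_right cinner_add_right)
  have scale: "h (c *\<^sub>C x) = c *\<^sub>C h x" for c x
    by (rule cinner_eqI) (simp add: h scale_right cinner_scaleC_right)
  have "norm (h y) \<le> norm y * K" for y
  proof -
    have "norm (h y) * norm (h y) \<le> (K * norm y) * norm (h y)"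
      using bound [of "h y" y] cinner_self [of "h y"]
      by (simp add: h power2_eq_square mult_ac norm_mult flip: of_real_mult)
    then show ?thesis
    proof (cases "norm (h y) = 0")
      case True
      \<comment> \<open>\<open>K\<close> is not assumed nonnegative; the needed sign comes from the
        bound at the pair \<open>y\<close>, \<open>y\<close>.\<close>
      have "0 \<le> K * norm y * norm y"
        using bound [of y y] norm_ge_zero order_trans by blast
      then show ?thesis
        using True by (cases "y = 0") (auto simp: zero_le_mult_iff)
    qed (simp add: mult.commute)
  qed
  then have "bounded_linear h"
    by (intro bounded_linear_intro [where K = K] add)
      (simp_all flip: scaleC_of_real add: scale)
  then have "blinfun_apply (Blinfun h) = h"
    by (rule bounded_linear_Blinfun_apply)
  then show thesis
    by (intro that [of "Blinfun h"] bounded_opsI) (simp_all add: add scale h)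
qed

lemma adj_ex:
  assumes T: "T \<in> bounded_ops"
  shows "\<exists>S. S \<in> bounded_ops \<and>
    (\<forall>x y. cinner (blinfun_apply S x) y = cinner x (blinfun_apply T y))"
proof -
  obtain S where "S \<in> bounded_ops"
    "\<And>x y. cinner x (blinfun_apply S y) = cinner (blinfun_apply T x) y"
  proof (rule sesquilinear_op [of "\<lambda>x y. cinner (blinfun_apply T x) y" "norm T"])
    show "cmod (cinner (blinfun_apply T x) y) \<le> norm T * norm x * norm y" for x y
      by (meson cmod_cinner_le mult_right_mono norm_blinfun norm_ge_zero order_trans)
  qed (simp_all add: bounded_ops_scaleC [OF T] cinner_add_left cinner_add_right
        cinner_scaleC_left cinner_scaleC_right blinfun.add_right)
  then have "cinner (blinfun_apply S x) y = cinner x (blinfun_apply T y)" for x y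
    using cinner_commute [of "blinfun_apply S x" y] cinner_commute [of x "blinfun_apply T y"]
    by simp
  then show ?thesis
    using \<open>S \<in> bounded_ops\<close> by blast
qed

lemma adj_unique:
  assumes "\<And>x y. cinner (blinfun_apply S x) y = cinner x (blinfun_apply T y)"
  shows "adj T = S"
  unfolding adj_def
proof (rule the_equality)
  fix S'
  assume "\<forall>x y. cinner (blinfun_apply S' x) y = cinner x (blinfun_apply T y)"
  then show "S' = S"
    by (intro blinfun_eqI, intro cinner_eqI_left [where 'a = 'a]) (simp add: assms)
qed (use assms in blast)

lemma adj_in_bounded_ops: "T \<in> bounded_ops \<Longrightarrow> adj T \<in> bounded_ops"
  using adj_ex adj_unique by metis

lemma cinner_adj_left:
  "T \<in> bounded_ops \<Longrightarrow> cinner (blinfun_apply (adj T) x) y = cinner x (blinfun_apply T y)"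
  using adj_ex adj_unique by metis

lemma cinner_adj_right:
  "T \<in> bounded_ops \<Longrightarrow> cinner x (blinfun_apply (adj T) y) = cinner (blinfun_apply T x) y"
  by (metis cinner_adj_left cinner_commute)

lemma adj_adj: "T \<in> bounded_ops \<Longrightarrow> adj (adj T) = T"
  by (rule adj_unique) (simp add: cinner_adj_right)

text \<open>The data is a relation, so no well-definedness has to be shown in advance: the bound
  applied to a difference (0, y - y') makes the closure of \<open>G\<close> single-valued. This
  suits maps prescribed on sums of elementary tensors or on vectors \<open>\<gamma> a\<close>, whose
  representations are not unique.\<close>

lemma extend_bounded_relation:
  fixes G :: "('a::complex_hilbert_space \<times> 'b::complex_hilbert_space) set"
  assumes add: "\<And>x y x' y'. (x, y) \<in> G \<Longrightarrow> (x', y') \<in> G \<Longrightarrow> (x + x', y + y') \<in> G"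
    and scale: "\<And>c x y. (x, y) \<in> G \<Longrightarrow> (c *\<^sub>C x, c *\<^sub>C y) \<in> G"
    and bound: "\<And>x y. (x, y) \<in> G \<Longrightarrow> norm y \<le> K * norm x"
    and dense: "closure (fst ` G) = UNIV"
  obtains T where "clinear_on UNIV (blinfun_apply T)" "\<And>x y. (x, y) \<in> G \<Longrightarrow> blinfun_apply T x = y"
    "\<And>x. norm (blinfun_apply T x) \<le> K * norm x"
proof -
  have diff: "(x - x', y - y') \<in> G" if "(x, y) \<in> G" "(x', y') \<in> G" for x x' y y'
    using add [OF that(1) scale [OF that(2), of "-1"]] by (simp add: scaleC.minus_left)
  have seq: "(x, y) \<in> closure G \<longleftrightarrow>
      (\<exists>u v. (\<forall>n. (u n, v n) \<in> G) \<and> u \<longlonglongrightarrow> x \<and> v \<longlonglongrightarrow> y)" for x y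
  proof
    assume "(x, y) \<in> closure G"
    then obtain z where "\<forall>n. z n \<in> G" "z \<longlonglongrightarrow> (x, y)"
      by (auto simp: closure_sequential)
    then show "\<exists>u v. (\<forall>n. (u n, v n) \<in> G) \<and> u \<longlonglongrightarrow> x \<and> v \<longlonglongrightarrow> y"
      by (intro exI [of _ "\<lambda>n. fst (z n)"] exI [of _ "\<lambda>n. snd (z n)"])
        (auto dest: tendsto_fst tendsto_snd)
  next
    assume "\<exists>u v. (\<forall>n. (u n, v n) \<in> G) \<and> u \<longlonglongrightarrow> x \<and> v \<longlonglongrightarrow> y"
    then obtain u v where "\<And>n. (u n, v n) \<in> G" "u \<longlonglongrightarrow> x" "v \<longlonglongrightarrow> y"
      by blast
    then show "(x, y) \<in> closure G"
      unfolding closure_sequential by (intro exI [of _ "\<lambda>n. (u n, v n)"] conjI tendsto_Pair) auto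
  qed
  have add': "(x + x', y + y') \<in> closure G"
    if xy: "(x, y) \<in> closure G" "(x', y') \<in> closure G" for x x' y y'
  proof -
    obtain u v where "\<And>n. (u n, v n) \<in> G" "u \<longlonglongrightarrow> x" "v \<longlonglongrightarrow> y"
      using xy(1) unfolding seq by blast
    moreover obtain u' v' where "\<And>n. (u' n, v' n) \<in> G" "u' \<longlonglongrightarrow> x'" "v' \<longlonglongrightarrow> y'"
      using xy(2) unfolding seq by blast
    ultimately show ?thesis
      unfolding seq
      by (intro exI [of _ "\<lambda>n. u n + u' n"] exI [of _ "\<lambda>n. v n + v' n"])
        (auto intro: add tendsto_add)
  qed
  have scale': "(c *\<^sub>C x, c *\<^sub>C y) \<in> closure G" if xy: "(x, y) \<in> closure G" for c x y
  proof -
    obtain u v where "\<And>n. (u n, v n) \<in> G" "u \<longlonglongrightarrow> x" "v \<longlonglongrightarrow> y"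
      using xy unfolding seq by blast
    then show ?thesis
      unfolding seq
      by (intro exI [of _ "\<lambda>n. c *\<^sub>C u n"] exI [of _ "\<lambda>n. c *\<^sub>C v n"])
        (auto intro: scale scaleC.tendsto tendsto_const)
  qed
  have bound': "norm y \<le> K * norm x" if "(x, y) \<in> closure G" for x y
  proof -
    obtain u v where uv: "\<And>n. (u n, v n) \<in> G" "u \<longlonglongrightarrow> x" "v \<longlonglongrightarrow> y"
      using \<open>(x, y) \<in> closure G\<close> unfolding seq by blast
    show ?thesis
    proof (rule LIMSEQ_le)
      show "(\<lambda>n. norm (v n)) \<longlonglongrightarrow> norm y" "(\<lambda>n. K * norm (u n)) \<longlonglongrightarrow> K * norm x"
        by (intro tendsto_intros uv)+
    qed (use bound uv in blast)
  qed
  have uniq: "y = y'" if "(x, y) \<in> closure G" "(x, y') \<in> closure G" for x y y'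
    using bound' [OF add' [OF that(1) scale' [OF that(2), of "-1"]]]
    by (simp add: scaleC.minus_left)
  have ex: "\<exists>y. (x, y) \<in> closure G" for x
  proof -
    have "x \<in> closure (fst ` G)"
      using dense by simp
    then obtain u where u: "\<And>n. u n \<in> fst ` G" "u \<longlonglongrightarrow> x"
      by (auto simp: closure_sequential)
    have "\<exists>y. (u n, y) \<in> G" for n
      using u(1) [of n] by auto
    then obtain v where v: "\<And>n. (u n, v n) \<in> G"
      by metis
    have "Cauchy v"
    proof (rule metric_CauchyI)
      fix e :: real
      assume "0 < e"
      \<comment> \<open>\<open>\<bar>K\<bar> + 1\<close> is a positive substitute for
        \<open>K\<close>, which may be zero or negative.\<close>
      then have "0 < e / (\<bar>K\<bar> + 1)"
        by (simp add: field_simps add_nonneg_pos)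
      then obtain M where M: "\<And>m n. M \<le> m \<Longrightarrow> M \<le> n \<Longrightarrow> dist (u m) (u n) < e / (\<bar>K\<bar> + 1)"
        using metric_CauchyD [OF LIMSEQ_imp_Cauchy [OF u(2)]] by metis
      have "dist (v m) (v n) < e" if "M \<le> m" "M \<le> n" for m n
      proof -
        have "dist (v m) (v n) \<le> K * dist (u m) (u n)"
          unfolding dist_norm by (intro bound diff v)
        also have "\<dots> \<le> (\<bar>K\<bar> + 1) * dist (u m) (u n)"
          by (intro mult_right_mono) auto
        also have "\<dots> < e"
          using M [OF that] by (simp add: pos_less_divide_eq mult.commute add_nonneg_pos)
        finally show ?thesis .
      qed
      then show "\<exists>M. \<forall>m\<ge>M. \<forall>n\<ge>M. dist (v m) (v n) < e"
        by blast
    qed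
    then obtain y where "v \<longlonglongrightarrow> y"
      using Cauchy_convergent_iff convergent_def by blast
    then show ?thesis
      unfolding seq using u v by blast
  qed
  define f where "f x = (THE y. (x, y) \<in> closure G)" for x
  have f: "(x, f x) \<in> closure G" for x
    unfolding f_def by (rule theI') (use ex uniq in blast)
  have f_add: "f (x + y) = f x + f y" for x y
    by (rule uniq [OF f add' [OF f f]])
  have f_scale: "f (c *\<^sub>C x) = c *\<^sub>C f x" for c x
    by (rule uniq [OF f scale' [OF f]])
  have "bounded_linear f"
    by (intro bounded_linear_intro [where K = K] f_add)
      (use bound' [OF f] in \<open>simp_all flip: scaleC_of_real add: f_scale mult.commute\<close>)
  then have "blinfun_apply (Blinfun f) = f"
    by (rule bounded_linear_Blinfun_apply)
  moreover have "f x = y" if "(x, y) \<in> G" for x y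
    using uniq [OF f] that closure_subset by blast
  ultimately show thesis
    by (intro that [of "Blinfun f"]) (simp_all add: clinear_on_def f_add f_scale bound' f)
qed

section \<open>A weak mean ergodic theorem\<close>

text \<open>The bound \<open>K\<close> is uniform in \<open>i\<close>, so weak convergence to 0
  passes from total sets to their closures in both arguments.\<close>

lemma weak_null_closure:
  fixes S :: "'i \<Rightarrow> 'h::complex_hilbert_space \<Rightarrow>\<^sub>L 'h"
  assumes bound: "\<And>i z. norm (blinfun_apply (S i) z) \<le> K * norm z" and K: "0 \<le> K"
    and null: "\<And>x z. x \<in> X \<Longrightarrow> z \<in> Z \<Longrightarrow> ((\<lambda>i. cinner x (blinfun_apply (S i) z)) \<longlongrightarrow> 0) F"
    and x: "x \<in> closure X" and z: "z \<in> closure Z"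
  shows "((\<lambda>i. cinner x (blinfun_apply (S i) z)) \<longlongrightarrow> 0) F"
proof (rule tendstoI)
  fix e :: real
  assume e: "0 < e"
  \<comment> \<open>\<open>x'\<close> is chosen first because the tolerance for \<open>z'\<close>
    depends on \<open>norm x'\<close>; the summand 1 keeps both denominators positive.\<close>
  have "0 < e / 3 / (K * norm z + 1)"
    using e K by (intro divide_pos_pos add_nonneg_pos mult_nonneg_nonneg) auto
  then obtain x' where x': "x' \<in> X" "dist x' x < e / 3 / (K * norm z + 1)"
    using x unfolding closure_approachable by blast
  have "0 < e / 3 / (norm x' * K + 1)"
    using e K by (intro divide_pos_pos add_nonneg_pos mult_nonneg_nonneg) auto
  then obtain z' where z': "z' \<in> Z" "dist z' z < e / 3 / (norm x' * K + 1)"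
    using z unfolding closure_approachable by blast
  have 1: "norm (x - x') * (K * norm z) \<le> e / 3"
  proof -
    have "norm (x - x') * (K * norm z) \<le> norm (x - x') * (K * norm z + 1)"
      by (intro mult_left_mono) auto
    also have "\<dots> \<le> e / 3"
      using x'(2) K
      by (subst pos_le_divide_eq [symmetric])
        (auto simp: add_nonneg_pos dist_norm norm_minus_commute)
    finally show ?thesis .
  qed
  have 2: "norm x' * (K * norm (z - z')) \<le> e / 3"
  proof -
    have "norm x' * (K * norm (z - z')) \<le> norm (z - z') * (norm x' * K + 1)"
      by (simp add: algebra_simps)
    also have "\<dots> \<le> e / 3"
      using z'(2) K
      by (subst pos_le_divide_eq [symmetric])
        (auto simp: add_nonneg_pos dist_norm norm_minus_commute)
    finally show ?thesis .
  qed
  have "\<forall>\<^sub>F i in F. dist (cinner x' (blinfun_apply (S i) z')) 0 < e / 3"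
    using null [OF x'(1) z'(1)] e by (intro tendstoD) auto
  then show "\<forall>\<^sub>F i in F. dist (cinner x (blinfun_apply (S i) z)) 0 < e"
  proof eventually_elim
    case (elim i)
    have "cinner x (blinfun_apply (S i) z) = cinner (x - x') (blinfun_apply (S i) z)
        + cinner x' (blinfun_apply (S i) (z - z')) + cinner x' (blinfun_apply (S i) z')"
      by (simp add: cinner.diff_left cinner.diff_right blinfun.diff_right)
    then have "cmod (cinner x (blinfun_apply (S i) z)) \<le> cmod (cinner (x - x') (blinfun_apply (S i) z))
        + cmod (cinner x' (blinfun_apply (S i) (z - z'))) + cmod (cinner x' (blinfun_apply (S i) z'))"
      by (metis norm_triangle_mono norm_triangle_ineq order_refl)
    moreover have "cmod (cinner (x - x') (blinfun_apply (S i) z)) \<le> norm (x - x') * (K * norm z)"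
      by (rule order_trans [OF cmod_cinner_le]) (intro mult_left_mono bound norm_ge_zero)
    moreover have "cmod (cinner x' (blinfun_apply (S i) (z - z'))) \<le> norm x' * (K * norm (z - z'))"
      by (rule order_trans [OF cmod_cinner_le]) (intro mult_left_mono bound norm_ge_zero)
    ultimately show ?case
      using 1 2 elim by simp
  qed
qed

text \<open>Real orthogonality to \<open>v\<close> and to \<i> \<open>v\<close> kills the real and
  the imaginary part of the complex inner product.\<close>

lemma hilbert_projection_complex:
  fixes V :: "'a::complex_hilbert_space set"
  assumes V: "subspace V" "closed V" and scale: "\<And>c v. v \<in> V \<Longrightarrow> c *\<^sub>C v \<in> V"
  obtains p where "p \<in> V" "\<And>v. v \<in> V \<Longrightarrow> cinner v (x - p) = 0"
proof -
  obtain p where p: "p \<in> V" "\<And>v. v \<in> V \<Longrightarrow> inner v (x - p) = 0"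
    using hilbert_projection [OF V] by blast
  have "cinner v (x - p) = 0" if "v \<in> V" for v
    using p(2) [OF that] p(2) [OF scale [OF that, of \<i>]]
    by (simp add: inner_eq_Re_cinner cinner_scaleC_left complex_eq_iff)
  then show thesis
    using that p by blast
qed

lemma orth_proj_eq:
  assumes V: "subspace V" and p: "p \<in> V" "\<And>v. v \<in> V \<Longrightarrow> cinner v (x - p) = 0"
  shows "orth_proj V x = p"
  unfolding orth_proj_def
proof (rule the_equality)
  fix q
  assume q: "q \<in> V \<and> (\<forall>v\<in>V. cinner v (x - q) = 0)"
  have "q - p \<in> V"
    using V q p by (simp add: subspace_diff)
  then have "cinner (q - p) (x - p) = 0" "cinner (q - p) (x - q) = 0"
    using q p by auto
  then have "cinner (q - p) (q - p) = 0"
    by (simp add: cinner.diff_right)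
  then show "q = p"
    by (simp add: cinner_self)
qed (use p in blast)

text \<open>For a contraction \<open>T\<close>, orthogonality of \<open>v\<close> to \<open>T v - v\<close> forces \<open>T v = v\<close>; hence the orthogonal
  complement of all the ranges of \<open>T - 1\<close> consists of common fixed points.\<close>

lemma weak_mean_ergodic:
  fixes T :: "'t \<Rightarrow> 'h::complex_hilbert_space \<Rightarrow>\<^sub>L 'h"
  assumes op: "\<And>\<theta>. \<theta> \<in> \<Theta> \<Longrightarrow> T \<theta> \<in> bounded_ops"
    and contr: "\<And>\<theta> x. \<theta> \<in> \<Theta> \<Longrightarrow> norm (blinfun_apply (T \<theta>) x) \<le> norm x"
    and \<phi>: "\<And>i. \<phi> i \<in> \<Theta>"
    and null: "\<And>\<theta> x y. \<theta> \<in> \<Theta> \<Longrightarrow>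
      ((\<lambda>i. cinner x (blinfun_apply (T (\<phi> i)) (blinfun_apply (T \<theta>) y - y))) \<longlongrightarrow> 0) F"
  shows "((\<lambda>i. cinner x (blinfun_apply (T (\<phi> i)) y)) \<longlongrightarrow>
    cinner x (orth_proj {x. \<forall>\<theta>\<in>\<Theta>. blinfun_apply (T \<theta>) x = x} y)) F"
proof -
  define V where "V = {x. \<forall>\<theta>\<in>\<Theta>. blinfun_apply (T \<theta>) x = x}"
  have V: "subspace V"
    by (auto simp: V_def subspace_def blinfun.add_right blinfun.scaleR_right)
  have "V = (\<Inter>\<theta>\<in>\<Theta>. {x. blinfun_apply (T \<theta>) x = x})"
    by (auto simp: V_def)
  then have clV: "closed V"
    by (auto intro!: closed_Collect_eq continuous_intros blinfun.continuous_on)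
  have "c *\<^sub>C v \<in> V" if "v \<in> V" for c v
    using that by (simp add: V_def bounded_ops_scaleC op)
  then obtain p where p: "p \<in> V" "\<And>v. v \<in> V \<Longrightarrow> cinner v (y - p) = 0"
    using hilbert_projection_complex [OF V clV] by blast
  define D where "D = {blinfun_apply (T \<theta>) y - y | \<theta> y. \<theta> \<in> \<Theta>}"
  \<comment> \<open>This is a real span, but \<open>D\<close> is stable under complex scalars, so
    \<open>N\<close> and its closure are complex subspaces.\<close>
  define N where "N = span D"
  have D_scale: "c *\<^sub>C d \<in> D" if d: "d \<in> D" for c d
  proof -
    obtain \<theta> y where "\<theta> \<in> \<Theta>" "d = blinfun_apply (T \<theta>) y - y"
      using d by (auto simp: D_def)
    then have "c *\<^sub>C d = blinfun_apply (T \<theta>) (c *\<^sub>C y) - c *\<^sub>C y"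
      by (simp add: bounded_ops_scaleC op scaleC.diff_right)
    then show ?thesis
      using \<open>\<theta> \<in> \<Theta>\<close> by (auto simp: D_def)
  qed
  have N_scale: "c *\<^sub>C d \<in> N" if "d \<in> N" for c d
    using that unfolding N_def
  proof (induction rule: span_induct_alt)
    case (step r x z)
    then show ?case
      by (simp add: scaleC_add_right scaleC.scaleR_right span_add span_scale span_base D_scale)
  qed (simp add: span_zero scaleC.zero_right)
  have sN: "subspace (closure N)"
    unfolding N_def by (intro subspace_closure subspace_span)
  have "c *\<^sub>C d \<in> closure N" if d: "d \<in> closure N" for c d
  proof -
    obtain u where "\<And>n. u n \<in> N" "u \<longlonglongrightarrow> d"
      using d unfolding closure_sequential by metis
    then show ?thesis
      unfolding closure_sequential
      by (intro exI [of _ "\<lambda>n. c *\<^sub>C u n"]) (auto intro!: N_scale tendsto_intros scaleC.tendsto)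
  qed
  then obtain q where q: "q \<in> closure N" "\<And>v. v \<in> closure N \<Longrightarrow> cinner v ((y - p) - q) = 0"
    using hilbert_projection_complex [OF sN closed_closure] by blast
  define v where "v = y - p - q"
  have "blinfun_apply (T \<theta>) v = v" if \<theta>: "\<theta> \<in> \<Theta>" for \<theta>
  proof -
    have "blinfun_apply (T \<theta>) v - v \<in> closure N"
      using \<theta> closure_subset [of N] span_base [of _ D] by (auto simp: D_def N_def)
    then have "cinner (blinfun_apply (T \<theta>) v - v) v = 0"
      using q(2) v_def by blast
    then have "inner (blinfun_apply (T \<theta>) v) v = (norm v)\<^sup>2"
      by (simp add: inner_eq_Re_cinner cinner.diff_left cinner_self)
    \<comment> \<open>Expanding the square, the cross term contributes minus twice the square of
      \<open>norm v\<close> by the preceding identity.\<close>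
    then have "(norm (blinfun_apply (T \<theta>) v - v))\<^sup>2 = (norm (blinfun_apply (T \<theta>) v))\<^sup>2 - (norm v)\<^sup>2"
      by (simp add: power2_norm_eq_inner inner_diff_left inner_diff_right inner_commute)
    also have "\<dots> \<le> 0"
      using contr [OF \<theta>] by (simp add: power_mono)
    finally show ?thesis
      by simp
  qed
  then have "v \<in> V"
    by (simp add: V_def)
  \<comment> \<open>The remainder \<open>v\<close> is orthogonal to \<open>y - p\<close> as an
    element of \<open>V\<close>, and to \<open>q\<close> as \<open>q\<close> lies in the closure of
    \<open>N\<close>; so it is orthogonal to itself and \<open>y - p = q\<close>.\<close>
  then have "cinner v (y - p) = 0"
    by (rule p(2))
  moreover have "cinner v q = 0"
    using q(2) [OF q(1)] by (metis cinner_commute complex_cnj_zero v_def)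
  ultimately have "cinner v v = 0"
    by (simp add: v_def cinner.diff_right)
  then have yp: "y - p = q"
    by (simp add: cinner_self v_def)
  have N_null: "((\<lambda>i. cinner x (blinfun_apply (T (\<phi> i)) z)) \<longlongrightarrow> 0) F" if "z \<in> N" for x z
    using that unfolding N_def
  proof (induction rule: span_induct_alt)
    case (step r d z)
    then obtain \<theta> u where "\<theta> \<in> \<Theta>" "d = blinfun_apply (T \<theta>) u - u"
      by (auto simp: D_def)
    then have "((\<lambda>i. r *\<^sub>R cinner x (blinfun_apply (T (\<phi> i)) d)
        + cinner x (blinfun_apply (T (\<phi> i)) z)) \<longlongrightarrow> r *\<^sub>R 0 + 0) F"
      using null step.IH by (intro tendsto_intros) auto
    then show ?case
      by (simp add: blinfun.add_right blinfun.scaleR_right cinner.add_right cinner.scaleR_right)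
  qed simp
  have "((\<lambda>i. cinner x (blinfun_apply (T (\<phi> i)) (y - p))) \<longlongrightarrow> 0) F"
    unfolding yp
    by (rule weak_null_closure [of "\<lambda>i. T (\<phi> i)" 1 UNIV N])
      (simp_all add: contr \<phi> N_null q(1))
  moreover have "blinfun_apply (T (\<phi> i)) p = p" for i
    using p(1) \<phi> by (simp add: V_def)
  ultimately have "((\<lambda>i. cinner x (blinfun_apply (T (\<phi> i)) y) - cinner x p) \<longlongrightarrow> 0) F"
    by (simp add: blinfun.diff_right cinner.diff_right)
  moreover have "orth_proj V y = p"
    by (rule orth_proj_eq [OF V p])
  ultimately show ?thesis
    by (simp add: LIM_zero_cancel flip: V_def)
qed

section \<open>Square-summable families\<close>

text \<open>Unordered summation permits arbitrary index types: sum types serve to join families,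
  product types to tensor them.\<close>

definition sq_summable :: "('i \<Rightarrow> 'a::real_normed_vector) \<Rightarrow> bool" where
  "sq_summable f \<longleftrightarrow> (\<lambda>i. (norm (f i))\<^sup>2) summable_on UNIV"

lemma sq_summable_zero: "sq_summable (\<lambda>i. 0)"
  by (simp add: sq_summable_def)

lemma sq_summable_bounded:
  assumes "sq_summable f" and "\<And>i. norm (g i) \<le> K * norm (f i)"
  shows "sq_summable g"
  unfolding sq_summable_def
proof (rule summable_on_comparison_test)
  show "(\<lambda>i. K\<^sup>2 * (norm (f i))\<^sup>2) summable_on UNIV"
    using assms(1) by (intro summable_on_cmult_right) (simp add: sq_summable_def)
  show "(norm (g i))\<^sup>2 \<le> K\<^sup>2 * (norm (f i))\<^sup>2" for i
    using power_mono [OF assms(2) norm_ge_zero, where n = 2] by (simp add: power_mult_distrib)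
qed auto

lemma sq_summable_blinfun: "sq_summable f \<Longrightarrow> sq_summable (\<lambda>i. blinfun_apply T (f i))"
  by (erule sq_summable_bounded) (rule norm_blinfun)

lemma sq_summable_scaleC: "sq_summable f \<Longrightarrow> sq_summable (\<lambda>i. c *\<^sub>C (f i :: _::complex_hilbert_space))"
  by (erule sq_summable_bounded [where K = "cmod c"]) (simp add: norm_scaleC)

lemma sq_summable_scaleR: "sq_summable f \<Longrightarrow> sq_summable (\<lambda>i. r *\<^sub>R f i)"
  by (erule sq_summable_bounded [where K = "\<bar>r\<bar>"]) simp

lemma sq_summable_add:
  assumes "sq_summable f" "sq_summable g"
  shows "sq_summable (\<lambda>i. f i + g i)"
  unfolding sq_summable_def
proof (rule summable_on_comparison_test)
  show "(\<lambda>i. 2 * (norm (f i))\<^sup>2 + 2 * (norm (g i))\<^sup>2) summable_on UNIV"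
    using assms by (intro summable_on_add summable_on_cmult_right) (simp_all add: sq_summable_def)
  show "(norm (f i + g i))\<^sup>2 \<le> 2 * (norm (f i))\<^sup>2 + 2 * (norm (g i))\<^sup>2" for i
  proof -
    have "(norm (f i + g i))\<^sup>2 \<le> (norm (f i) + norm (g i))\<^sup>2"
      by (intro power_mono norm_triangle_ineq norm_ge_zero)
    also have "\<dots> \<le> 2 * (norm (f i))\<^sup>2 + 2 * (norm (g i))\<^sup>2"
      using zero_le_power2 [of "norm (f i) - norm (g i)"]
      by (simp add: power2_eq_square algebra_simps)
    finally show ?thesis .
  qed
qed auto

lemma sq_summable_uminus: "sq_summable f \<Longrightarrow> sq_summable (\<lambda>i. - f i)"
  by (simp add: sq_summable_def)

lemma sq_summable_diff: "sq_summable f \<Longrightarrow> sq_summable g \<Longrightarrow> sq_summable (\<lambda>i. f i - g i)"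
  using sq_summable_add [OF _ sq_summable_uminus] by fastforce

lemma sq_summable_norm_mult:
  assumes "sq_summable f" "sq_summable g"
  shows "(\<lambda>i. norm (f i) * norm (g i)) summable_on UNIV"
proof (rule summable_on_comparison_test)
  show "(\<lambda>i. (norm (f i))\<^sup>2 + (norm (g i))\<^sup>2) summable_on UNIV"
    using assms by (intro summable_on_add) (simp_all add: sq_summable_def)
  show "norm (f i) * norm (g i) \<le> (norm (f i))\<^sup>2 + (norm (g i))\<^sup>2" for i
    using sum_squares_bound [of "norm (f i)" "norm (g i)"]
      mult_nonneg_nonneg [OF norm_ge_zero [of "f i"] norm_ge_zero [of "g i"]]
    by linarith
qed auto

lemma sq_summable_inner:
  assumes "sq_summable f" "sq_summable g"
  shows "(\<lambda>i. inner (f i) (g i)) summable_on UNIV"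
proof -
  have "(\<lambda>i. norm (inner (f i) (g i))) summable_on UNIV"
    by (rule summable_on_comparison_test [OF sq_summable_norm_mult [OF assms]])
      (auto simp: Cauchy_Schwarz_ineq2)
  then show ?thesis
    by (rule abs_summable_summable)
qed

text \<open>The Hilbert sum of copies of \<open>'a\<close>. In it a sum of vector functionals
  becomes one inner product, so projections, Cauchy-Schwarz and limits apply directly.\<close>

typedef (overloaded) ('i, 'a::real_normed_vector) ell2 = "{f :: 'i \<Rightarrow> 'a. sq_summable f}"
  using sq_summable_zero by blast

setup_lifting type_definition_ell2

instantiation ell2 :: (type, real_inner) real_inner
begin

lift_definition zero_ell2 :: "('a, 'b) ell2" is "\<lambda>i. 0"
  by (rule sq_summable_zero)
lift_definition plus_ell2 :: "('a, 'b) ell2 \<Rightarrow> ('a, 'b) ell2 \<Rightarrow> ('a, 'b) ell2" is "\<lambda>f g i. f i + g i"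
  by (rule sq_summable_add)
lift_definition uminus_ell2 :: "('a, 'b) ell2 \<Rightarrow> ('a, 'b) ell2" is "\<lambda>f i. - f i"
  by (rule sq_summable_uminus)
lift_definition minus_ell2 :: "('a, 'b) ell2 \<Rightarrow> ('a, 'b) ell2 \<Rightarrow> ('a, 'b) ell2" is "\<lambda>f g i. f i - g i"
  by (rule sq_summable_diff)
lift_definition scaleR_ell2 :: "real \<Rightarrow> ('a, 'b) ell2 \<Rightarrow> ('a, 'b) ell2" is "\<lambda>r f i. r *\<^sub>R f i"
  by (rule sq_summable_scaleR)
lift_definition inner_ell2 :: "('a, 'b) ell2 \<Rightarrow> ('a, 'b) ell2 \<Rightarrow> real" is
  "\<lambda>f g. \<Sum>\<^sub>\<infinity>i. inner (f i) (g i)" .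

definition "norm_ell2 (x :: ('a, 'b) ell2) = sqrt (inner x x)"
definition "sgn_ell2 (x :: ('a, 'b) ell2) = scaleR (inverse (norm x)) x"
definition "dist_ell2 (x :: ('a, 'b) ell2) y = norm (x - y)"
definition "uniformity_ell2 =
  (INF e\<in>{0<..}. principal {(x :: ('a, 'b) ell2, y). dist x y < e})"
definition "open_ell2 (U :: ('a, 'b) ell2 set) \<longleftrightarrow>
  (\<forall>x\<in>U. eventually (\<lambda>(x', y). x' = x \<longrightarrow> y \<in> U) uniformity)"

instance
proof
  fix x y z :: "('a, 'b) ell2" and r s :: real
  show "x + y + z = x + (y + z)" "x + y = y + x" "0 + x = x" "- x + x = 0" "x - y = x + - y"
    by (transfer; simp add: algebra_simps)+
  show "r *\<^sub>R (x + y) = r *\<^sub>R x + r *\<^sub>R y" "(r + s) *\<^sub>R x = r *\<^sub>R x + s *\<^sub>R x"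
    "r *\<^sub>R s *\<^sub>R x = (r * s) *\<^sub>R x" "1 *\<^sub>R x = x"
    by (transfer; simp add: algebra_simps)+
  show "inner x y = inner y x"
    by transfer (simp add: inner_commute)
  show "inner (x + y) z = inner x z + inner y z"
    by transfer (simp add: inner_add_left infsum_add sq_summable_inner)
  show "inner (r *\<^sub>R x) y = r * inner x y"
    by transfer (simp add: infsum_cmult_right sq_summable_inner)
  show "0 \<le> inner x x"
    by transfer (simp add: infsum_nonneg)
  show "inner x x = 0 \<longleftrightarrow> x = 0"
  proof transfer
    fix f :: "'a \<Rightarrow> 'b"
    assume f: "sq_summable f"
    have *: "inner (f i) (f i) = 0" if "(\<Sum>\<^sub>\<infinity>i. inner (f i) (f i)) = 0" for i
      using nonneg_infsum_le_0D [of "\<lambda>i. inner (f i) (f i)" UNIV i] that sq_summable_inner [OF f f]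
      by simp
    show "((\<Sum>\<^sub>\<infinity>i. inner (f i) (f i)) = 0) = (f = (\<lambda>i. 0))"
    proof
      show "f = (\<lambda>i. 0)" if "(\<Sum>\<^sub>\<infinity>i. inner (f i) (f i)) = 0"
        using * [OF that] by (intro ext) simp
    qed simp
  qed
qed (simp_all add: norm_ell2_def sgn_ell2_def dist_ell2_def uniformity_ell2_def open_ell2_def)

end

lemma power2_norm_ell2: "(norm x)\<^sup>2 = (\<Sum>\<^sub>\<infinity>i. (norm (Rep_ell2 x i))\<^sup>2)"
  unfolding power2_norm_eq_inner by transfer (simp add: power2_norm_eq_inner)

lemma sq_summable_Rep_ell2: "sq_summable (Rep_ell2 x)"
  using Rep_ell2 by blast

lemma sum_le_power2_norm_ell2:
  assumes "finite F"
  shows "(\<Sum>i\<in>F. (norm (Rep_ell2 x i))\<^sup>2) \<le> (norm x)\<^sup>2"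
  unfolding power2_norm_ell2
  using sq_summable_Rep_ell2 [of x] assms
  by (intro finite_sum_le_infsum) (auto simp: sq_summable_def)

instance ell2 :: (type, "{real_inner, complete_space}") complete_space
proof
  fix X :: "nat \<Rightarrow> ('a, 'b) ell2"
  assume X: "Cauchy X"
  have coord: "dist (Rep_ell2 x i) (Rep_ell2 y i) \<le> dist x y" for x y :: "('a, 'b) ell2" and i
    using sum_le_power2_norm_ell2 [of "{i}" "x - y"]
    by (simp add: dist_norm minus_ell2.rep_eq abs_le_square_iff [symmetric])
  have "Cauchy (\<lambda>n. Rep_ell2 (X n) i)" for i
  proof (rule metric_CauchyI)
    fix e :: real
    assume "0 < e"
    then obtain N where "\<forall>m\<ge>N. \<forall>n\<ge>N. dist (X m) (X n) < e"
      using metric_CauchyD [OF X] by blast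
    then show "\<exists>N. \<forall>m\<ge>N. \<forall>n\<ge>N. dist (Rep_ell2 (X m) i) (Rep_ell2 (X n) i) < e"
      using coord le_less_trans by blast
  qed
  then have "\<exists>l. (\<lambda>n. Rep_ell2 (X n) i) \<longlonglongrightarrow> l" for i
    using Cauchy_convergent_iff convergent_def by blast
  then obtain f where f: "\<And>i. (\<lambda>n. Rep_ell2 (X n) i) \<longlonglongrightarrow> f i"
    by metis
  \<comment> \<open>Bounds on finite partial sums survive the coordinatewise limit and do not depend
    on \<open>F\<close>; this yields both square summability and norm convergence.\<close>
  have fin: "(\<Sum>i\<in>F. (norm (Rep_ell2 (X m) i - f i))\<^sup>2) \<le> e\<^sup>2"
    if F: "finite F" and N: "\<forall>m\<ge>N. \<forall>n\<ge>N. dist (X m) (X n) < e" "N \<le> m" for F m N e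
  proof (rule LIMSEQ_le_const2)
    show "(\<lambda>n. \<Sum>i\<in>F. (norm (Rep_ell2 (X m) i - Rep_ell2 (X n) i))\<^sup>2)
        \<longlonglongrightarrow> (\<Sum>i\<in>F. (norm (Rep_ell2 (X m) i - f i))\<^sup>2)"
      by (intro tendsto_intros f)
    have "(\<Sum>i\<in>F. (norm (Rep_ell2 (X m) i - Rep_ell2 (X n) i))\<^sup>2) \<le> e\<^sup>2" if "N \<le> n" for n
    proof -
      have "(dist (X m) (X n))\<^sup>2 \<le> e\<^sup>2"
        using N that by (intro power_mono) (auto intro: less_imp_le)
      then show ?thesis
        using sum_le_power2_norm_ell2 [OF F, of "X m - X n"]
        by (simp add: dist_norm minus_ell2.rep_eq)
    qed
    then show "\<exists>N. \<forall>n\<ge>N. (\<Sum>i\<in>F. (norm (Rep_ell2 (X m) i - Rep_ell2 (X n) i))\<^sup>2) \<le> e\<^sup>2"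
      by blast
  qed
  have diff: "sq_summable (\<lambda>i. Rep_ell2 (X m) i - f i)"
    if "\<forall>m\<ge>N. \<forall>n\<ge>N. dist (X m) (X n) < e" "N \<le> m" for m N e
    unfolding sq_summable_def
    by (rule nonneg_bdd_above_summable_on) (auto intro!: bdd_aboveI2 fin [OF _ that])
  obtain N1 where N1: "\<forall>m\<ge>N1. \<forall>n\<ge>N1. dist (X m) (X n) < 1"
    using metric_CauchyD [OF X, of 1] by auto
  \<comment> \<open>\<open>f\<close> is \<open>X N1\<close> minus the square-summable difference of
    \<open>X N1\<close> and \<open>f\<close>.\<close>
  have "sq_summable f"
    using sq_summable_diff [OF sq_summable_Rep_ell2 [of "X N1"] diff [OF N1 order_refl]] by simp
  then obtain x where x: "Rep_ell2 x = f"
    using Rep_ell2_cases by (metis mem_Collect_eq)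
  have "X \<longlonglongrightarrow> x"
  proof (rule metric_LIMSEQ_I)
    fix e :: real
    assume e: "0 < e"
    then obtain N where N: "\<forall>m\<ge>N. \<forall>n\<ge>N. dist (X m) (X n) < e / 2"
      using metric_CauchyD [OF X, of "e / 2"] by auto
    have "dist (X m) x < e" if "N \<le> m" for m
    proof -
      have "(norm (X m - x))\<^sup>2 \<le> (e / 2)\<^sup>2"
        unfolding power2_norm_ell2 minus_ell2.rep_eq x
        by (rule infsum_le_finite_sums [OF diff [OF N that, unfolded sq_summable_def] fin [OF _ N that]])
      then have "norm (X m - x) \<le> e / 2"
        by (rule power2_le_imp_le) (use e in simp)
      then show ?thesis
        using e by (simp add: dist_norm)
    qed
    then show "\<exists>N. \<forall>n\<ge>N. dist (X n) x < e"
      by blast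
  qed
  then show "convergent X"
    by (rule convergentI)
qed

lemma sq_summable_cinner:
  assumes "sq_summable f" "sq_summable g"
  shows "(\<lambda>i. cinner (f i) (g i)) summable_on UNIV"
proof (rule abs_summable_summable)
  show "(\<lambda>i. cmod (cinner (f i) (g i))) summable_on UNIV"
    by (rule summable_on_comparison_test [OF sq_summable_norm_mult [OF assms]])
      (auto simp: cmod_cinner_le)
qed

instantiation ell2 :: (type, complex_hilbert_space) complex_hilbert_space
begin

lift_definition scaleC_ell2 :: "complex \<Rightarrow> ('a, 'b) ell2 \<Rightarrow> ('a, 'b) ell2" is "\<lambda>c f i. c *\<^sub>C f i"
  by (rule sq_summable_scaleC)
lift_definition cinner_ell2 :: "('a, 'b) ell2 \<Rightarrow> ('a, 'b) ell2 \<Rightarrow> complex" is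
  "\<lambda>f g. \<Sum>\<^sub>\<infinity>i. cinner (f i) (g i)" .

instance
proof
  fix x y z :: "('a, 'b) ell2" and r :: real and c d :: complex
  show "complex_of_real r *\<^sub>C x = r *\<^sub>R x"
    by transfer (simp add: scaleC_of_real)
  show "c *\<^sub>C (x + y) = c *\<^sub>C x + c *\<^sub>C y" "(c + d) *\<^sub>C x = c *\<^sub>C x + d *\<^sub>C x"
    by (transfer; simp add: scaleC_add_left scaleC_add_right)+
  show "c *\<^sub>C (d *\<^sub>C x) = (c * d) *\<^sub>C x"
    by transfer (simp add: scaleC_scaleC)
  show "cinner x y = cnj (cinner y x)"
    by transfer (simp flip: infsum_cnj cinner_commute)
  show "cinner x (y + z) = cinner x y + cinner x z"
    by transfer (simp add: cinner_add_right infsum_add sq_summable_cinner)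
  show "cinner x (c *\<^sub>C y) = c * cinner x y"
    by transfer (simp add: cinner_scaleC_right infsum_cmult_right sq_summable_cinner)
  show "inner x y = Re (cinner x y)"
    by transfer (simp add: inner_eq_Re_cinner infsum_Re sq_summable_cinner)
qed

end

text \<open>The amplification \<open>T \<otimes> 1\<close> on square-summable families.\<close>

definition amp :: "('a::complex_hilbert_space \<Rightarrow>\<^sub>L 'a) \<Rightarrow> ('i \<Rightarrow> 'a) \<Rightarrow> ('i, 'a) ell2" where
  "amp T \<xi> = Abs_ell2 (\<lambda>i. blinfun_apply T (\<xi> i))"

lemma Rep_amp: "sq_summable \<xi> \<Longrightarrow> Rep_ell2 (amp T \<xi>) = (\<lambda>i. blinfun_apply T (\<xi> i))"
  unfolding amp_def by (rule Abs_ell2_inverse) (simp add: sq_summable_blinfun)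

lemma amp_diff: "sq_summable \<xi> \<Longrightarrow> amp (S - T) \<xi> = amp S \<xi> - amp T \<xi>"
  by (simp add: Rep_ell2_inject [symmetric] minus_ell2.rep_eq Rep_amp blinfun.diff_left)

lemma amp_add: "sq_summable \<xi> \<Longrightarrow> amp (S + T) \<xi> = amp S \<xi> + amp T \<xi>"
  by (simp add: Rep_ell2_inject [symmetric] plus_ell2.rep_eq Rep_amp blinfun.add_left)

lemma amp_scaleC: "sq_summable \<xi> \<Longrightarrow> amp (c *\<^sub>C T) \<xi> = c *\<^sub>C amp T \<xi>"
  by (simp add: Rep_ell2_inject [symmetric] scaleC_ell2.rep_eq Rep_amp scaleC_blinfun.rep_eq)

lemma amp_zero: "sq_summable \<xi> \<Longrightarrow> amp 0 \<xi> = 0"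
  by (simp add: Rep_ell2_inject [symmetric] zero_ell2.rep_eq Rep_amp)

lemma amp_sum: "sq_summable \<xi> \<Longrightarrow> amp (\<Sum>i\<in>I. T i) \<xi> = (\<Sum>i\<in>I. amp (T i) \<xi>)"
  by (induction I rule: infinite_finite_induct) (simp_all add: amp_add amp_zero)

text \<open>Convergence for a joined family is inherited by each of its subfamilies, which are
  selected by an injection \<open>j\<close> of index types.\<close>

lemma norm_amp_comp_le:
  assumes "sq_summable \<xi>" "inj j"
  shows "sq_summable (\<lambda>k. \<xi> (j k))" "norm (amp T (\<lambda>k. \<xi> (j k))) \<le> norm (amp T \<xi>)"
proof -
  have sub: "(\<lambda>k. f (j k)) summable_on UNIV" "(\<Sum>\<^sub>\<infinity>k. f (j k)) \<le> (\<Sum>\<^sub>\<infinity>i. f i)"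
    if "f summable_on UNIV" "\<And>i. 0 \<le> f i" for f :: "'a \<Rightarrow> real"
  proof -
    have f: "f summable_on range j"
      using that(1) summable_on_subset_banach by blast
    then show "(\<lambda>k. f (j k)) summable_on UNIV"
      by (subst (asm) summable_on_reindex [OF assms(2)]) (simp add: o_def)
    have "(\<Sum>\<^sub>\<infinity>k. f (j k)) = infsum f (range j)"
      by (subst infsum_reindex [OF assms(2)]) (simp add: o_def)
    also have "\<dots> \<le> infsum f UNIV"
      by (rule infsum_mono2) (use f that in auto)
    finally show "(\<Sum>\<^sub>\<infinity>k. f (j k)) \<le> (\<Sum>\<^sub>\<infinity>i. f i)" .
  qed
  show *: "sq_summable (\<lambda>k. \<xi> (j k))"
    using sub(1) [of "\<lambda>i. (norm (\<xi> i))\<^sup>2"] assms(1) by (simp add: sq_summable_def)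
  have "(norm (amp T (\<lambda>k. \<xi> (j k))))\<^sup>2 \<le> (norm (amp T \<xi>))\<^sup>2"
    unfolding power2_norm_ell2 Rep_amp [OF assms(1)] Rep_amp [OF *]
    by (rule sub(2)) (use sq_summable_blinfun [OF assms(1)] in \<open>simp_all add: sq_summable_def\<close>)
  then show "norm (amp T (\<lambda>k. \<xi> (j k))) \<le> norm (amp T \<xi>)"
    by (rule power2_le_imp_le) simp
qed

lemma norm_amp_le:
  assumes "sq_summable \<xi>"
  shows "norm (amp T \<xi>) \<le> norm T * norm (Abs_ell2 \<xi>)"
proof (rule power2_le_imp_le)
  have "(norm (amp T \<xi>))\<^sup>2 \<le> (\<Sum>\<^sub>\<infinity>i. (norm T)\<^sup>2 * (norm (\<xi> i))\<^sup>2)"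
    unfolding power2_norm_ell2 Rep_amp [OF assms]
  proof (intro infsum_mono summable_on_cmult_right)
    show "(norm (blinfun_apply T (\<xi> i)))\<^sup>2 \<le> (norm T)\<^sup>2 * (norm (\<xi> i))\<^sup>2" for i
      using power_mono [OF norm_blinfun [of T "\<xi> i"] norm_ge_zero, of 2]
      by (simp add: power_mult_distrib)
  qed (use assms sq_summable_blinfun [OF assms] in \<open>simp_all add: sq_summable_def\<close>)
  also have "\<dots> = (norm T * norm (Abs_ell2 \<xi>))\<^sup>2"
    using assms
    by (simp add: power_mult_distrib power2_norm_ell2 Abs_ell2_inverse
      infsum_cmult_right sq_summable_def)
  finally show "(norm (amp T \<xi>))\<^sup>2 \<le> (norm T * norm (Abs_ell2 \<xi>))\<^sup>2" .
qed simp

section \<open>Normal functionals as sums of vector functionals\<close>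

lemma scaleC_of_real_blinfun: "complex_of_real r *\<^sub>C T = r *\<^sub>R T" for T :: "_ \<Rightarrow>\<^sub>L _"
  by (rule blinfun_eqI) (simp add: scaleC_blinfun.rep_eq blinfun.scaleR_left scaleC_of_real)

definition csubspace :: "'a::{zero,plus,scaleC} set \<Rightarrow> bool" where
  "csubspace M \<longleftrightarrow> 0 \<in> M \<and> (\<forall>x\<in>M. \<forall>y\<in>M. x + y \<in> M) \<and> (\<forall>c. \<forall>x\<in>M. c *\<^sub>C x \<in> M)"

text \<open>The general form of a normal functional. Over \<open>nat\<close> it is the series in the
  definition of \<open>sigma_weak\<close>; other index types arise from joining and tensoring
  families.\<close>

definition vsum :: "('i \<Rightarrow> 'a::complex_hilbert_space) \<Rightarrow> ('i \<Rightarrow> 'a) \<Rightarrow> ('a \<Rightarrow>\<^sub>L 'a) \<Rightarrow> complex" where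
  "vsum \<xi> \<eta> T = (\<Sum>\<^sub>\<infinity>i. cinner (\<xi> i) (blinfun_apply T (\<eta> i)))"

lemma vsum_summable:
  "sq_summable \<xi> \<Longrightarrow> sq_summable \<eta> \<Longrightarrow> (\<lambda>i. cinner (\<xi> i) (blinfun_apply T (\<eta> i))) summable_on UNIV"
  by (intro sq_summable_cinner sq_summable_blinfun)

lemma vsum_has_sum:
  "sq_summable \<xi> \<Longrightarrow> sq_summable \<eta> \<Longrightarrow>
    ((\<lambda>i. cinner (\<xi> i) (blinfun_apply T (\<eta> i))) has_sum vsum \<xi> \<eta> T) UNIV"
  unfolding vsum_def by (intro has_sum_infsum vsum_summable)

lemma vsum_add:
  "sq_summable \<xi> \<Longrightarrow> sq_summable \<eta> \<Longrightarrow> vsum \<xi> \<eta> (S + T) = vsum \<xi> \<eta> S + vsum \<xi> \<eta> T"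
  unfolding vsum_def by (simp add: blinfun.add_left cinner_add_right infsum_add vsum_summable)

lemma vsum_scaleC:
  "sq_summable \<xi> \<Longrightarrow> sq_summable \<eta> \<Longrightarrow> vsum \<xi> \<eta> (c *\<^sub>C T) = c * vsum \<xi> \<eta> T"
  unfolding vsum_def
  by (simp add: scaleC_blinfun.rep_eq cinner_scaleC_right infsum_cmult_right vsum_summable)

lemma csubspace_sum: "csubspace M \<Longrightarrow> (\<And>i. i \<in> I \<Longrightarrow> f i \<in> M) \<Longrightarrow> sum f I \<in> M"
  for f :: "'i \<Rightarrow> 'a::{comm_monoid_add,scaleC}"
  by (induction I rule: infinite_finite_induct) (auto simp: csubspace_def)

lemma vsum_zero [simp]: "vsum \<xi> \<eta> 0 = 0"
  by (simp add: vsum_def)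

lemma vsum_clinear: "sq_summable \<xi> \<Longrightarrow> sq_summable \<eta> \<Longrightarrow> clinear_on M (vsum \<xi> \<eta>)"
  by (simp add: clinear_on_def vsum_add vsum_scaleC scaleC_complex_def)

lemma vsum_compose_right: "vsum \<xi> \<eta> (S o\<^sub>L T) = vsum \<xi> (\<lambda>i. blinfun_apply T (\<eta> i)) S"
  by (simp add: vsum_def)

lemma vsum_compose_left:
  "S \<in> bounded_ops \<Longrightarrow> vsum \<xi> \<eta> (S o\<^sub>L T) = vsum (\<lambda>i. blinfun_apply (adj S) (\<xi> i)) \<eta> T"
  by (simp add: vsum_def cinner_adj_left)

lemma vsum_eq_cinner:
  "sq_summable \<xi> \<Longrightarrow> sq_summable \<eta> \<Longrightarrow> vsum \<xi> \<eta> T = cinner (Abs_ell2 \<xi>) (amp T \<eta>)"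
  by (simp add: vsum_def cinner_ell2.rep_eq Rep_amp Abs_ell2_inverse)

text \<open>The value at S* T splits into a vector depending on \<open>S\<close> and one depending
  on \<open>T\<close>. The two families may differ, so positivity of the functional is not visible
  from this formula and remains a separate fact.\<close>

lemma vsum_adj_eq_cinner:
  "sq_summable \<xi> \<Longrightarrow> sq_summable \<eta> \<Longrightarrow> S \<in> bounded_ops \<Longrightarrow>
    vsum \<xi> \<eta> (adj S o\<^sub>L T) = cinner (amp S \<xi>) (amp T \<eta>)"
  by (simp add: vsum_def cinner_ell2.rep_eq Rep_amp cinner_adj_right)

lemma cmod_vsum_le:
  assumes "sq_summable \<xi>" "sq_summable \<eta>"
  shows "cmod (vsum \<xi> \<eta> T) \<le> norm T * (norm (Abs_ell2 \<xi>) * norm (Abs_ell2 \<eta>))"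
proof -
  have "cmod (vsum \<xi> \<eta> T) \<le> norm (Abs_ell2 \<xi>) * norm (amp T \<eta>)"
    unfolding vsum_eq_cinner [OF assms] by (rule cmod_cinner_le)
  also have "\<dots> \<le> norm (Abs_ell2 \<xi>) * (norm T * norm (Abs_ell2 \<eta>))"
    by (intro mult_left_mono norm_amp_le assms norm_ge_zero)
  finally show ?thesis
    by (simp add: mult_ac)
qed

text \<open>The functionals defining \<open>sigma_weak\<close> are indexed by \<open>nat\<close>.
  Padding with zeros along \<open>to_nat\<close> reduces every countable index type to that case,
  finite ones included.\<close>

lemma vsum_nat:
  fixes \<xi> \<eta> :: "'i::countable \<Rightarrow> 'a::complex_hilbert_space"
  assumes "sq_summable \<xi>" "sq_summable \<eta>"
  obtains \<xi>' \<eta>' :: "nat \<Rightarrow> 'a" where "sq_summable \<xi>'" "sq_summable \<eta>'" "vsum \<xi> \<eta> = vsum \<xi>' \<eta>'"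
proof -
  define ext where "ext f = (\<lambda>n. if n \<in> range (to_nat :: 'i \<Rightarrow> nat) then f (from_nat n) else 0)"
    for f :: "'i \<Rightarrow> 'a"
  have sq: "sq_summable (ext f)" if "sq_summable f" for f
  proof -
    have "(\<lambda>n. (norm (ext f n))\<^sup>2) summable_on range (to_nat :: 'i \<Rightarrow> nat)"
      using that by (subst summable_on_reindex) (auto simp: ext_def o_def sq_summable_def)
    then show ?thesis
      unfolding sq_summable_def by (subst summable_on_cong_neutral) (auto simp: ext_def)
  qed
  have "vsum \<xi> \<eta> T = vsum (ext \<xi>) (ext \<eta>) T" for T
  proof -
    have "vsum (ext \<xi>) (ext \<eta>) T =
        (\<Sum>\<^sub>\<infinity>n\<in>range (to_nat :: 'i \<Rightarrow> nat). cinner (ext \<xi> n) (blinfun_apply T (ext \<eta> n)))"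
      unfolding vsum_def by (rule infsum_cong_neutral) (auto simp: ext_def)
    also have "\<dots> = vsum \<xi> \<eta> T"
      unfolding vsum_def by (subst infsum_reindex) (auto simp: ext_def o_def)
    finally show ?thesis ..
  qed
  then show thesis
    using that sq assms by blast
qed

lemma vsum_nat_suminf:
  fixes \<xi> \<eta> :: "nat \<Rightarrow> 'a::complex_hilbert_space"
  assumes "sq_summable \<xi>" "sq_summable \<eta>"
  shows "vsum \<xi> \<eta> T = (\<Sum>n. cinner (\<xi> n) (blinfun_apply T (\<eta> n)))"
  using has_sum_imp_sums [OF vsum_has_sum [OF assms]] by (rule sums_unique)

lemma sq_summable_nat: "sq_summable f \<longleftrightarrow> summable (\<lambda>n. (norm (f n))\<^sup>2)" for f :: "nat \<Rightarrow> _"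
  unfolding sq_summable_def by (rule summable_on_UNIV_nonneg_real_iff) simp

section \<open>The sigma-weak topology\<close>

definition sigma_weak_subbasis :: "('a::complex_hilbert_space \<Rightarrow>\<^sub>L 'a) set set" where
  "sigma_weak_subbasis =
    {{T. vsum \<xi> \<eta> T \<in> U} | (\<xi> :: nat \<Rightarrow> 'a) \<eta> U. sq_summable \<xi> \<and> sq_summable \<eta> \<and> open U}"

lemma sigma_weak_eq:
  "sigma_weak = subtopology (topology_generated_by sigma_weak_subbasis) bounded_ops"
proof -
  have "{{T. (\<Sum>n. cinner (\<xi> n) (blinfun_apply T (\<eta> n))) \<in> U} | (\<xi> :: nat \<Rightarrow> 'a) \<eta> U.
      summable (\<lambda>n. (norm (\<xi> n))\<^sup>2) \<and> summable (\<lambda>n. (norm (\<eta> n))\<^sup>2) \<and> open U} = sigma_weak_subbasis"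
    unfolding sigma_weak_subbasis_def sq_summable_nat [symmetric]
    by (intro Collect_cong ex_cong1 rev_conj_cong refl) (simp add: vsum_nat_suminf)
  then show ?thesis
    by (simp add: sigma_weak_def)
qed

lemma Union_sigma_weak_subbasis: "\<Union> sigma_weak_subbasis = UNIV"
proof -
  have "UNIV \<in> (sigma_weak_subbasis :: ('a \<Rightarrow>\<^sub>L 'a) set set)"
    unfolding sigma_weak_subbasis_def using sq_summable_zero by blast
  then show ?thesis
    by blast
qed

lemma topspace_sigma_weak: "topspace sigma_weak = bounded_ops"
  by (simp add: sigma_weak_eq Union_sigma_weak_subbasis)

lemma continuous_map_vsum:
  fixes \<xi> \<eta> :: "'i::countable \<Rightarrow> 'a::complex_hilbert_space"
  assumes "sq_summable \<xi>" "sq_summable \<eta>"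
  shows "continuous_map sigma_weak euclidean (vsum \<xi> \<eta>)"
proof -
  obtain \<xi>' \<eta>' :: "nat \<Rightarrow> 'a" where *: "sq_summable \<xi>'" "sq_summable \<eta>'" "vsum \<xi> \<eta> = vsum \<xi>' \<eta>'"
    using vsum_nat assms by blast
  have "openin (topology_generated_by sigma_weak_subbasis) {T. vsum \<xi>' \<eta>' T \<in> U}" if "open U" for U
    using * that by (intro topology_generated_by_Basis) (auto simp: sigma_weak_subbasis_def)
  then show ?thesis
    unfolding sigma_weak_eq *
    by (intro continuous_map_from_subtopology)
      (auto simp: continuous_map_def Union_sigma_weak_subbasis)
qed

lemma continuous_map_into_sigma_weak:
  assumes "\<And>T. T \<in> topspace X \<Longrightarrow> h T \<in> bounded_ops"
    and "\<And>\<xi> \<eta> :: nat \<Rightarrow> 'a. sq_summable \<xi> \<Longrightarrow> sq_summable \<eta> \<Longrightarrow>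
      continuous_map X euclidean (\<lambda>T. vsum \<xi> \<eta> (h T))"
  shows "continuous_map X (sigma_weak :: ('a::complex_hilbert_space \<Rightarrow>\<^sub>L 'a) topology) h"
  unfolding sigma_weak_eq
proof (rule continuous_map_into_subtopology)
  show "continuous_map X (topology_generated_by sigma_weak_subbasis) h"
  proof (rule continuous_on_generated_topo)
    fix W :: "('a \<Rightarrow>\<^sub>L 'a) set"
    assume "W \<in> sigma_weak_subbasis"
    then obtain \<xi> \<eta> :: "nat \<Rightarrow> 'a" and U
      where "sq_summable \<xi>" "sq_summable \<eta>" "open U" "W = {T. vsum \<xi> \<eta> T \<in> U}"
      unfolding sigma_weak_subbasis_def by blast
    then show "openin X (h -` W \<inter> topspace X)"
      using openin_continuous_map_preimage [OF assms(2), of \<xi> \<eta> U]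
      by (simp add: vimage_def Int_def conj_commute)
  qed (simp add: Union_sigma_weak_subbasis)
qed (use assms(1) in blast)

lemma sigma_weak_closure_map:
  assumes "continuous_map sigma_weak sigma_weak h" and "\<And>T. T \<in> S \<Longrightarrow> h T \<in> sigma_weak closure_of S'"
    and "T \<in> sigma_weak closure_of S"
  shows "h T \<in> sigma_weak closure_of S'"
proof -
  have "h ` (sigma_weak closure_of S) \<subseteq> sigma_weak closure_of (h ` S)"
    by (rule continuous_map_image_closure_subset [OF assms(1)])
  also have "\<dots> \<subseteq> sigma_weak closure_of (sigma_weak closure_of S')"
    by (intro closure_of_mono) (use assms(2) in blast)
  finally show ?thesis
    using assms(3) by auto
qed

lemma csubspace_bounded_ops: "csubspace bounded_ops"
  unfolding csubspace_def
  by (auto intro!: bounded_opsI simp: blinfun.add_left blinfun.add_right bounded_ops_scaleC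
      scaleC_add_right scaleC_blinfun.rep_eq scaleC_scaleC mult.commute)

lemma csubspace_sigma_weak_closure:
  assumes S: "csubspace S" "S \<subseteq> bounded_ops"
  shows "csubspace (sigma_weak closure_of S)"
proof -
  let ?C = "sigma_weak closure_of S"
  have C: "?C \<subseteq> bounded_ops"
    using closure_of_subset_topspace topspace_sigma_weak by metis
  have SC: "S \<subseteq> ?C"
    using S(2) closure_of_subset topspace_sigma_weak by metis
  have plus: "continuous_map sigma_weak sigma_weak (\<lambda>T. T + Y)" if "Y \<in> bounded_ops"
    for Y :: "'a \<Rightarrow>\<^sub>L 'a"
  proof (rule continuous_map_into_sigma_weak)
    show "continuous_map sigma_weak euclidean (\<lambda>T. vsum \<xi> \<eta> (T + Y))"
      if "sq_summable \<xi>" "sq_summable \<eta>" for \<xi> \<eta> :: "nat \<Rightarrow> 'a"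
      unfolding vsum_add [OF that] by (intro continuous_map_add continuous_map_vsum that) simp
  qed (use that csubspace_bounded_ops in \<open>auto simp: topspace_sigma_weak csubspace_def\<close>)
  have scale: "continuous_map sigma_weak sigma_weak (\<lambda>T :: 'a \<Rightarrow>\<^sub>L 'a. c *\<^sub>C T)" for c
  proof (rule continuous_map_into_sigma_weak)
    show "continuous_map sigma_weak euclidean (\<lambda>T. vsum \<xi> \<eta> (c *\<^sub>C T))"
      if "sq_summable \<xi>" "sq_summable \<eta>" for \<xi> \<eta> :: "nat \<Rightarrow> 'a"
      unfolding vsum_scaleC [OF that]
      using continuous_map_compose [OF continuous_map_vsum [OF that], of euclidean "\<lambda>z. c * z"]
      by (simp add: o_def continuous_on_mult_left)
  qed (use csubspace_bounded_ops in \<open>auto simp: topspace_sigma_weak csubspace_def\<close>)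
  \<comment> \<open>Addition is handled one variable at a time: first with \<open>Y\<close> in
    \<open>S\<close>, then with both summands in the closure.\<close>
  have 1: "T + Y \<in> ?C" if "T \<in> ?C" "Y \<in> S" for T Y
    by (rule sigma_weak_closure_map [OF plus _ that(1)]) (use that S SC in \<open>auto
      simp: csubspace_def\<close>)
  have "T + Y \<in> ?C" if "T \<in> ?C" "Y \<in> ?C" for T Y
    by (rule sigma_weak_closure_map [OF plus _ that(1)]) (use that C 1 [of Y] in \<open>auto simp: add.commute\<close>)
  moreover have "c *\<^sub>C T \<in> ?C" if "T \<in> ?C" for c T
    by (rule sigma_weak_closure_map [OF scale _ that]) (use S SC in \<open>auto simp: csubspace_def\<close>)
  ultimately show ?thesis
    using S SC by (auto simp: csubspace_def)
qed

lemma generate_topology_on_finite_base: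
  assumes "generate_topology_on S W" "x \<in> W"
  shows "\<exists>F\<subseteq>S. finite F \<and> x \<in> \<Inter>F \<and> \<Inter>F \<subseteq> W"
  using assms
proof (induction arbitrary: x rule: generate_topology_on.induct)
  case (Int a b)
  then obtain F G where "F \<subseteq> S" "finite F" "x \<in> \<Inter>F" "\<Inter>F \<subseteq> a" "G \<subseteq> S" "finite G" "x \<in> \<Inter>G" "\<Inter>G \<subseteq> b"
    by (meson IntE)
  then show ?case
    by (intro exI [of _ "F \<union> G"]) auto
next
  case (UN K)
  then show ?case
    by (meson Sup_upper UnionE subset_trans)
next
  case (Basis s)
  then show ?case
    by (intro exI [of _ "{s}"]) auto
qed simp

section \<open>Every normal functional is a sum of vector functionals\<close>

definition vsums :: "(('a::complex_hilbert_space \<Rightarrow>\<^sub>L 'a) \<Rightarrow> complex) set" where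
  "vsums = {vsum \<xi> \<eta> | \<xi> \<eta> :: nat \<Rightarrow> 'a. sq_summable \<xi> \<and> sq_summable \<eta>}"

lemma vsum_in_vsums:
  fixes \<xi> \<eta> :: "'i::countable \<Rightarrow> 'a::complex_hilbert_space"
  shows "sq_summable \<xi> \<Longrightarrow> sq_summable \<eta> \<Longrightarrow> vsum \<xi> \<eta> \<in> vsums"
  unfolding vsums_def using vsum_nat [of \<xi> \<eta>] by (smt (verit, best) mem_Collect_eq)

lemma vsums_zero: "(\<lambda>T. 0) \<in> (vsums :: (('a::complex_hilbert_space \<Rightarrow>\<^sub>L 'a) \<Rightarrow> complex) set)"
proof -
  have "vsum (\<lambda>i :: nat. 0 :: 'a) (\<lambda>i. 0) = (\<lambda>T. 0)"
    by (simp add: fun_eq_iff vsum_def)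
  then show ?thesis
    using vsum_in_vsums [OF sq_summable_zero sq_summable_zero, where 'i = nat and 'a = 'a] by simp
qed

lemma vsums_scale:
  assumes "f \<in> vsums"
  shows "(\<lambda>T. c * f T) \<in> vsums"
proof -
  obtain \<xi> \<eta> :: "nat \<Rightarrow> _" where f: "sq_summable \<xi>" "sq_summable \<eta>" "f = vsum \<xi> \<eta>"
    using assms unfolding vsums_def by blast
  have "(\<lambda>T. c * f T) = vsum (\<lambda>i. cnj c *\<^sub>C \<xi> i) \<eta>"
    unfolding f fun_eq_iff vsum_def
    by (simp add: cinner_scaleC_left infsum_cmult_right vsum_summable f)
  then show ?thesis
    by (simp add: vsum_in_vsums sq_summable_scaleC f)
qed

lemma has_sum_case_sum:
  assumes "((\<lambda>i. f (Inl i)) has_sum a) UNIV" "((\<lambda>j. f (Inr j)) has_sum b) UNIV"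
  shows "(f has_sum (a + b :: 'c::{topological_comm_monoid_add,t2_space})) (UNIV :: ('i + 'j) set)"
proof -
  have "(f has_sum a) (range Inl)" "(f has_sum b) (range Inr)"
    using assms by (subst has_sum_reindex; simp add: o_def)+
  then have "(f has_sum a + b) (range Inl \<union> range Inr)"
    by (rule has_sum_Un_disjoint) auto
  then show ?thesis
    by (simp add: UNIV_sum)
qed

lemma sq_summable_case_sum:
  assumes "sq_summable f" "sq_summable g"
  shows "sq_summable (case_sum f g)"
  using has_sum_case_sum [of "\<lambda>k. (norm (case_sum f g k))\<^sup>2"] assms
  unfolding sq_summable_def summable_on_def by fastforce

lemma vsums_add:
  assumes "f \<in> vsums" "g \<in> vsums"
  shows "(\<lambda>T. f T + g T) \<in> vsums"
proof -
  obtain \<xi> \<eta> \<xi>' \<eta>' :: "nat \<Rightarrow> _" where f: "sq_summable \<xi>" "sq_summable \<eta>" "f = vsum \<xi> \<eta>"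
    and g: "sq_summable \<xi>'" "sq_summable \<eta>'" "g = vsum \<xi>' \<eta>'"
    using assms unfolding vsums_def by blast
  \<comment> \<open>Joining the families over the disjoint union of the index sets adds the
    functionals.\<close>
  have "vsum (case_sum \<xi> \<xi>') (case_sum \<eta> \<eta>') T = f T + g T" for T
    unfolding f g vsum_def [of "case_sum \<xi> \<xi>'"]
    by (intro infsumI has_sum_case_sum) (simp_all add: vsum_has_sum f g)
  then have "(\<lambda>T. f T + g T) = vsum (case_sum \<xi> \<xi>') (case_sum \<eta> \<eta>')"
    by auto
  then show ?thesis
    by (simp add: vsum_in_vsums sq_summable_case_sum f g)
qed

lemma vsums_clinear: "f \<in> vsums \<Longrightarrow> clinear_on M f"
  unfolding vsums_def using vsum_clinear by blast

lemma vsums_continuous: "f \<in> vsums \<Longrightarrow> continuous_map sigma_weak euclidean f"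
  unfolding vsums_def using continuous_map_vsum by blast

text \<open>A functional vanishing on finitely many common kernels is a combination of the given
  ones. The induction replaces \<open>M\<close> by the kernel \<open>M0\<close> of one functional
  \<open>\<phi>\<close>; the multiple of \<open>\<phi>\<close> to be added back is forced by the
  value at a single \<open>e\<close> with \<open>\<phi> e \<noteq> 0\<close>.\<close>

lemma vsums_kernel:
  assumes "finite \<Phi>" "\<Phi> \<subseteq> vsums" "csubspace M" "clinear_on M f"
    and "\<And>T. T \<in> M \<Longrightarrow> (\<And>\<phi>. \<phi> \<in> \<Phi> \<Longrightarrow> \<phi> T = 0) \<Longrightarrow> f T = 0"
  shows "\<exists>g\<in>vsums. \<forall>T\<in>M. f T = g T"
  using assms
proof (induction arbitrary: M rule: finite_induct)
  case empty
  then show ?case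
    using vsums_zero by (metis empty_iff)
next
  case (insert \<phi> \<Phi>)
  have add: "h (S + T) = h S + h T" and scale: "h (c *\<^sub>C T) = c * h T"
    if "h \<in> vsums" for h c and S T :: "'a \<Rightarrow>\<^sub>L 'a"
    using vsums_clinear [OF that, of UNIV] by (auto simp: clinear_on_def scaleC_complex_def)
  have \<phi>: "\<phi> \<in> vsums"
    using insert.prems by simp
  define M0 where "M0 = {T \<in> M. \<phi> T = 0}"
  have "\<phi> 0 = 0"
    using add [OF \<phi>, of 0 0] by simp
  then have "csubspace M0"
    using insert.prems(2) by (auto simp: M0_def csubspace_def add scale \<phi>)
  moreover have "clinear_on M0 f"
    using insert.prems(3) by (auto simp: M0_def clinear_on_def)
  moreover have "f T = 0" if "T \<in> M0" "\<And>\<psi>. \<psi> \<in> \<Phi> \<Longrightarrow> \<psi> T = 0" for T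
    using that insert.prems(4) by (auto simp: M0_def)
  ultimately obtain g where g: "g \<in> vsums" "\<And>T. T \<in> M0 \<Longrightarrow> f T = g T"
    using insert.IH insert.prems(1) by (metis insert_subset)
  show ?case
  proof (cases "\<exists>e\<in>M. \<phi> e \<noteq> 0")
    case False
    then show ?thesis
      using g by (auto simp: M0_def)
  next
    case True
    then obtain e where e: "e \<in> M" "\<phi> e \<noteq> 0"
      by blast
    define k where "k = (f e - g e) / \<phi> e"
    have "f T = g T + k * \<phi> T" if T: "T \<in> M" for T
    proof -
      \<comment> \<open>Chosen so that \<open>\<phi>\<close> vanishes at
        \<open>T + c *\<^sub>C e\<close>, where \<open>f\<close> and \<open>g\<close> agree.\<close>
      define c where "c = - (\<phi> T / \<phi> e)"
      have eM: "c *\<^sub>C e \<in> M"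
        using e insert.prems(2) by (simp add: csubspace_def)
      then have "T + c *\<^sub>C e \<in> M0"
        using T e insert.prems(2) by (simp add: M0_def csubspace_def add scale \<phi> c_def)
      then have "f (T + c *\<^sub>C e) = g (T + c *\<^sub>C e)"
        by (rule g)
      moreover have "f (T + c *\<^sub>C e) = f T + c * f e"
        using insert.prems(3) T e eM by (simp add: clinear_on_def scaleC_complex_def)
      ultimately have "f T = g T + (- c) * (f e - g e)"
        by (simp add: add scale g algebra_simps)
      then show ?thesis
        using e by (simp add: c_def k_def)
    qed
    then show ?thesis
      by (intro bexI [of _ "\<lambda>T. g T + k * \<phi> T"]) (simp_all add: vsums_add vsums_scale g \<phi>)
  qed
qed

text \<open>Continuity at 0 bounds \<open>f\<close> on a neighbourhood given by finitely many
  functionals. On their common kernel \<open>f\<close> is bounded along whole complex lines, hence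
  zero, and \<open>vsums_kernel\<close> applies.\<close>

lemma normal_functional_vsums:
  assumes M: "csubspace M" "M \<subseteq> bounded_ops" and f: "normal_functional M f"
  shows "\<exists>g\<in>vsums. \<forall>T\<in>M. f T = g T"
proof -
  have lin: "clinear_on M f" and cont: "continuous_map (subtopology sigma_weak M) euclidean f"
    using f by (auto simp: normal_functional_def)
  have scale: "f (c *\<^sub>C T) = c * f T" if "T \<in> M" for c T
    using lin that by (simp add: clinear_on_def scaleC_complex_def)
  have "f (0 + 0) = f 0 + f 0"
    using lin M(1) unfolding clinear_on_def csubspace_def by blast
  then have f0: "f 0 = 0"
    by simp
  have "subtopology sigma_weak M = subtopology (topology_generated_by sigma_weak_subbasis) M"
    using M(2) by (simp add: sigma_weak_eq subtopology_subtopology Int_absorb1)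
  then have "openin (subtopology (topology_generated_by sigma_weak_subbasis) M) {T \<in> M. f T \<in> ball 0 1}"
    using openin_continuous_map_preimage [OF cont, of "ball 0 1"] M(2)
    by (simp add: Union_sigma_weak_subbasis)
  then obtain W
    where W: "generate_topology_on sigma_weak_subbasis W" "{T \<in> M. f T \<in> ball 0 1} = W \<inter> M"
    by (auto simp: openin_subtopology openin_topology_generated_by_iff)
  then have "0 \<in> W"
    using M(1) f0 by (auto simp: csubspace_def)
  then obtain F where F: "F \<subseteq> sigma_weak_subbasis" "finite F" "0 \<in> \<Inter>F" "\<Inter>F \<subseteq> W"
    using generate_topology_on_finite_base [OF W(1), of 0] by metis
  have "\<exists>\<phi>\<in>vsums. \<exists>U. G = {T. \<phi> T \<in> U}" if "G \<in> F" for G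
    using that F(1) unfolding sigma_weak_subbasis_def vsums_def by blast
  then have "\<forall>G\<in>F. \<exists>\<phi>. \<phi> \<in> vsums \<and> (\<exists>U. G = {T. \<phi> T \<in> U})"
    by blast
  then obtain \<phi> where \<phi>: "\<forall>G\<in>F. \<phi> G \<in> vsums \<and> (\<exists>U. G = {T. \<phi> G T \<in> U})"
    by (rule bchoice [THEN exE])
  show ?thesis
  proof (rule vsums_kernel [of "\<phi> ` F"])
    fix T
    assume T: "T \<in> M" and 0: "\<And>\<psi>. \<psi> \<in> \<phi> ` F \<Longrightarrow> \<psi> T = 0"
    \<comment> \<open>The functional defining \<open>G\<close> takes the same value at
      \<open>c *\<^sub>C T\<close> as at 0, and 0 lies in \<open>G\<close>; so the whole line
      through \<open>T\<close> stays in \<open>W\<close>. The scalar \<open>1 / f T\<close> then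
      rules out \<open>f T \<noteq> 0\<close>.\<close>
    have lt: "cmod (c * f T) < 1" for c
    proof -
      have "c *\<^sub>C T \<in> G" if G: "G \<in> F" for G
      proof -
        have lin: "clinear_on UNIV (\<phi> G)"
          using \<phi> G vsums_clinear by blast
        have "\<phi> G (0 + 0) = \<phi> G 0 + \<phi> G 0"
          using lin unfolding clinear_on_def by blast
        then have "\<phi> G (c *\<^sub>C T) = \<phi> G 0"
          using lin 0 G by (simp add: clinear_on_def scaleC_complex_def)
        then show ?thesis
          using F(3) G \<phi> by (metis InterD mem_Collect_eq)
      qed
      then have "c *\<^sub>C T \<in> W \<inter> M"
        using F(4) M(1) T by (auto simp: csubspace_def)
      then have "cmod (f (c *\<^sub>C T)) < 1"
        using W(2) [symmetric] by simp
      then show ?thesis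
        by (simp add: scale T)
    qed
    show "f T = 0"
      using lt [of "1 / f T"] by (cases "f T = 0") auto
  qed (use F \<phi> M lin in auto)
qed

lemma vsums_normal: "f \<in> vsums \<Longrightarrow> normal_functional M f"
  by (simp
    add: normal_functional_def vsums_clinear vsums_continuous continuous_map_from_subtopology)

lemma vsums_eq_on_closure:
  assumes "f \<in> vsums" "g \<in> vsums" "\<And>T. T \<in> S \<Longrightarrow> f T = g T" "T \<in> sigma_weak closure_of S"
  shows "f T = g T"
  by (rule forall_in_closure_of_eq [OF assms(4) _ vsums_continuous vsums_continuous])
    (simp_all add: assms)

section \<open>Strong approximation\<close>

text \<open>Weak and strong closures of a subspace agree: otherwise the component of \<open>amp U \<zeta>\<close> orthogonal
  to the \<open>amp X \<zeta>\<close> with \<open>X \<in> S\<close> would give a \<open>\<sigma>\<close>-weakly continuous functional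
  vanishing on \<open>S\<close> but not at \<open>U\<close>.\<close>

lemma amp_in_closure:
  fixes \<zeta> :: "'i::countable \<Rightarrow> 'a::complex_hilbert_space"
  assumes S: "csubspace S" and U: "U \<in> sigma_weak closure_of S" and \<zeta>: "sq_summable \<zeta>"
  shows "amp U \<zeta> \<in> closure ((\<lambda>X. amp X \<zeta>) ` S)"
proof -
  let ?E = "(\<lambda>X. amp X \<zeta>) ` S"
  have E_scale: "r *\<^sub>R amp X \<zeta> = amp (complex_of_real r *\<^sub>C X) \<zeta>" for r X
    by (simp add: amp_scaleC \<zeta> scaleC_of_real)
  have "subspace ?E"
  proof (rule subspaceI)
    show "0 \<in> ?E"
      using S amp_zero [OF \<zeta>] unfolding csubspace_def by (metis imageI)
  qed (use S in \<open>auto simp: csubspace_def E_scale simp flip: amp_add [OF \<zeta>]\<close>)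
  then obtain p where p: "p \<in> closure ?E" "\<And>v. v \<in> closure ?E \<Longrightarrow> inner v (amp U \<zeta> - p) = 0"
    using hilbert_projection [OF subspace_closure closed_closure] by blast
  define z where "z = Rep_ell2 (amp U \<zeta> - p)"
  have z: "sq_summable z"
    unfolding z_def by (rule sq_summable_Rep_ell2)
  have Re: "Re (vsum z \<zeta> X) = inner (amp X \<zeta>) (amp U \<zeta> - p)" for X
    unfolding vsum_eq_cinner [OF z \<zeta>]
    by (simp add: z_def Rep_ell2_inverse inner_eq_Re_cinner
        cinner_commute [of "amp U \<zeta> - p" "amp X \<zeta>"])
  have S0: "vsum z \<zeta> X = 0" if X: "X \<in> S" for X
  proof -
    have "Re (vsum z \<zeta> (c *\<^sub>C X)) = 0" for c
      unfolding Re by (rule p(2)) (use S X closure_subset [of ?E] in \<open>auto simp: csubspace_def\<close>)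
    \<comment> \<open>The factors 1 and -\<i> expose the real and the imaginary part.\<close>
    from this [of 1] this [of "-\<i>"] show ?thesis
      by (simp add: vsum_scaleC z \<zeta> complex_eq_iff)
  qed
  have "vsum z \<zeta> U = 0"
    by (rule vsums_eq_on_closure [OF _ vsums_zero S0 U]) (simp_all add: vsum_in_vsums z \<zeta>)
  then have "inner (amp U \<zeta>) (amp U \<zeta> - p) = 0"
    using Re [of U] by simp
  moreover have "inner p (amp U \<zeta> - p) = 0"
    by (rule p(2) [OF p(1)])
  ultimately have "inner (amp U \<zeta> - p) (amp U \<zeta> - p) = 0"
    by (simp add: inner_diff_left)
  then show ?thesis
    using p(1) by simp
qed

text \<open>One sequence has to serve several families at once, so they are joined into one family
  and separated afterwards. Closeness is required only at one vector of \<open>ell2\<close>, hence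
  sequences suffice; no bound on the norms of \<open>X n\<close> is claimed. The three slots are the
  two families of a product functional and one family of a functional compared with it.\<close>

lemma strong_approximation:
  fixes \<xi> :: "'i::countable \<Rightarrow> 'a::complex_hilbert_space"
    and \<eta> :: "'j::countable \<Rightarrow> 'a" and \<zeta> :: "'k::countable \<Rightarrow> 'a"
  assumes S: "csubspace S" and U: "U \<in> sigma_weak closure_of S"
    and sq: "sq_summable \<xi>" "sq_summable \<eta>" "sq_summable \<zeta>"
  obtains X where "\<And>n :: nat. X n \<in> S" "(\<lambda>n. amp (X n) \<xi>) \<longlonglongrightarrow> amp U \<xi>"
    "(\<lambda>n. amp (X n) \<eta>) \<longlonglongrightarrow> amp U \<eta>" "(\<lambda>n. amp (X n) \<zeta>) \<longlonglongrightarrow> amp U \<zeta>"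
proof -
  define z where "z = case_sum \<xi> (case_sum \<eta> \<zeta>)"
  have z: "sq_summable z"
    by (simp add: z_def sq_summable_case_sum sq)
  obtain x where x: "\<And>n. x n \<in> (\<lambda>X. amp X z) ` S" "x \<longlonglongrightarrow> amp U z"
    using amp_in_closure [OF S U z] unfolding closure_sequential by metis
  have "\<exists>X\<in>S. x n = amp X z" for n
    using x(1) [of n] by blast
  then obtain X where X: "\<And>n. X n \<in> S" "\<And>n. x n = amp (X n) z"
    by metis
  have "(\<lambda>n. amp (X n) (\<lambda>k. z (j k))) \<longlonglongrightarrow> amp U (\<lambda>k. z (j k))" if j: "inj j" for j :: "'l \<Rightarrow> _"
  proof -
    have *: "(\<lambda>n. norm (amp (X n) z - amp U z)) \<longlonglongrightarrow> 0"
      using x(2) unfolding X(2) by (intro tendsto_norm_zero) (simp add: LIM_zero)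
    have "(\<lambda>n. amp (X n) (\<lambda>k. z (j k)) - amp U (\<lambda>k. z (j k))) \<longlonglongrightarrow> 0"
    proof (rule tendsto_norm_zero_cancel [OF tendsto_sandwich [OF _ _ tendsto_const *]])
      show "\<forall>\<^sub>F n in sequentially. norm (amp (X n) (\<lambda>k. z (j k)) - amp U (\<lambda>k. z (j k)))
          \<le> norm (amp (X n) z - amp U z)"
        using norm_amp_comp_le [OF z j] by (simp flip: amp_diff add: z)
    qed simp
    then show ?thesis
      by (rule LIM_zero_cancel)
  qed
  from this [of Inl] this [of "\<lambda>k. Inr (Inl k)"] this [of "\<lambda>k. Inr (Inr k)"] show thesis
    using that [OF X(1)] by (simp add: z_def inj_def)
qed

section \<open>The Schur product of positive semidefinite matrices\<close>

text \<open>Membership in \<open>\<real>\<^sub>\<ge>\<^sub>0\<close> also says that the quadratic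
  form is real, which encodes Hermitian symmetry.\<close>

definition psd :: "'i set \<Rightarrow> ('i \<Rightarrow> 'i \<Rightarrow> complex) \<Rightarrow> bool" where
  "psd I M \<longleftrightarrow> (\<forall>c. (\<Sum>i\<in>I. \<Sum>j\<in>I. cnj (c i) * c j * M i j) \<in> \<real>\<^sub>\<ge>\<^sub>0)"

text \<open>Gram--Schmidt: splitting off the component of the vectors along one of them reduces the
  number of nonzero vectors, and the rank-one part is an instance of positivity of \<open>M\<close>.\<close>

lemma psd_schur:
  fixes v :: "'i \<Rightarrow> 'a::complex_hilbert_space"
  assumes "finite I" "psd I M"
  shows "(\<Sum>i\<in>I. \<Sum>j\<in>I. M i j * cinner (v i) (v j)) \<in> \<real>\<^sub>\<ge>\<^sub>0"
  using assms
proof (induction arbitrary: v rule: finite_induct)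
  case (insert a I)
  have psd: "psd I M"
    unfolding psd_def
  proof
    fix c :: "'i \<Rightarrow> complex"
    \<comment> \<open>A zero coefficient at \<open>a\<close> restricts the form to the principal
      submatrix over \<open>I\<close>.\<close>
    define c' where "c' = c(a := 0)"
    have c': "c' a = 0" "\<And>i. i \<in> I \<Longrightarrow> c' i = c i"
      using insert.hyps by (auto simp: c'_def)
    have "(\<Sum>i\<in>insert a I. \<Sum>j\<in>insert a I. cnj (c' i) * c' j * M i j) \<in> \<real>\<^sub>\<ge>\<^sub>0"
      using insert.prems unfolding psd_def by blast
    then show "(\<Sum>i\<in>I. \<Sum>j\<in>I. cnj (c i) * c j * M i j) \<in> \<real>\<^sub>\<ge>\<^sub>0"
      using insert.hyps by (simp add: c')
  qed
  \<comment> \<open>The Gram-Schmidt coefficient. If \<open>v a = 0\<close>, division by zero makes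
    it 0, and \<open>w a = 0\<close> still holds.\<close>
  define c where "c i = cinner (v a) (v i) / of_real ((norm (v a))\<^sup>2)" for i
  define w where "w i = v i - c i *\<^sub>C v a" for i
  have wa: "w a = 0"
    by (cases "v a = 0") (simp_all add: w_def c_def cinner_self)
  have orth: "cinner (v a) (w i) = 0" for i
    by (cases "v a = 0")
      (simp_all add: w_def c_def cinner.diff_right cinner_scaleC_right cinner_self)
  then have orth': "cinner (w i) (v a) = 0" for i
    by (metis cinner_commute complex_cnj_zero)
  have split: "cinner (v i) (v j) = of_real ((norm (v a))\<^sup>2) * (cnj (c i) * c j) + cinner (w i) (w j)" for i j
  proof -
    have "v i = c i *\<^sub>C v a + w i" "v j = c j *\<^sub>C v a + w j"
      by (simp_all add: w_def)
    then show ?thesis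
      by (simp add: cinner_add_left cinner_add_right cinner_scaleC_left
        cinner_scaleC_right orth orth'
          cinner_self)
  qed
  have "(\<Sum>i\<in>insert a I. \<Sum>j\<in>insert a I. M i j * cinner (w i) (w j)) =
      (\<Sum>i\<in>I. \<Sum>j\<in>I. M i j * cinner (w i) (w j))"
    using insert.hyps by (simp add: wa)
  also have "\<dots> \<in> \<real>\<^sub>\<ge>\<^sub>0"
    by (rule insert.IH [OF psd])
  finally have 1: "(\<Sum>i\<in>insert a I. \<Sum>j\<in>insert a I. M i j * cinner (w i) (w j)) \<in> \<real>\<^sub>\<ge>\<^sub>0" .
  have "(\<Sum>i\<in>insert a I. \<Sum>j\<in>insert a I. cnj (c i) * c j * M i j) \<in> \<real>\<^sub>\<ge>\<^sub>0"
    using insert.prems unfolding psd_def by blast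
  then have 2: "of_real ((norm (v a))\<^sup>2) * (\<Sum>i\<in>insert a I. \<Sum>j\<in>insert a I. cnj (c i) * c j * M i j) \<in> \<real>\<^sub>\<ge>\<^sub>0"
    by (intro nonneg_Reals_mult_I) simp_all
  have "(\<Sum>i\<in>insert a I. \<Sum>j\<in>insert a I. M i j * cinner (v i) (v j)) =
      of_real ((norm (v a))\<^sup>2) * (\<Sum>i\<in>insert a I. \<Sum>j\<in>insert a I. cnj (c i) * c j * M i j)
      + (\<Sum>i\<in>insert a I. \<Sum>j\<in>insert a I. M i j * cinner (w i) (w j))"
    unfolding split sum_distrib_left sum.distrib [symmetric]
    by (intro sum.cong refl) (simp add: algebra_simps)
  also have "\<dots> \<in> \<real>\<^sub>\<ge>\<^sub>0"
    by (rule nonneg_Reals_add_I [OF 2 1])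
  finally show ?case .
qed simp

section \<open>Tensor products of operators\<close>

lemma
  assumes "hilbert_tensor t"
  shows tensor_add_left: "t (x + x') y = t x y + t x' y"
    and tensor_add_right: "t x (y + y') = t x y + t x y'"
    and tensor_scaleC_left: "t (c *\<^sub>C x) y = c *\<^sub>C t x y"
    and tensor_scaleC_right: "t x (c *\<^sub>C y) = c *\<^sub>C t x y"
    and cinner_tensor: "cinner (t x y) (t x' y') = cinner x x' * cinner y y'"
    and closure_span_tensor: "closure (span {t x y | x y. True}) = UNIV"
  using assms unfolding hilbert_tensor_def clinear_on_def by auto

lemma tensor_scaleR_left: "hilbert_tensor t \<Longrightarrow> t (r *\<^sub>R x) y = r *\<^sub>R t x y"
  by (simp add: tensor_scaleC_left flip: scaleC_of_real)

text \<open>Lets 1 \<otimes> T be obtained from the construction of S \<otimes> 1.\<close>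

lemma hilbert_tensor_flip: "hilbert_tensor t \<Longrightarrow> hilbert_tensor (\<lambda>y x. t x y)"
proof -
  assume t: "hilbert_tensor t"
  have "{t x y | y x. True} = {t x y | x y. True}"
    by blast
  then show ?thesis
    using t by (simp add: hilbert_tensor_def mult.commute)
qed

lemma norm_tensor:
  assumes "hilbert_tensor t"
  shows "norm (t x y) = norm x * norm y"
proof -
  have "complex_of_real ((norm (t x y))\<^sup>2) = of_real ((norm x * norm y)\<^sup>2)"
    using cinner_tensor [OF assms, of x y x y] by (simp add: cinner_self power_mult_distrib)
  then have "(norm (t x y))\<^sup>2 = (norm x * norm y)\<^sup>2"
    by (simp only: of_real_eq_iff)
  then show ?thesis
    by (simp add: power2_eq_iff_nonneg)
qed

lemma tensor_cinner_eqI: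
  assumes t: "hilbert_tensor t" and eq: "\<And>x y. cinner (t x y) a = cinner (t x y) b"
  shows "a = b"
proof (rule cinner_dense_eqI [OF closure_span_tensor [OF t]])
  show "cinner z a = cinner z b" if "z \<in> span {t x y | x y. True}" for z
    using that
  proof (induction rule: span_induct_alt)
    case (step r x z)
    then show ?case
      using eq by (auto simp: cinner.add_left cinner.scaleR_left)
  qed simp
qed

lemma tensor_blinfun_eqI:
  assumes t: "hilbert_tensor t" and eq: "\<And>x y. blinfun_apply U (t x y) = blinfun_apply U' (t x y)"
  shows "U = U'"
proof (rule blinfun_eqI)
  fix z
  have "closed {z. blinfun_apply U z = blinfun_apply U' z}"
    by (intro closed_Collect_eq continuous_intros)
  moreover have "span {t x y | x y. True} \<subseteq> {z. blinfun_apply U z = blinfun_apply U' z}"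
  proof
    fix z
    assume "z \<in> span {t x y | x y. True}"
    then show "z \<in> {z. blinfun_apply U z = blinfun_apply U' z}"
    proof (induction rule: span_induct_alt)
      case (step r x z)
      then show ?case
        using eq by (auto simp: blinfun.add_right blinfun.scaleR_right)
    qed simp
  qed
  ultimately have "closure (span {t x y | x y. True}) \<subseteq> {z. blinfun_apply U z = blinfun_apply U' z}"
    by (rule closure_minimal [rotated])
  then show "blinfun_apply U z = blinfun_apply U' z"
    using closure_span_tensor [OF t] by blast
qed

text \<open>The point is the bound by \<open>norm S\<close> on sums of elementary tensors. For such
  a sum z with image w, the difference of the squares of \<open>norm S * norm z\<close> and
  \<open>norm w\<close> is a Schur product of a positive matrix with the Gram matrix of the second
  factors.\<close>

lemma op_tensor_left_ex:
  assumes t: "hilbert_tensor t" and S: "S \<in> bounded_ops"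
  shows "\<exists>U\<in>bounded_ops. \<forall>x y. blinfun_apply U (t x y) = t (blinfun_apply S x) y"
proof -
  define B where "B = {(t x y, t (blinfun_apply S x) y) | x y. True}"
  have bound: "norm w \<le> norm S * norm z" if zw: "(z, w) \<in> span B" for z w
  proof -
    obtain I r where I: "finite I" "I \<subseteq> B" "(\<Sum>p\<in>I. r p *\<^sub>R p) = (z, w)"
      using zw unfolding span_explicit mem_Collect_eq by metis
    have "\<forall>p\<in>I. \<exists>q. p = (t (fst q) (snd q), t (blinfun_apply S (fst q)) (snd q))"
      using I(2) by (auto simp: B_def)
    then obtain q
      where q: "\<forall>p\<in>I. p = (t (fst (q p)) (snd (q p)), t (blinfun_apply S (fst (q p))) (snd (q p)))"
      by (rule bchoice [THEN exE])
    \<comment> \<open>The real coefficients of the span are absorbed into the first tensor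
      factor.\<close>
    define x where "x p = r p *\<^sub>R fst (q p)" for p
    define y where "y p = snd (q p)" for p
    have "z = (\<Sum>p\<in>I. r p *\<^sub>R fst p)"
      using arg_cong [OF I(3), of fst] by (simp add: fst_sum)
    also have "\<dots> = (\<Sum>p\<in>I. t (x p) (y p))"
      using q by (intro sum.cong refl) (metis fst_conv tensor_scaleR_left [OF t] x_def y_def)
    finally have z: "z = (\<Sum>p\<in>I. t (x p) (y p))" .
    have "w = (\<Sum>p\<in>I. r p *\<^sub>R snd p)"
      using arg_cong [OF I(3), of snd] by (simp add: snd_sum)
    also have "\<dots> = (\<Sum>p\<in>I. t (blinfun_apply S (x p)) (y p))"
      using q
      by (intro sum.cong refl) (metis snd_conv tensor_scaleR_left [OF t] x_def y_def
        blinfun.scaleR_right)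
    finally have w: "w = (\<Sum>p\<in>I. t (blinfun_apply S (x p)) (y p))" .
    \<comment> \<open>The matrix of the form of the positive operator \<open>norm S\<close> squared
      minus S* S at the vectors \<open>x p\<close>; its positivity is the inequality defining the
      operator norm.\<close>
    define M where "M p p' = of_real ((norm S)\<^sup>2) * cinner (x p) (x p')
        - cinner (blinfun_apply S (x p)) (blinfun_apply S (x p'))" for p p'
    have "psd I M"
      unfolding psd_def
    proof
      fix c :: "_ \<Rightarrow> complex"
      define u where "u = (\<Sum>p\<in>I. c p *\<^sub>C x p)"
      have "(\<Sum>p\<in>I. \<Sum>p'\<in>I. cnj (c p) * c p' * cinner (f p) (f p')) = cinner (\<Sum>p\<in>I. c p *\<^sub>C f p) (\<Sum>p\<in>I. c p *\<^sub>C f p)"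
        for f :: "_ \<Rightarrow> 'z::complex_hilbert_space"
        by (simp add: cinner.sum_left cinner.sum_right cinner_scaleC_left cinner_scaleC_right
            sum_distrib_left mult_ac) (rule sum.swap)
      note gram = this
      have Su: "(\<Sum>p\<in>I. c p *\<^sub>C blinfun_apply S (x p)) = blinfun_apply S u"
        by (simp add: u_def blinfun.sum_right bounded_ops_scaleC S)
      have "(\<Sum>p\<in>I. \<Sum>p'\<in>I. cnj (c p) * c p' * M p p') =
          of_real ((norm S)\<^sup>2) * (\<Sum>p\<in>I. \<Sum>p'\<in>I. cnj (c p) * c p' * cinner (x p) (x p'))
          - (\<Sum>p\<in>I. \<Sum>p'\<in>I. cnj (c p) * c p' * cinner (blinfun_apply S (x p)) (blinfun_apply S (x p')))"
        unfolding M_def sum_distrib_left sum_subtractf [symmetric]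
        by (intro sum.cong refl) (simp add: algebra_simps)
      also have "\<dots> = of_real ((norm S * norm u)\<^sup>2 - (norm (blinfun_apply S u))\<^sup>2)"
        unfolding gram Su by (simp add: cinner_self u_def power_mult_distrib)
      also have "\<dots> \<in> \<real>\<^sub>\<ge>\<^sub>0"
        using power_mono [OF norm_blinfun [of S u] norm_ge_zero, of 2]
        by (simp only: nonneg_Reals_of_real_iff diff_ge_0_iff_ge)
      finally show "(\<Sum>p\<in>I. \<Sum>p'\<in>I. cnj (c p) * c p' * M p p') \<in> \<real>\<^sub>\<ge>\<^sub>0" .
    qed
    have gram_t: "cinner (\<Sum>p\<in>I. t (a p) (y p)) (\<Sum>p\<in>I. t (a p) (y p)) =
        (\<Sum>p\<in>I. \<Sum>p'\<in>I. cinner (a p) (a p') * cinner (y p) (y p'))" for a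
      by (simp add: cinner.sum_left cinner.sum_right cinner_tensor [OF t]) (rule sum.swap)
    have "(\<Sum>p\<in>I. \<Sum>p'\<in>I. M p p' * cinner (y p) (y p')) \<in> \<real>\<^sub>\<ge>\<^sub>0"
      by (rule psd_schur [OF I(1) \<open>psd I M\<close>])
    also have "(\<Sum>p\<in>I. \<Sum>p'\<in>I. M p p' * cinner (y p) (y p')) = of_real ((norm S)\<^sup>2) * cinner z z - cinner w w"
      unfolding M_def z w gram_t sum_distrib_left sum_subtractf [symmetric]
      by (intro sum.cong refl) (simp add: algebra_simps)
    also have "\<dots> = of_real ((norm S * norm z)\<^sup>2 - (norm w)\<^sup>2)"
      by (simp add: cinner_self power_mult_distrib)
    finally have "(norm w)\<^sup>2 \<le> (norm S * norm z)\<^sup>2"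
      by (simp only: nonneg_Reals_of_real_iff diff_ge_0_iff_ge)
    then show ?thesis
      by (rule power2_le_imp_le) simp
  qed
  obtain U where U: "clinear_on UNIV (blinfun_apply U)"
    "\<And>z w. (z, w) \<in> span B \<Longrightarrow> blinfun_apply U z = w"
  proof (rule extend_bounded_relation [of "span B" "norm S"])
    show "(x + x', y + y') \<in> span B" if "(x, y) \<in> span B" "(x', y') \<in> span B" for x y x' y'
      using span_add [OF that] by simp
    have "(c *\<^sub>C fst p, c *\<^sub>C snd p) \<in> span B" if "p \<in> span B" for c p
      using that
    proof (induction rule: span_induct_alt)
      case base
      then show ?case
        by (simp add: span_zero flip: zero_prod_def)
    next
      case (step r p p')
      have "(c *\<^sub>C fst p, c *\<^sub>C snd p) \<in> B"
        using step(1)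
        by (auto simp: B_def bounded_ops_scaleC S simp flip: tensor_scaleC_left [OF t])
          (metis bounded_ops_scaleC S)
      then have "r *\<^sub>R (c *\<^sub>C fst p, c *\<^sub>C snd p) + (c *\<^sub>C fst p', c *\<^sub>C snd p') \<in> span B"
        by (intro span_add span_scale span_base step)
      then show ?case
        by (simp add: scaleC_add_right scaleC.scaleR_right)
    qed
    then show "(c *\<^sub>C x, c *\<^sub>C y) \<in> span B" if "(x, y) \<in> span B" for c x y
      using that by fastforce
    have "fst ` span B = span (fst ` B)"
      by (rule linear_span_image [symmetric]) (simp add: bounded_linear.linear bounded_linear_fst)
    also have "fst ` B = {t x y | x y. True}"
      by (force simp: B_def)
    finally show "closure (fst ` span B) = UNIV"
      using closure_span_tensor [OF t] by simp
  qed (use bound in auto)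
  have "blinfun_apply U (t x y) = t (blinfun_apply S x) y" for x y
    by (intro U span_base) (auto simp: B_def)
  then show ?thesis
    using U(1) by (auto simp: bounded_ops_def)
qed

lemma bounded_ops_compose: "S \<in> bounded_ops \<Longrightarrow> T \<in> bounded_ops \<Longrightarrow> S o\<^sub>L T \<in> bounded_ops"
  by (rule bounded_opsI) (simp_all add: blinfun.add_right bounded_ops_scaleC)

lemma bounded_ops_id: "id_blinfun \<in> bounded_ops"
  by (rule bounded_opsI) simp_all

lemma blinfun_compose_id [simp]: "T o\<^sub>L id_blinfun = T" "id_blinfun o\<^sub>L T = T"
  by (rule blinfun_eqI; simp)+

lemma adj_id: "adj id_blinfun = id_blinfun"
  by (rule adj_unique) simp

lemma op_tensor_eqI:
  assumes "hilbert_tensor t" "U \<in> bounded_ops"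
    and "\<And>x y. blinfun_apply U (t x y) = t (blinfun_apply S x) (blinfun_apply T y)"
  shows "op_tensor t S T = U"
  unfolding op_tensor_def by (rule the_equality) (use assms tensor_blinfun_eqI in metis)+

lemma
  assumes t: "hilbert_tensor t" and S: "S \<in> bounded_ops" and T: "T \<in> bounded_ops"
  shows op_tensor_in_bounded_ops: "op_tensor t S T \<in> bounded_ops"
    and op_tensor_apply:
      "blinfun_apply (op_tensor t S T) (t x y) = t (blinfun_apply S x) (blinfun_apply T y)"
proof -
  obtain U where U: "U \<in> bounded_ops" "\<And>x y. blinfun_apply U (t x y) = t (blinfun_apply S x) y"
    using op_tensor_left_ex [OF t S] by blast
  obtain W where W: "W \<in> bounded_ops" "\<And>x y. blinfun_apply W (t x y) = t x (blinfun_apply T y)"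
    using op_tensor_left_ex [OF hilbert_tensor_flip [OF t] T] by blast
  have "op_tensor t S T = U o\<^sub>L W"
    by (rule op_tensor_eqI [OF t]) (simp_all add: U W bounded_ops_compose)
  then show "op_tensor t S T \<in> bounded_ops"
    "blinfun_apply (op_tensor t S T) (t x y) = t (blinfun_apply S x) (blinfun_apply T y)"
    by (simp_all add: U W bounded_ops_compose)
qed

lemma op_tensor_compose:
  assumes "hilbert_tensor t" "S \<in> bounded_ops" "T \<in> bounded_ops" "S' \<in> bounded_ops" "T' \<in> bounded_ops"
  shows "op_tensor t S T o\<^sub>L op_tensor t S' T' = op_tensor t (S o\<^sub>L S') (T o\<^sub>L T')"
  by (rule op_tensor_eqI [symmetric])
    (simp_all add: assms bounded_ops_compose op_tensor_in_bounded_ops op_tensor_apply)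

lemma op_tensor_scaleC:
  assumes "hilbert_tensor t" "S \<in> bounded_ops" "T \<in> bounded_ops"
  shows "c *\<^sub>C op_tensor t S T = op_tensor t (c *\<^sub>C S) T"
proof (rule op_tensor_eqI [symmetric])
  show "c *\<^sub>C op_tensor t S T \<in> bounded_ops"
    using csubspace_bounded_ops op_tensor_in_bounded_ops [OF assms] unfolding csubspace_def by blast
qed (simp_all add: assms op_tensor_apply scaleC_blinfun.rep_eq tensor_scaleC_left)

lemma adj_op_tensor:
  assumes t: "hilbert_tensor t" and S: "S \<in> bounded_ops" and T: "T \<in> bounded_ops"
  shows "adj (op_tensor t S T) = op_tensor t (adj S) (adj T)"
proof (rule op_tensor_eqI [symmetric])
  show "blinfun_apply (adj (op_tensor t S T)) (t x y) = t (blinfun_apply (adj S) x) (blinfun_apply (adj T) y)" for x y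
    by (rule tensor_cinner_eqI [OF t])
      (simp add: cinner_adj_right op_tensor_in_bounded_ops op_tensor_apply assms cinner_tensor)
qed (simp_all add: assms op_tensor_in_bounded_ops adj_in_bounded_ops)

section \<open>Von Neumann algebras and their tensor products\<close>

lemma commutant_bounded: "commutant N \<subseteq> bounded_ops"
  by (auto simp: commutant_def)

lemma
  assumes "von_neumann_algebra M"
  shows vna_bounded: "M \<subseteq> bounded_ops"
    and vna_adj: "T \<in> M \<Longrightarrow> adj T \<in> M"
    and vna_bicommutant: "commutant (commutant M) = M"
  using assms by (auto simp: von_neumann_algebra_def)

lemma vna_id: "von_neumann_algebra M \<Longrightarrow> id_blinfun \<in> M"
proof -
  assume M: "von_neumann_algebra M"
  have "id_blinfun \<in> commutant (commutant M)"
    unfolding commutant_def [of "commutant M"] by (auto simp: bounded_ops_id intro!: blinfun_eqI)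
  then show ?thesis
    by (simp add: vna_bicommutant M)
qed

lemma vna_compose:
  assumes "von_neumann_algebra M" "S \<in> M" "T \<in> M"
  shows "S o\<^sub>L T \<in> M"
proof -
  have "(S o\<^sub>L T) o\<^sub>L W = W o\<^sub>L (S o\<^sub>L T)" if "W \<in> commutant M" for W
  proof -
    have "S o\<^sub>L W = W o\<^sub>L S" "T o\<^sub>L W = W o\<^sub>L T"
      using that assms(2,3) by (auto simp: commutant_def)
    then have "blinfun_apply S (blinfun_apply W x) = blinfun_apply W (blinfun_apply S x)"
      "blinfun_apply T (blinfun_apply W x) = blinfun_apply W (blinfun_apply T x)" for x
      by (metis blinfun_apply_blinfun_compose)+
    then show ?thesis
      by (intro blinfun_eqI) simp
  qed
  then have "S o\<^sub>L T \<in> commutant (commutant M)"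
    using assms vna_bounded [OF assms(1)]
    by (auto simp: commutant_def [of "commutant M"] intro: bounded_ops_compose)
  then show ?thesis
    by (simp add: vna_bicommutant assms)
qed

lemma csubspace_commutant:
  assumes "N \<subseteq> bounded_ops"
  shows "csubspace (commutant N)"
proof -
  have "(c *\<^sub>C T) o\<^sub>L S = S o\<^sub>L (c *\<^sub>C T)" if "S \<in> N" "T o\<^sub>L S = S o\<^sub>L T" for c S T
  proof (rule blinfun_eqI)
    fix x
    have "blinfun_apply (T o\<^sub>L S) x = blinfun_apply (S o\<^sub>L T) x"
      by (simp only: that)
    then show "blinfun_apply ((c *\<^sub>C T) o\<^sub>L S) x = blinfun_apply (S o\<^sub>L (c *\<^sub>C T)) x"
      using subsetD [OF assms that(1)] by (simp add: scaleC_blinfun.rep_eq bounded_ops_scaleC)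
  qed
  then show ?thesis
    using csubspace_bounded_ops
    by (auto
      simp: csubspace_def commutant_def bounded_bilinear.add_left [OF bounded_bilinear_blinfun_compose] bounded_bilinear.add_right [OF bounded_bilinear_blinfun_compose]
        bounded_bilinear.zero_left [OF bounded_bilinear_blinfun_compose] bounded_bilinear.zero_right [OF bounded_bilinear_blinfun_compose])
qed

lemma vna_csubspace: "von_neumann_algebra M \<Longrightarrow> csubspace M"
  using csubspace_commutant [OF commutant_bounded, of M] vna_bicommutant [of M] by simp

definition elem_tensors ::
  "('a::complex_hilbert_space \<Rightarrow> 'b::complex_hilbert_space \<Rightarrow> 'c::complex_hilbert_space) \<Rightarrow>
     ('a \<Rightarrow>\<^sub>L 'a) set \<Rightarrow> ('b \<Rightarrow>\<^sub>L 'b) set \<Rightarrow> ('c \<Rightarrow>\<^sub>L 'c) set" where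
  "elem_tensors t M N = {op_tensor t S T | S T. S \<in> M \<and> T \<in> N}"

lemma vn_tensor_eq: "vn_tensor t M N = sigma_weak closure_of (span (elem_tensors t M N))"
  by (simp add: vn_tensor_def elem_tensors_def)

context
  fixes t :: "'a::complex_hilbert_space \<Rightarrow> 'b::complex_hilbert_space \<Rightarrow> 'c::complex_hilbert_space"
    and M :: "('a \<Rightarrow>\<^sub>L 'a) set" and N :: "('b \<Rightarrow>\<^sub>L 'b) set"
  assumes t: "hilbert_tensor t" and M: "csubspace M" "M \<subseteq> bounded_ops" and N: "N \<subseteq> bounded_ops"
begin

lemma csubspace_span_elem_tensors: "csubspace (span (elem_tensors t M N))"
  unfolding csubspace_def
proof (intro conjI ballI allI)
  show "c *\<^sub>C X \<in> span (elem_tensors t M N)" if "X \<in> span (elem_tensors t M N)" for c X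
    using that
  proof (induction rule: span_induct_alt)
    case base
    have "c *\<^sub>C (0 :: 'c \<Rightarrow>\<^sub>L 'c) = 0"
      by (rule blinfun_eqI) (simp add: scaleC_blinfun.rep_eq)
    then show ?case
      by (simp add: span_zero)
  next
    case (step r X Y)
    obtain S T where "S \<in> M" "T \<in> N" "X = op_tensor t S T"
      using step(1) by (auto simp: elem_tensors_def)
    then have "c *\<^sub>C X = op_tensor t (c *\<^sub>C S) T" "c *\<^sub>C S \<in> M"
      using M N op_tensor_scaleC [OF t, of S T c] by (auto simp: csubspace_def)
    then have "c *\<^sub>C X \<in> elem_tensors t M N"
      using \<open>T \<in> N\<close> unfolding elem_tensors_def by blast
    then have "r *\<^sub>R (c *\<^sub>C X) + c *\<^sub>C Y \<in> span (elem_tensors t M N)"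
      by (intro span_add span_scale span_base step)
    moreover have "c *\<^sub>C (r *\<^sub>R X + Y) = r *\<^sub>R (c *\<^sub>C X) + c *\<^sub>C Y"
      by (rule blinfun_eqI)
        (simp add: scaleC_blinfun.rep_eq blinfun.add_left
          blinfun.scaleR_left scaleC_add_right scaleC.scaleR_right)
    ultimately show ?case
      by simp
  qed
qed (auto intro: span_zero span_add)

lemma span_elem_tensors_bounded: "span (elem_tensors t M N) \<subseteq> bounded_ops"
proof
  fix X
  assume "X \<in> span (elem_tensors t M N)"
  then show "X \<in> bounded_ops"
  proof (induction rule: span_induct_alt)
    case (step r X Y)
    have "X \<in> bounded_ops"
      using step(1) M N op_tensor_in_bounded_ops [OF t] by (auto simp: elem_tensors_def)
    then have "of_real r *\<^sub>C X + Y \<in> bounded_ops"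
      using csubspace_bounded_ops step(2) by (auto simp: csubspace_def)
    then show ?case
      by (simp add: scaleC_of_real_blinfun)
  qed (use csubspace_bounded_ops in \<open>auto simp: csubspace_def\<close>)
qed

lemma csubspace_vn_tensor: "csubspace (vn_tensor t M N)"
  unfolding vn_tensor_eq
  by (intro csubspace_sigma_weak_closure csubspace_span_elem_tensors span_elem_tensors_bounded)

lemma vn_tensor_bounded: "vn_tensor t M N \<subseteq> bounded_ops"
  unfolding vn_tensor_eq using closure_of_subset_topspace topspace_sigma_weak by metis

lemma span_elem_tensors_subset: "span (elem_tensors t M N) \<subseteq> vn_tensor t M N"
  unfolding vn_tensor_eq using closure_of_subset span_elem_tensors_bounded topspace_sigma_weak
  by metis

lemma op_tensor_in_vn_tensor: "S \<in> M \<Longrightarrow> T \<in> N \<Longrightarrow> op_tensor t S T \<in> vn_tensor t M N"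
  using span_elem_tensors_subset by (force simp: elem_tensors_def intro: span_base)

lemma vsums_eq_on_vn_tensor:
  assumes f: "f \<in> vsums" and g: "g \<in> vsums"
    and eq: "\<And>S T. S \<in> M \<Longrightarrow> T \<in> N \<Longrightarrow> f (op_tensor t S T) = g (op_tensor t S T)"
    and U: "U \<in> vn_tensor t M N"
  shows "f U = g U"
proof (rule vsums_eq_on_closure [OF f g _ U [unfolded vn_tensor_eq]])
  have lin: "h (r *\<^sub>R X + Y) = r *\<^sub>R h X + h Y" if h: "h \<in> vsums" for h r and X Y :: "'c \<Rightarrow>\<^sub>L 'c"
    using vsums_clinear [OF h, of UNIV]
    by (simp add: clinear_on_def scaleC_complex_def scaleR_conv_of_real
      flip: scaleC_of_real_blinfun)
  show "f X = g X" if "X \<in> span (elem_tensors t M N)" for X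
    using that
  proof (induction rule: span_induct_alt)
    case base
    show ?case
      using lin [OF f, of 0 0 0] lin [OF g, of 0 0 0] lin [OF f, of 1 0 0] lin [OF g, of 1 0 0]
      by simp
  next
    case (step r X Y)
    then show ?case
      using eq by (auto simp: lin f g elem_tensors_def)
  qed
qed

end

text \<open>Left multiplication by a fixed operator is sigma-weakly continuous and preserves the
  algebraic span. This keeps the product of the adjoint of 1 \<otimes> d with \<open>U\<close>
  inside the tensor product, the only place where \<open>functional_tensor\<close> is
  determined.\<close>

lemma op_tensor_compose_vn_tensor:
  assumes t: "hilbert_tensor t" and M: "von_neumann_algebra M" and N: "von_neumann_algebra N"
    and S: "S \<in> M" and T: "T \<in> N" and U: "U \<in> vn_tensor t M N"
  shows "op_tensor t S T o\<^sub>L U \<in> vn_tensor t M N"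
proof -
  let ?D = "op_tensor t S T"
  note b = vna_bounded [OF M] vna_bounded [OF N]
  have D: "?D \<in> bounded_ops"
    using S T b by (auto intro: op_tensor_in_bounded_ops [OF t])
  have cont: "continuous_map sigma_weak sigma_weak (\<lambda>X. ?D o\<^sub>L X)"
  proof (rule continuous_map_into_sigma_weak)
    show "continuous_map sigma_weak euclidean (\<lambda>X. vsum \<xi> \<eta> (?D o\<^sub>L X))"
      if "sq_summable \<xi>" "sq_summable \<eta>" for \<xi> \<eta> :: "nat \<Rightarrow> _"
      unfolding vsum_compose_left [OF D] by (intro continuous_map_vsum sq_summable_blinfun that)
  qed (simp add: topspace_sigma_weak bounded_ops_compose D)
  have "?D o\<^sub>L X \<in> span (elem_tensors t M N)" if "X \<in> span (elem_tensors t M N)" for X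
    using that
  proof (induction rule: span_induct_alt)
    case (step r X Y)
    obtain S' T' where X: "S' \<in> M" "T' \<in> N" "X = op_tensor t S' T'"
      using step(1) by (auto simp: elem_tensors_def)
    then have "?D o\<^sub>L X = op_tensor t (S o\<^sub>L S') (T o\<^sub>L T')"
      using S T b by (auto intro: op_tensor_compose [OF t])
    then have "?D o\<^sub>L X \<in> elem_tensors t M N"
      using vna_compose [OF M S X(1)] vna_compose [OF N T X(2)] unfolding elem_tensors_def by blast
    then show ?case
      by (simp
        add: bounded_bilinear.add_right [OF bounded_bilinear_blinfun_compose] bounded_bilinear.scaleR_right [OF bounded_bilinear_blinfun_compose] span_add span_scale span_base step)
  qed (simp add: span_zero bounded_bilinear.zero_right [OF bounded_bilinear_blinfun_compose])
  then show ?thesis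
    using sigma_weak_closure_map [OF cont _ U [unfolded vn_tensor_eq]]
      span_elem_tensors_subset [OF t vna_csubspace [OF M] b]
    unfolding vn_tensor_eq by blast
qed

section \<open>Tensor products of normal functionals\<close>

definition tens :: "('a \<Rightarrow> 'b \<Rightarrow> 'c) \<Rightarrow> ('i \<Rightarrow> 'a) \<Rightarrow> ('j \<Rightarrow> 'b) \<Rightarrow> 'i \<times> 'j \<Rightarrow> 'c" where
  "tens t \<xi> \<xi>' = (\<lambda>(i, j). t (\<xi> i) (\<xi>' j))"

lemma sq_summable_tens:
  assumes t: "hilbert_tensor t" and "sq_summable \<xi>" "sq_summable \<xi>'"
  shows "sq_summable (tens t \<xi> \<xi>')"
  unfolding sq_summable_def UNIV_Times_UNIV [symmetric]
proof (rule summable_on_SigmaI)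
  show "((\<lambda>j. (norm (tens t \<xi> \<xi>' (i, j)))\<^sup>2) has_sum (norm (\<xi> i))\<^sup>2 * (\<Sum>\<^sub>\<infinity>j. (norm (\<xi>' j))\<^sup>2)) UNIV"
    for i
    using assms unfolding tens_def sq_summable_def
    by (auto simp: norm_tensor [OF t] power_mult_distrib intro!: has_sum_cmult_right has_sum_infsum)
  show "(\<lambda>i. (norm (\<xi> i))\<^sup>2 * (\<Sum>\<^sub>\<infinity>j. (norm (\<xi>' j))\<^sup>2)) summable_on UNIV"
    using assms unfolding sq_summable_def by (intro summable_on_cmult_left)
qed simp

lemma sq_summable_tensor:
  assumes t: "hilbert_tensor t" and "sq_summable \<xi>"
  shows "sq_summable (\<lambda>j. t x (\<xi> j))"
  by (rule sq_summable_bounded [OF assms(2), where K = "norm x"]) (simp add: norm_tensor [OF t])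

lemma norm_Abs_tensor:
  assumes t: "hilbert_tensor t" and \<xi>: "sq_summable \<xi>"
  shows "norm (Abs_ell2 (\<lambda>j. t x (\<xi> j))) = norm x * norm (Abs_ell2 \<xi>)"
proof -
  have "(norm (Abs_ell2 (\<lambda>j. t x (\<xi> j))))\<^sup>2 = (norm x * norm (Abs_ell2 \<xi>))\<^sup>2"
    using \<xi> sq_summable_tensor [OF assms, of x]
      unfolding sq_summable_def power_mult_distrib power2_norm_ell2
    by (simp add: Abs_ell2_inverse sq_summable_def norm_tensor [OF t] power_mult_distrib
      infsum_cmult_right)
  then show ?thesis
    by (simp add: power2_eq_iff_nonneg)
qed

text \<open>Fubini for the product family. The inner sum is the sesquilinear form of the slice
  operator constructed in \<open>slice_ex\<close>.\<close>

lemma vsum_tens_iterated: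
  assumes t: "hilbert_tensor t"
    and "sq_summable \<xi>" "sq_summable \<eta>" "sq_summable \<xi>'" "sq_summable \<eta>'"
  shows "vsum (tens t \<xi> \<xi>') (tens t \<eta> \<eta>') U =
    (\<Sum>\<^sub>\<infinity>i. vsum (\<lambda>j. t (\<xi> i) (\<xi>' j)) (\<lambda>j. t (\<eta> i) (\<eta>' j)) U)"
  using infsum_Sigma_banach [where A = UNIV and B = "\<lambda>_. UNIV",
      OF vsum_summable [OF sq_summable_tens sq_summable_tens, unfolded UNIV_Times_UNIV [symmetric]], OF t assms(2,4) t assms(3,5), of U]
  by (simp add: vsum_def tens_def)

lemma vsum_tens_op_tensor:
  assumes t: "hilbert_tensor t" and S: "S \<in> bounded_ops" "T \<in> bounded_ops"
    and sq: "sq_summable \<xi>" "sq_summable \<eta>" "sq_summable \<xi>'" "sq_summable \<eta>'"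
  shows "vsum (tens t \<xi> \<xi>') (tens t \<eta> \<eta>') (op_tensor t S T) = vsum \<xi> \<eta> S * vsum \<xi>' \<eta>' T"
proof -
  have "vsum (\<lambda>j. t (\<xi> i) (\<xi>' j)) (\<lambda>j. t (\<eta> i) (\<eta>' j)) (op_tensor t S T) =
      cinner (\<xi> i) (blinfun_apply S (\<eta> i)) * vsum \<xi>' \<eta>' T" for i
    by (simp add: vsum_def op_tensor_apply [OF t S] cinner_tensor [OF t]
      infsum_cmult_right vsum_summable sq)
  then show ?thesis
    unfolding vsum_tens_iterated [OF t sq]
    by (simp add: infsum_cmult_left vsum_summable sq) (simp add: vsum_def)
qed

lemma vsum_tens_in_vsums:
  fixes \<xi> \<eta> :: "'i::countable \<Rightarrow> 'a::complex_hilbert_space"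
    and \<xi>' \<eta>' :: "'j::countable \<Rightarrow> 'b::complex_hilbert_space"
  assumes "hilbert_tensor t" "sq_summable \<xi>" "sq_summable \<eta>" "sq_summable \<xi>'" "sq_summable \<eta>'"
  shows "vsum (tens t \<xi> \<xi>') (tens t \<eta> \<eta>') \<in> vsums"
  by (intro vsum_in_vsums sq_summable_tens assms)

text \<open>\<open>functional_tensor\<close> is a choice. The product family witnesses that a normal
  extension exists, and every normal extension agrees with it on \<open>vn_tensor t M N\<close>,
  because normal functionals are determined there by elementary tensors.\<close>

lemma functional_tensor_eq:
  fixes \<xi> \<eta> :: "'i::countable \<Rightarrow> 'a::complex_hilbert_space"
    and \<xi>' \<eta>' :: "'j::countable \<Rightarrow> 'b::complex_hilbert_space"
  assumes t: "hilbert_tensor t" and M: "csubspace M" "M \<subseteq> bounded_ops" and N: "N \<subseteq> bounded_ops"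
    and sq: "sq_summable \<xi>" "sq_summable \<eta>" "sq_summable \<xi>'" "sq_summable \<eta>'"
    and \<mu>: "\<And>S. S \<in> M \<Longrightarrow> \<mu> S = vsum \<xi> \<eta> S" and \<nu>: "\<And>T. T \<in> N \<Longrightarrow> \<nu> T = vsum \<xi>' \<eta>' T"
    and U: "U \<in> vn_tensor t M N"
  shows "functional_tensor t M N \<mu> \<nu> U = vsum (tens t \<xi> \<xi>') (tens t \<eta> \<eta>') U"
proof -
  let ?f = "functional_tensor t M N \<mu> \<nu>" and ?h = "vsum (tens t \<xi> \<xi>') (tens t \<eta> \<eta>')"
  have elem: "?h (op_tensor t S T) = \<mu> S * \<nu> T" if "S \<in> M" "T \<in> N" for S T
    using that M N by (simp add: vsum_tens_op_tensor [OF t _ _ sq] \<mu> \<nu> subsetD)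
  have "normal_functional (vn_tensor t M N) ?f \<and> (\<forall>S\<in>M. \<forall>T\<in>N. ?f (op_tensor t S T) = \<mu> S * \<nu> T)"
    unfolding functional_tensor_def
    by (rule someI [of _ ?h]) (use elem vsums_normal [OF vsum_tens_in_vsums [OF t sq]] in auto)
  then obtain g where g: "g \<in> vsums" "\<And>T. T \<in> vn_tensor t M N \<Longrightarrow> ?f T = g T"
    "\<And>S T. S \<in> M \<Longrightarrow> T \<in> N \<Longrightarrow> ?f (op_tensor t S T) = \<mu> S * \<nu> T"
    using normal_functional_vsums [OF csubspace_vn_tensor [OF t M N] vn_tensor_bounded [OF t M N]]
    by metis
  have "g U = ?h U"
    by (rule vsums_eq_on_vn_tensor [OF t M N g(1) vsum_tens_in_vsums [OF t sq] _ U])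
      (use g elem op_tensor_in_vn_tensor [OF t M N] in metis)
  then show ?thesis
    using g(2) [OF U] by simp
qed

lemma functional_tensor_normal:
  assumes t: "hilbert_tensor t" and M: "csubspace M" "M \<subseteq> bounded_ops"
    and N: "csubspace N" "N \<subseteq> bounded_ops"
    and \<mu>: "normal_functional M \<mu>" and \<nu>: "normal_functional N \<nu>"
  obtains h where "h \<in> vsums" "\<And>U. U \<in> vn_tensor t M N \<Longrightarrow> functional_tensor t M N \<mu> \<nu> U = h U"
    "\<And>S T. S \<in> M \<Longrightarrow> T \<in> N \<Longrightarrow> h (op_tensor t S T) = \<mu> S * \<nu> T"
proof -
  obtain \<xi> \<eta> :: "nat \<Rightarrow> _" where \<xi>: "sq_summable \<xi>" "sq_summable \<eta>" "\<And>S. S \<in> M \<Longrightarrow> \<mu> S = vsum \<xi> \<eta> S"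
    using normal_functional_vsums [OF M \<mu>] unfolding vsums_def by blast
  obtain \<xi>' \<eta>' :: "nat \<Rightarrow> _"
    where \<xi>': "sq_summable \<xi>'" "sq_summable \<eta>'" "\<And>S. S \<in> N \<Longrightarrow> \<nu> S = vsum \<xi>' \<eta>' S"
    using normal_functional_vsums [OF N \<nu>] unfolding vsums_def by blast
  show thesis
  proof (rule that)
    show "vsum (tens t \<xi> \<xi>') (tens t \<eta> \<eta>') \<in> vsums"
      by (rule vsum_tens_in_vsums [OF t \<xi>(1,2) \<xi>'(1,2)])
    show "functional_tensor t M N \<mu> \<nu> U = vsum (tens t \<xi> \<xi>') (tens t \<eta> \<eta>') U"
      if "U \<in> vn_tensor t M N" for U
      by (rule functional_tensor_eq [OF t M N(2) \<xi>(1,2) \<xi>'(1,2) \<xi>(3) \<xi>'(3) that])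
    show "vsum (tens t \<xi> \<xi>') (tens t \<eta> \<eta>') (op_tensor t S T) = \<mu> S * \<nu> T" if "S \<in> M" "T \<in> N" for S T
      using that M N by (simp add: vsum_tens_op_tensor [OF t _ _ \<xi>(1,2) \<xi>'(1,2)] \<xi> \<xi>' subsetD)
  qed
qed

text \<open>\<open>vn_tensor t M N\<close> commutes with \<open>M' \<otimes> 1\<close>; this is why slices by functionals on \<open>N\<close> lie
  in \<open>M'' = M\<close>.\<close>

lemma vn_tensor_commute:
  assumes t: "hilbert_tensor t" and M: "csubspace M" "M \<subseteq> bounded_ops" and N: "N \<subseteq> bounded_ops"
    and S: "S \<in> commutant M" and U: "U \<in> vn_tensor t M N"
  shows "U o\<^sub>L op_tensor t S id_blinfun = op_tensor t S id_blinfun o\<^sub>L U"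
proof -
  let ?D = "op_tensor t S id_blinfun"
  have S': "S \<in> bounded_ops"
    using S commutant_bounded by blast
  have D: "?D \<in> bounded_ops"
    by (intro op_tensor_in_bounded_ops t S' bounded_ops_id)
  \<comment> \<open>Families over a one-element index type turn a single matrix coefficient into a
    \<open>vsum\<close>, so the commutation only has to be checked on elementary tensors.\<close>
  have sq: "sq_summable (\<lambda>_ :: unit. x)" for x :: 'c
    by (simp add: sq_summable_def)
  have eq: "vsum (\<lambda>_ :: unit. x) (\<lambda>_. blinfun_apply ?D y) U =
      vsum (\<lambda>_ :: unit. blinfun_apply (adj ?D) x) (\<lambda>_. y) U" for x y
  proof (rule vsums_eq_on_vn_tensor [OF t M N _ _ _ U])
    fix S0 T0
    assume ST: "S0 \<in> M" "T0 \<in> N"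
    then have "S0 \<in> bounded_ops" "T0 \<in> bounded_ops" "S0 o\<^sub>L S = S o\<^sub>L S0"
      using M N S by (auto simp: commutant_def)
    then have "op_tensor t S0 T0 o\<^sub>L ?D = ?D o\<^sub>L op_tensor t S0 T0"
      by (simp add: op_tensor_compose [OF t] S' bounded_ops_id)
    then have "vsum (\<lambda>_ :: unit. x) (\<lambda>_. y) (op_tensor t S0 T0 o\<^sub>L ?D) =
        vsum (\<lambda>_ :: unit. blinfun_apply (adj ?D) x) (\<lambda>_. y) (op_tensor t S0 T0)"
      by (simp only: vsum_compose_left [OF D])
    then show "vsum (\<lambda>_ :: unit. x) (\<lambda>_. blinfun_apply ?D y) (op_tensor t S0 T0) =
        vsum (\<lambda>_ :: unit. blinfun_apply (adj ?D) x) (\<lambda>_. y) (op_tensor t S0 T0)"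
      by (simp only: vsum_compose_right)
  qed (intro vsum_in_vsums sq)+
  show ?thesis
  proof (intro blinfun_eqI, rule cinner_eqI)
    show "cinner x (blinfun_apply (U o\<^sub>L ?D) y) = cinner x (blinfun_apply (?D o\<^sub>L U) y)" for x y
      using eq [of x y] by (simp add: vsum_def cinner_adj_left D)
  qed
qed

text \<open>The element r is the slice of \<open>U\<close> by \<open>\<nu>\<close>. What matters is
  that it is obtained before \<open>\<mu>\<close>: one r evaluates all normal functionals, so
  differences of functionals can be estimated at it.\<close>

lemma slice_ex:
  assumes t: "hilbert_tensor t" and M: "von_neumann_algebra M"
    and N: "csubspace N" "N \<subseteq> bounded_ops" and \<nu>: "normal_functional N \<nu>"
      and U: "U \<in> vn_tensor t M N"
  obtains r where "r \<in> M" "\<And>\<mu>. normal_functional M \<mu> \<Longrightarrow> functional_tensor t M N \<mu> \<nu> U = \<mu> r"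
proof -
  note M' = vna_csubspace [OF M] vna_bounded [OF M]
  obtain \<xi>' \<eta>' :: "nat \<Rightarrow> _"
    where \<xi>': "sq_summable \<xi>'" "sq_summable \<eta>'" "\<And>T. T \<in> N \<Longrightarrow> \<nu> T = vsum \<xi>' \<eta>' T"
    using normal_functional_vsums [OF N \<nu>] unfolding vsums_def by blast
  note sq = sq_summable_tensor [OF t \<xi>'(1)] sq_summable_tensor [OF t \<xi>'(2)]
  define B where "B x y = vsum (\<lambda>j. t x (\<xi>' j)) (\<lambda>j. t y (\<eta>' j)) U" for x y
  have U': "U \<in> bounded_ops"
    using U vn_tensor_bounded [OF t M' N(2)] by blast
  have summ: "(\<lambda>j. cinner (t x (\<xi>' j)) (blinfun_apply U (t y (\<eta>' j)))) summable_on UNIV" for x y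
    by (intro vsum_summable sq)
  obtain r where r: "r \<in> bounded_ops" "\<And>x y. cinner x (blinfun_apply r y) = B x y"
  proof (rule sesquilinear_op [of B "norm U * (norm (Abs_ell2 \<xi>') * norm (Abs_ell2 \<eta>'))"])
    show "cmod (B x y) \<le> norm U * (norm (Abs_ell2 \<xi>') * norm (Abs_ell2 \<eta>')) * norm x * norm y"
      for x y
      using cmod_vsum_le [OF sq, of x y U] by (simp add: B_def norm_Abs_tensor [OF t] \<xi>' mult_ac)
  qed (simp_all add: B_def vsum_def tensor_add_left [OF t] tensor_scaleC_left [OF t] cinner_add_left
      cinner_add_right cinner_scaleC_left cinner_scaleC_right blinfun.add_right bounded_ops_scaleC U'
      infsum_add infsum_cmult_right summ)
  have "r o\<^sub>L S = S o\<^sub>L r" if S: "S \<in> commutant M" for S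
  proof (intro blinfun_eqI, rule cinner_eqI)
    fix y x
    have S': "S \<in> bounded_ops"
      using S commutant_bounded by blast
    let ?D = "op_tensor t S id_blinfun"
    note Sid = S' bounded_ops_id
    have "cinner x (blinfun_apply (r o\<^sub>L S) y) = vsum (\<lambda>j. t x (\<xi>' j)) (\<lambda>j. blinfun_apply ?D (t y (\<eta>' j))) U"
      by (simp add: r B_def op_tensor_apply [OF t Sid])
    also have "\<dots> = vsum (\<lambda>j. t x (\<xi>' j)) (\<lambda>j. t y (\<eta>' j)) (?D o\<^sub>L U)"
      unfolding vn_tensor_commute [OF t M' N(2) S U, symmetric] vsum_compose_right ..
    also have "\<dots> = cinner x (blinfun_apply (S o\<^sub>L r) y)"
      by (simp add: vsum_compose_left op_tensor_in_bounded_ops [OF t Sid] adj_op_tensor [OF t Sid]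
          op_tensor_apply [OF t adj_in_bounded_ops [OF Sid(1)] bounded_ops_id] r adj_id B_def flip: cinner_adj_left [OF S'])
    finally show "cinner x (blinfun_apply (r o\<^sub>L S) y) = cinner x (blinfun_apply (S o\<^sub>L r) y)" .
  qed
  then have "r \<in> commutant (commutant M)"
    using r(1) by (simp add: commutant_def [of "commutant M"])
  then have rM: "r \<in> M"
    by (simp add: vna_bicommutant M)
  show thesis
  proof (rule that [OF rM])
    fix \<mu>
    assume \<mu>: "normal_functional M \<mu>"
    obtain \<xi> \<eta> :: "nat \<Rightarrow> _" where \<xi>: "sq_summable \<xi>" "sq_summable \<eta>" "\<And>S. S \<in> M \<Longrightarrow> \<mu> S = vsum \<xi> \<eta> S"
      using normal_functional_vsums [OF M' \<mu>] unfolding vsums_def by blast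
    have "functional_tensor t M N \<mu> \<nu> U = vsum (tens t \<xi> \<xi>') (tens t \<eta> \<eta>') U"
      by (rule functional_tensor_eq [OF t M' N(2) \<xi>(1,2) \<xi>'(1,2) \<xi>(3) \<xi>'(3) U])
    also have "\<dots> = \<mu> r"
      by (simp add: vsum_tens_iterated [OF t \<xi>(1,2) \<xi>'(1,2)] \<xi>(3) [OF rM] vsum_def [of \<xi>] r
        flip: B_def)
    finally show "functional_tensor t M N \<mu> \<nu> U = \<mu> r" .
  qed
qed

text \<open>\<open>functional_norm\<close> is a real supremum, meaningful only for a set bounded
  above; the bound comes from the representing families of \<open>f\<close>.\<close>

lemma cmod_le_functional_norm:
  assumes M: "csubspace M" "M \<subseteq> bounded_ops" and f: "normal_functional M f" and T: "T \<in> M"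
  shows "cmod (f T) \<le> functional_norm M f * norm T"
proof -
  obtain \<xi> \<eta> :: "nat \<Rightarrow> _" where \<xi>: "sq_summable \<xi>" "sq_summable \<eta>" "\<And>S. S \<in> M \<Longrightarrow> f S = vsum \<xi> \<eta> S"
    using normal_functional_vsums [OF M f] unfolding vsums_def by blast
  have bdd: "bdd_above ((\<lambda>T. cmod (f T)) ` {T \<in> M. norm T \<le> 1})"
  proof (rule bdd_aboveI2)
    fix T
    assume T: "T \<in> {T \<in> M. norm T \<le> 1}"
    then have "cmod (f T) \<le> norm T * (norm (Abs_ell2 \<xi>) * norm (Abs_ell2 \<eta>))"
      using cmod_vsum_le [OF \<xi>(1,2)] \<xi>(3) by simp
    also have "\<dots> \<le> 1 * (norm (Abs_ell2 \<xi>) * norm (Abs_ell2 \<eta>))"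
      using T by (intro mult_right_mono) auto
    finally show "cmod (f T) \<le> 1 * (norm (Abs_ell2 \<xi>) * norm (Abs_ell2 \<eta>))" .
  qed
  show ?thesis
  proof (cases "T = 0")
    case False
    define S where "S = complex_of_real (inverse (norm T)) *\<^sub>C T"
    have S: "S \<in> M"
      using M T by (simp add: S_def csubspace_def)
    have "S = inverse (norm T) *\<^sub>R T"
      unfolding S_def by (rule scaleC_of_real_blinfun)
    then have "norm S \<le> 1"
      using False by simp
    then have "cmod (f S) \<le> functional_norm M f"
      unfolding functional_norm_def by (intro cSUP_upper bdd) (use S in simp)
    moreover have "cmod (f S) = inverse (norm T) * cmod (f T)"
      using T S \<xi>(3) by (simp add: S_def vsum_scaleC \<xi> norm_mult norm_inverse)
    ultimately show ?thesis
      using False by (simp add: norm_mult norm_divide norm_inverse field_simps)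
  next
    case True
    then show ?thesis
      using \<xi>(3) T by simp
  qed
qed

section \<open>Tensor products of states\<close>

text \<open>The quadratic form at \<open>c\<close> is the value of \<open>f\<close> at X* X for the
  combination X of the \<open>S p\<close> with coefficients \<open>c p\<close>.\<close>

lemma psd_functional:
  assumes M: "von_neumann_algebra M" and f: "normal_functional M f"
    and pos: "\<And>T. T \<in> M \<Longrightarrow> f (adj T o\<^sub>L T) \<in> \<real>\<^sub>\<ge>\<^sub>0" and S: "\<And>p. p \<in> I \<Longrightarrow> S p \<in> M"
  shows "psd I (\<lambda>p q. f (adj (S p) o\<^sub>L S q))"
  unfolding psd_def
proof
  fix c :: "_ \<Rightarrow> complex"
  note M' = vna_csubspace [OF M] vna_bounded [OF M]
  obtain \<xi> \<eta> :: "nat \<Rightarrow> _" where \<xi>: "sq_summable \<xi>" "sq_summable \<eta>" "\<And>S. S \<in> M \<Longrightarrow> f S = vsum \<xi> \<eta> S"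
    using normal_functional_vsums [OF M' f] unfolding vsums_def by blast
  have gram: "f (adj X o\<^sub>L Y) = cinner (amp X \<xi>) (amp Y \<eta>)" if "X \<in> M" "Y \<in> M" for X Y
    using that M'
    by (simp add: \<xi>(3) vna_compose [OF M] vna_adj [OF M] vsum_adj_eq_cinner \<xi>(1,2) subsetD)
  define X where "X = (\<Sum>p\<in>I. c p *\<^sub>C S p)"
  have X: "X \<in> M"
    unfolding X_def using M'(1) S by (intro csubspace_sum) (auto simp: csubspace_def)
  have "f (adj X o\<^sub>L X) = (\<Sum>p\<in>I. \<Sum>q\<in>I. cnj (c p) * c q * cinner (amp (S p) \<xi>) (amp (S q) \<eta>))"
    unfolding gram [OF X X] unfolding X_def
    by (simp add: amp_sum amp_scaleC \<xi> cinner.sum_left cinner.sum_right cinner_scaleC_left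
        cinner_scaleC_right sum_distrib_left mult_ac) (rule sum.swap)
  also have "\<dots> = (\<Sum>p\<in>I. \<Sum>q\<in>I. cnj (c p) * c q * f (adj (S p) o\<^sub>L S q))"
    by (intro sum.cong refl) (simp add: gram S)
  finally show "(\<Sum>p\<in>I. \<Sum>q\<in>I. cnj (c p) * c q * f (adj (S p) o\<^sub>L S q)) \<in> \<real>\<^sub>\<ge>\<^sub>0"
    using pos [OF X] by simp
qed

text \<open>Cauchy-Schwarz in scalar form: the assumption is positivity of a sesquilinear form at V
  + c W, with \<open>a\<close>, \<open>z\<close>, \<open>w\<close>, \<open>d\<close> its values at
  (V,V), (V,W), (W,V), (W,W).\<close>

lemma pos_sesquilinear_Cauchy_Schwarz:
  fixes a d z w :: complex
  assumes pos: "\<And>c. a + c * z + cnj c * w + c * cnj c * d \<in> \<real>\<^sub>\<ge>\<^sub>0" and d: "d \<in> \<real>\<^sub>\<ge>\<^sub>0"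
  shows "(cmod z)\<^sup>2 \<le> Re a * Re d"
proof -
  have re: "0 \<le> Re (a + c * z + cnj c * w + c * cnj c * d)"
    and im: "Im (a + c * z + cnj c * w + c * cnj c * d) = 0" for c
    using pos [of c] by (simp_all only: complex_nonneg_Reals_iff)
  have d': "0 \<le> Re d" "Im d = 0"
    using d by (simp_all only: complex_nonneg_Reals_iff)
  \<comment> \<open>Hermitian symmetry is extracted from reality of the form at c = 0, 1,
    \<i>.\<close>
  have w: "w = cnj z"
    using im [of 0] im [of 1] im [of \<i>] d' by (simp add: complex_eq_iff)
  \<comment> \<open>The phase of c is chosen against that of \<open>z\<close>, which leaves a real
    quadratic in \<open>r\<close>. If \<open>Re d\<close> is nonzero, \<open>r = 1 / Re d\<close> is
    optimal; if it is 0 and \<open>z\<close> is not, the value of \<open>r\<close> used below makes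
    the right side -1.\<close>
  have quad: "0 \<le> Re a - 2 * r * (cmod z)\<^sup>2 + r\<^sup>2 * (cmod z)\<^sup>2 * Re d" for r
    unfolding cmod_power2 using re [of "- (of_real r * cnj z)"] d'
    by (simp add: w power2_eq_square algebra_simps)
  show ?thesis
  proof (cases "Re d = 0")
    case True
    have "cmod z = 0"
    proof (rule ccontr)
      assume "cmod z \<noteq> 0"
      then show False
        using quad [of "(Re a + 1) / (2 * (cmod z)\<^sup>2)"] True by simp
    qed
    then show ?thesis
      using True by simp
  next
    case False
    then show ?thesis
      using quad [of "1 / Re d"] d' by (simp add: field_simps power2_eq_square)
  qed
qed

text \<open>The conclusion is \<open>(\<theta> \<otimes> \<omega>) (U\<^sup>* U) \<ge> 0\<close>: with representing families \<open>\<Xi>\<close>, \<open>H\<close> of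
  \<open>\<theta> \<otimes> \<omega>\<close> one has \<open>(\<theta> \<otimes> \<omega>) (X\<^sup>* Y) = cinner (amp X \<Xi>) (amp Y H)\<close>, which extends positivity
  from the algebraic tensor product by strong approximation, without Kaplansky density.\<close>

lemma tensor_state_pos:
  fixes \<xi> \<eta> :: "'i::countable \<Rightarrow> 'r::complex_hilbert_space"
    and \<xi>' \<eta>' :: "'j::countable \<Rightarrow> 'a::complex_hilbert_space"
    and \<gamma> :: "('a \<Rightarrow>\<^sub>L 'a) \<Rightarrow> 'h::complex_hilbert_space"
  assumes t: "hilbert_tensor t" and M: "von_neumann_algebra M" and N: "von_neumann_algebra N"
    and \<theta>: "\<theta> \<in> normal_states M" and \<gamma>: "gns_construction N \<omega> \<gamma>"
    and sq: "sq_summable \<xi>" "sq_summable \<eta>" "sq_summable \<xi>'" "sq_summable \<eta>'"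
    and rep: "\<And>S. S \<in> M \<Longrightarrow> \<theta> S = vsum \<xi> \<eta> S" "\<And>T. T \<in> N \<Longrightarrow> \<omega> T = vsum \<xi>' \<eta>' T"
    and U: "U \<in> vn_tensor t M N"
  shows "cinner (amp U (tens t \<xi> \<xi>')) (amp U (tens t \<eta> \<eta>')) \<in> \<real>\<^sub>\<ge>\<^sub>0"
proof -
  note M' = vna_csubspace [OF M] vna_bounded [OF M] and N' = vna_bounded [OF N]
  let ?\<Xi> = "tens t \<xi> \<xi>'" and ?H = "tens t \<eta> \<eta>'"
  note sqt = sq_summable_tens [OF t sq(1,3)] sq_summable_tens [OF t sq(2,4)]
  have elem: "cinner (amp X ?\<Xi>) (amp X ?H) \<in> \<real>\<^sub>\<ge>\<^sub>0" if X: "X \<in> span (elem_tensors t M N)" for X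
  proof -
    obtain I r where I: "finite I" "I \<subseteq> elem_tensors t M N" "X = (\<Sum>p\<in>I. r p *\<^sub>R p)"
      using X unfolding span_explicit mem_Collect_eq by metis
    have "\<forall>p\<in>I. \<exists>q. fst q \<in> M \<and> snd q \<in> N \<and> p = op_tensor t (fst q) (snd q)"
      using I(2) by (force simp: elem_tensors_def)
    then obtain q
      where q: "\<forall>p\<in>I. fst (q p) \<in> M \<and> snd (q p) \<in> N \<and> p = op_tensor t (fst (q p)) (snd (q p))"
      by (rule bchoice [THEN exE])
    define S where "S p = complex_of_real (r p) *\<^sub>C fst (q p)" for p
    define T where "T p = snd (q p)" for p
    have ST: "S p \<in> M" "T p \<in> N" "S p \<in> bounded_ops" "T p \<in> bounded_ops" if "p \<in> I" for p
      using q that M' N' by (auto simp: S_def T_def csubspace_def)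
    have "r p *\<^sub>R p = op_tensor t (S p) (T p)" if "p \<in> I" for p
    proof -
      have "r p *\<^sub>R p = complex_of_real (r p) *\<^sub>C op_tensor t (fst (q p)) (snd (q p))"
        using q that by (simp add: scaleC_of_real_blinfun)
      also have "\<dots> = op_tensor t (S p) (T p)"
        unfolding S_def T_def using q that M' N' by (intro op_tensor_scaleC [OF t]) auto
      finally show ?thesis .
    qed
    then have X_eq: "X = (\<Sum>p\<in>I. op_tensor t (S p) (T p))"
      using I(3) by simp
    have entry: "cinner (amp (op_tensor t (S p) (T p)) ?\<Xi>) (amp (op_tensor t (S p') (T p')) ?H) =
        \<theta> (adj (S p) o\<^sub>L S p') * cinner (\<gamma> (T p)) (\<gamma> (T p'))" if p: "p \<in> I" "p' \<in> I" for p p'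
    proof -
      note b = ST [OF p(1)] ST [OF p(2)]
      have "cinner (amp (op_tensor t (S p) (T p)) ?\<Xi>) (amp (op_tensor t (S p') (T p')) ?H) =
          vsum ?\<Xi> ?H (adj (op_tensor t (S p) (T p)) o\<^sub>L op_tensor t (S p') (T p'))"
        by (rule vsum_adj_eq_cinner [symmetric]) (intro sqt op_tensor_in_bounded_ops t b)+
      also have "\<dots> = vsum ?\<Xi> ?H (op_tensor t (adj (S p) o\<^sub>L S p') (adj (T p) o\<^sub>L T p'))"
        by (simp add: adj_op_tensor [OF t] op_tensor_compose [OF t] b adj_in_bounded_ops)
      also have "\<dots> = vsum \<xi> \<eta> (adj (S p) o\<^sub>L S p') * vsum \<xi>' \<eta>' (adj (T p) o\<^sub>L T p')"
        by (rule vsum_tens_op_tensor [OF t _ _ sq]) (simp_all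
          add: b adj_in_bounded_ops bounded_ops_compose)
      also have "\<dots> = \<theta> (adj (S p) o\<^sub>L S p') * \<omega> (adj (T p) o\<^sub>L T p')"
        using b
        by (simp add: rep vna_compose [OF M] vna_adj [OF M] vna_compose [OF N] vna_adj [OF N])
      also have "\<omega> (adj (T p) o\<^sub>L T p') = cinner (\<gamma> (T p)) (\<gamma> (T p'))"
        using \<gamma> b by (simp add: gns_construction_def)
      finally show ?thesis .
    qed
    have "cinner (amp X ?\<Xi>) (amp X ?H) =
        (\<Sum>p\<in>I. \<Sum>p'\<in>I. cinner (amp (op_tensor t (S p) (T p)) ?\<Xi>) (amp (op_tensor t (S p') (T p')) ?H))"
      by (simp add: X_eq amp_sum sqt cinner.sum_left cinner.sum_right) (rule sum.swap)
    also have "\<dots> = (\<Sum>p\<in>I. \<Sum>p'\<in>I. \<theta> (adj (S p) o\<^sub>L S p') * cinner (\<gamma> (T p)) (\<gamma> (T p')))"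
      by (intro sum.cong refl entry)
    \<comment> \<open>The double sum is the Schur product of the positive matrix given by \<theta>
      with the Gram matrix of the vectors \<open>\<gamma> (T p)\<close>.\<close>
    also have "\<dots> \<in> \<real>\<^sub>\<ge>\<^sub>0"
      by (rule psd_schur [OF I(1) psd_functional [OF M]])
        (use \<theta> ST in \<open>auto simp: normal_states_def\<close>)
    finally show ?thesis .
  qed
  \<comment> \<open>Only two families have to be approximated, so the second one also fills the
    third slot.\<close>
  obtain X where X: "\<And>n :: nat. X n \<in> span (elem_tensors t M N)"
    "(\<lambda>n. amp (X n) ?\<Xi>) \<longlonglongrightarrow> amp U ?\<Xi>" "(\<lambda>n. amp (X n) ?H) \<longlonglongrightarrow> amp U ?H"
    using strong_approximation [OF csubspace_span_elem_tensors [OF t M' N'] U [unfolded vn_tensor_eq] sqt sqt(2)]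
    by metis
  have "(\<lambda>n. cinner (amp (X n) ?\<Xi>) (amp (X n) ?H)) \<longlonglongrightarrow> cinner (amp U ?\<Xi>) (amp U ?H)"
    by (intro cinner.tendsto X)
  then show ?thesis
    by (rule closed_sequentially [OF closed_nonneg_Reals_complex elem [OF X(1)]])
qed

section \<open>The operators on the GNS space\<close>

context
  fixes t :: "'r::complex_hilbert_space \<Rightarrow> 'a::complex_hilbert_space \<Rightarrow> 'ra::complex_hilbert_space"
    and R :: "('r \<Rightarrow>\<^sub>L 'r) set" and A :: "('a \<Rightarrow>\<^sub>L 'a) set"
    and \<omega> :: "('a \<Rightarrow>\<^sub>L 'a) \<Rightarrow> complex" and \<gamma> :: "('a \<Rightarrow>\<^sub>L 'a) \<Rightarrow> 'h::complex_hilbert_space"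
  assumes t: "hilbert_tensor t" and R: "von_neumann_algebra R" and A: "von_neumann_algebra A"
    and \<omega>: "\<omega> \<in> normal_states A" and \<gamma>: "gns_construction A \<omega> \<gamma>"
begin

lemmas R_sub = vna_csubspace [OF R] vna_bounded [OF R]
lemmas A_sub = vna_csubspace [OF A] vna_bounded [OF A]

lemma gns_add: "a \<in> A \<Longrightarrow> b \<in> A \<Longrightarrow> \<gamma> (a + b) = \<gamma> a + \<gamma> b"
  and gns_scaleC: "a \<in> A \<Longrightarrow> \<gamma> (c *\<^sub>C a) = c *\<^sub>C \<gamma> a"
  and gns_dense: "closure (\<gamma> ` A) = UNIV"
  and cinner_gns: "a \<in> A \<Longrightarrow> b \<in> A \<Longrightarrow> cinner (\<gamma> a) (\<gamma> b) = \<omega> (adj a o\<^sub>L b)"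
  using \<gamma> by (auto simp: gns_construction_def clinear_on_def)

lemma gns_eqI: "(\<And>d. d \<in> A \<Longrightarrow> cinner (\<gamma> d) h = cinner (\<gamma> d) k) \<Longrightarrow> h = k"
  by (rule cinner_dense_eqI [OF gns_dense]) blast

lemma right_op_in_bounded_ops: "d \<in> A \<Longrightarrow> op_tensor t id_blinfun d \<in> bounded_ops"
  using A_sub by (intro op_tensor_in_bounded_ops t bounded_ops_id) auto

lemma adj_right_op: "d \<in> A \<Longrightarrow> adj (op_tensor t id_blinfun d) = op_tensor t id_blinfun (adj d)"
  using A_sub by (subst adj_op_tensor [OF t bounded_ops_id]) (auto simp: adj_id)

lemma adj_right_op_compose:
  "d \<in> A \<Longrightarrow> U \<in> vn_tensor t R A \<Longrightarrow> adj (op_tensor t id_blinfun d) o\<^sub>L U \<in> vn_tensor t R A"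
  by (simp add: adj_right_op op_tensor_compose_vn_tensor t R A vna_id vna_adj)

lemma normal_states_rep:
  assumes "f \<in> normal_states M" "csubspace M" "M \<subseteq> bounded_ops"
  obtains \<xi> \<eta> :: "nat \<Rightarrow> 'z::complex_hilbert_space"
  where "sq_summable \<xi>" "sq_summable \<eta>" "\<And>S. S \<in> M \<Longrightarrow> f S = vsum \<xi> \<eta> S"
  using normal_functional_vsums [OF assms(2,3), of f] assms(1) unfolding vsums_def normal_states_def
  by blast

text \<open>The form \<open>b\<close> extends the sesquilinear form of \<theta> \<otimes> \<omega>
  and is positive on the tensor product. Since \<theta> is 1 at the identity, \<open>b\<close> at 1
  \<otimes> d is the squared norm of \<open>\<gamma> d\<close>, so Cauchy-Schwarz makes the defining
  functional bounded and Riesz yields the slice. The norm estimate is what later gives contractivity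
  and continuity along strongly convergent sequences.\<close>

lemma
  fixes \<xi> \<eta> :: "'i::countable \<Rightarrow> 'r" and \<xi>' \<eta>' :: "'j::countable \<Rightarrow> 'a"
  assumes \<theta>: "\<theta> \<in> normal_states R"
    and \<xi>: "sq_summable \<xi>" "sq_summable \<eta>" "\<And>S. S \<in> R \<Longrightarrow> \<theta> S = vsum \<xi> \<eta> S"
    and \<xi>': "sq_summable \<xi>'" "sq_summable \<eta>'" "\<And>T. T \<in> A \<Longrightarrow> \<omega> T = vsum \<xi>' \<eta>' T"
    and U: "U \<in> vn_tensor t R A"
  shows cinner_gns_slice: "d \<in> A \<Longrightarrow> cinner (\<gamma> d) (gns_slice t R A \<omega> \<gamma> \<theta> U) =
      functional_tensor t R A \<theta> \<omega> (adj (op_tensor t id_blinfun d) o\<^sub>L U)"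
    and norm_gns_slice_le: "(norm (gns_slice t R A \<omega> \<gamma> \<theta> U))\<^sup>2 \<le>
      Re (cinner (amp U (tens t \<xi> \<xi>')) (amp U (tens t \<eta> \<eta>')))"
proof -
  let ?\<Xi> = "tens t \<xi> \<xi>'" and ?H = "tens t \<eta> \<eta>'"
  let ?D = "\<lambda>d. op_tensor t id_blinfun d"
  note sqt = sq_summable_tens [OF t \<xi>(1) \<xi>'(1)] sq_summable_tens [OF t \<xi>(2) \<xi>'(2)]
  define b where "b V W = cinner (amp V ?\<Xi>) (amp W ?H)" for V W
  have sub: "csubspace (vn_tensor t R A)"
    by (rule csubspace_vn_tensor [OF t R_sub A_sub(2)])
  have pos: "b V V \<in> \<real>\<^sub>\<ge>\<^sub>0" if "V \<in> vn_tensor t R A" for V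
    unfolding b_def by (rule tensor_state_pos [OF t R A \<theta> \<gamma> \<xi>(1,2) \<xi>'(1,2) \<xi>(3) \<xi>'(3) that])
  have CS: "(cmod (b V W))\<^sup>2 \<le> Re (b V V) * Re (b W W)"
    if "V \<in> vn_tensor t R A" "W \<in> vn_tensor t R A" for V W
  proof (rule pos_sesquilinear_Cauchy_Schwarz [of _ _ "b W V"])
    fix c
    have "b (V + c *\<^sub>C W) (V + c *\<^sub>C W) \<in> \<real>\<^sub>\<ge>\<^sub>0"
      using that sub by (intro pos) (auto simp: csubspace_def)
    also have "b (V + c *\<^sub>C W) (V + c *\<^sub>C W) = b V V + c * b V W + cnj c * b W V + c * cnj c * b W W"
      by (simp add: b_def amp_add amp_scaleC sqt cinner_add_left cinner_add_right cinner_scaleC_left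
          cinner_scaleC_right algebra_simps)
    finally show "b V V + c * b V W + cnj c * b W V + c * cnj c * b W W \<in> \<real>\<^sub>\<ge>\<^sub>0" .
  qed (rule pos [OF that(2)])
  have FT: "functional_tensor t R A \<theta> \<omega> (adj (?D d) o\<^sub>L V) = b (?D d) V"
    if "d \<in> A" "V \<in> vn_tensor t R A" for d V
    unfolding b_def vsum_adj_eq_cinner [OF sqt right_op_in_bounded_ops [OF that(1)], symmetric]
    by (rule functional_tensor_eq [OF t R_sub A_sub(2) \<xi>(1,2) \<xi>'(1,2) \<xi>(3) \<xi>'(3) adj_right_op_compose [OF that]])
  have D: "?D d \<in> vn_tensor t R A" if "d \<in> A" for d
    by (rule op_tensor_in_vn_tensor [OF t R_sub A_sub(2) vna_id [OF R] that])
  have bD: "b (?D d) (?D d) = of_real ((norm (\<gamma> d))\<^sup>2)" if d: "d \<in> A" for d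
  proof -
    have d': "d \<in> bounded_ops"
      using d A_sub by blast
    have "b (?D d) (?D d) = vsum ?\<Xi> ?H (adj (?D d) o\<^sub>L ?D d)"
      unfolding b_def
      by (rule vsum_adj_eq_cinner [OF sqt right_op_in_bounded_ops [OF d], symmetric])
    also have "\<dots> = vsum ?\<Xi> ?H (op_tensor t id_blinfun (adj d o\<^sub>L d))"
      by (simp add: adj_right_op d op_tensor_compose [OF t] bounded_ops_id d' adj_in_bounded_ops)
    also have "\<dots> = \<theta> id_blinfun * \<omega> (adj d o\<^sub>L d)"
      using d
      by (simp
        add: vsum_tens_op_tensor [OF t bounded_ops_id _ \<xi>(1,2) \<xi>'(1,2)] bounded_ops_compose d'
          adj_in_bounded_ops \<xi>(3) vna_id R \<xi>'(3) vna_compose [OF A] vna_adj [OF A])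
    also have "\<dots> = cinner (\<gamma> d) (\<gamma> d)"
      using \<theta> by (simp add: normal_states_def cinner_gns d)
    finally show ?thesis
      by (simp add: cinner_self)
  qed
  have bound: "cmod (b (?D d) U) \<le> sqrt (Re (b U U)) * norm (\<gamma> d)" if d: "d \<in> A" for d
  proof (rule power2_le_imp_le)
    have "0 \<le> Re (b U U)"
      using pos [OF U] by (simp only: complex_nonneg_Reals_iff)
    then show "(cmod (b (?D d) U))\<^sup>2 \<le> (sqrt (Re (b U U)) * norm (\<gamma> d))\<^sup>2"
      using CS [OF D [OF d] U] by (simp add: bD [OF d] power_mult_distrib mult.commute)
    show "0 \<le> sqrt (Re (b U U)) * norm (\<gamma> d)"
      using \<open>0 \<le> Re (b U U)\<close> by simp
  qed
  have D_add: "amp (?D (d + d')) ?\<Xi> = amp (?D d) ?\<Xi> + amp (?D d') ?\<Xi>" if "d \<in> A" "d' \<in> A" for d d'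
  proof -
    have "?D (d + d') = ?D d + ?D d'"
    proof (rule op_tensor_eqI [OF t])
      show "?D d + ?D d' \<in> bounded_ops"
        using csubspace_bounded_ops right_op_in_bounded_ops that unfolding csubspace_def by blast
      show "blinfun_apply (?D d + ?D d') (t x y) = t (blinfun_apply id_blinfun x) (blinfun_apply (d + d') y)" for x y
        using that A_sub
        by (simp add: blinfun.add_left op_tensor_apply [OF t bounded_ops_id]
          tensor_add_right [OF t] subsetD)
    qed
    then show ?thesis
      by (simp add: amp_add sqt)
  qed
  have D_scale: "amp (?D (c *\<^sub>C d)) ?\<Xi> = c *\<^sub>C amp (?D d) ?\<Xi>" if "d \<in> A" for c d
  proof -
    have "?D (c *\<^sub>C d) = c *\<^sub>C ?D d"
    proof (rule op_tensor_eqI [OF t])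
      show "c *\<^sub>C ?D d \<in> bounded_ops"
        using csubspace_bounded_ops right_op_in_bounded_ops that unfolding csubspace_def by blast
      show "blinfun_apply (c *\<^sub>C ?D d) (t x y) = t (blinfun_apply id_blinfun x) (blinfun_apply (c *\<^sub>C d) y)" for x y
        using that A_sub
        by (simp add: scaleC_blinfun.rep_eq op_tensor_apply [OF t bounded_ops_id]
          tensor_scaleC_right [OF t] subsetD)
    qed
    then show ?thesis
      by (simp add: amp_scaleC sqt)
  qed
  \<comment> \<open>\<open>b (?D d) U\<close> is conjugate-linear in \<open>d\<close>, hence the
    conjugate. The prescription is a relation because \<open>\<gamma>\<close> may have a
    kernel.\<close>
  obtain L where L: "clinear_on UNIV (blinfun_apply L)"
    "\<And>d. d \<in> A \<Longrightarrow> blinfun_apply L (\<gamma> d) = cnj (b (?D d) U)"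
    "\<And>x. norm (blinfun_apply L x) \<le> sqrt (Re (b U U)) * norm x"
  proof (rule extend_bounded_relation [of "{(\<gamma> d, cnj (b (?D d) U)) | d. d \<in> A}" "sqrt (Re (b U U))"])
    have A_add: "d + d' \<in> A" and A_scale: "c *\<^sub>C d \<in> A" if "d \<in> A" "d' \<in> A" for c d d'
      using A_sub(1) that by (auto simp: csubspace_def)
    show "(x + x', y + y') \<in> {(\<gamma> d, cnj (b (?D d) U)) | d. d \<in> A}"
      if xy: "(x, y) \<in> {(\<gamma> d, cnj (b (?D d) U)) | d. d \<in> A}" "(x', y') \<in> {(\<gamma> d, cnj (b (?D d) U)) | d. d \<in> A}" for x y x' y'
    proof -
      obtain d d'
        where "d \<in> A" "d' \<in> A" "x = \<gamma> d" "x' = \<gamma> d'" "y = cnj (b (?D d) U)" "y' = cnj (b (?D d') U)"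
        using xy by blast
      then show ?thesis
        by (intro CollectI exI [of _ "d + d'"]) (simp add: A_add gns_add b_def D_add
          cinner_add_left)
    qed
    show "(c *\<^sub>C x, c *\<^sub>C y) \<in> {(\<gamma> d, cnj (b (?D d) U)) | d. d \<in> A}"
      if xy: "(x, y) \<in> {(\<gamma> d, cnj (b (?D d) U)) | d. d \<in> A}" for c x y
    proof -
      obtain d where "d \<in> A" "x = \<gamma> d" "y = cnj (b (?D d) U)"
        using xy by blast
      then show ?thesis
        by (intro CollectI exI [of _ "c *\<^sub>C d"])
          (simp add: A_scale gns_scaleC b_def D_scale cinner_scaleC_left scaleC_complex_def)
    qed
    show "norm y \<le> sqrt (Re (b U U)) * norm x" if "(x, y) \<in> {(\<gamma> d, cnj (b (?D d) U)) | d. d \<in> A}"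
      for x y
      using that bound by auto
    have "fst ` {(\<gamma> d, cnj (b (?D d) U)) | d. d \<in> A} = \<gamma> ` A"
      by force
    then show "closure (fst ` {(\<gamma> d, cnj (b (?D d) U)) | d. d \<in> A}) = UNIV"
      by (simp add: gns_dense)
  qed (use that in blast)
  obtain h where h: "\<And>x. blinfun_apply L x = cinner h x"
    using riesz_complex [OF L(1,3)] by blast
  have hd: "cinner (\<gamma> d) h = functional_tensor t R A \<theta> \<omega> (adj (?D d) o\<^sub>L U)" if d: "d \<in> A" for d
    using L(2) [OF d] h [of "\<gamma> d"] cinner_commute [of "\<gamma> d" h] by (simp add: FT [OF d U])
  have h_eq: "gns_slice t R A \<omega> \<gamma> \<theta> U = h"
    unfolding gns_slice_def
  proof (rule the_equality)
    show "k = h" if "\<forall>d\<in>A. cinner (\<gamma> d) k = functional_tensor t R A \<theta> \<omega> (adj (?D d) o\<^sub>L U)" for k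
      by (rule gns_eqI) (simp add: that hd)
  qed (simp add: hd)
  show "cinner (\<gamma> d) (gns_slice t R A \<omega> \<gamma> \<theta> U) = functional_tensor t R A \<theta> \<omega> (adj (?D d) o\<^sub>L U)"
    if "d \<in> A" for d
    using hd [OF that] by (simp add: h_eq)
  \<comment> \<open>The bound on \<open>L\<close> is evaluated at its own Riesz vector
    \<open>h\<close>.\<close>
  have "norm h * norm h \<le> sqrt (Re (b U U)) * norm h"
    using L(3) [of h] by (simp add: h cinner_self power2_eq_square norm_mult)
  then have "norm h \<le> sqrt (Re (b U U))"
    by (cases "norm h = 0") (use pos [OF U] in \<open>simp_all add: complex_nonneg_Reals_iff\<close>)
  then have "(norm h)\<^sup>2 \<le> (sqrt (Re (b U U)))\<^sup>2"
    by (intro power_mono) auto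
  then show "(norm (gns_slice t R A \<omega> \<gamma> \<theta> U))\<^sup>2 \<le> Re (cinner (amp U ?\<Xi>) (amp U ?H))"
    using pos [OF U] by (simp add: h_eq b_def complex_nonneg_Reals_iff)
qed


lemma normal_statesD: "f \<in> normal_states M \<Longrightarrow> normal_functional M f" "f \<in> normal_states M \<Longrightarrow> f id_blinfun = 1"
  by (simp_all add: normal_states_def)

lemma gns_slice_inner:
  assumes \<theta>: "\<theta> \<in> normal_states R" and U: "U \<in> vn_tensor t R A" and d: "d \<in> A"
  shows "cinner (\<gamma> d) (gns_slice t R A \<omega> \<gamma> \<theta> U) =
    functional_tensor t R A \<theta> \<omega> (adj (op_tensor t id_blinfun d) o\<^sub>L U)"
proof -
  obtain \<xi> \<eta> :: "nat \<Rightarrow> 'r" where \<xi>: "sq_summable \<xi>" "sq_summable \<eta>" "\<And>S. S \<in> R \<Longrightarrow> \<theta> S = vsum \<xi> \<eta> S"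
    using normal_states_rep [OF \<theta> R_sub] by blast
  obtain \<xi>' \<eta>' :: "nat \<Rightarrow> 'a"
    where \<xi>': "sq_summable \<xi>'" "sq_summable \<eta>'" "\<And>S. S \<in> A \<Longrightarrow> \<omega> S = vsum \<xi>' \<eta>' S"
    using normal_states_rep [OF \<omega> A_sub] by blast
  show ?thesis
    by (rule cinner_gns_slice [OF \<theta> \<xi> \<xi>' U d])
qed

lemma
  assumes \<theta>: "\<theta> \<in> normal_states R"
  shows gns_slice_add: "U \<in> vn_tensor t R A \<Longrightarrow> V \<in> vn_tensor t R A \<Longrightarrow>
      gns_slice t R A \<omega> \<gamma> \<theta> (U + V) = gns_slice t R A \<omega> \<gamma> \<theta> U + gns_slice t R A \<omega> \<gamma> \<theta> V"
    and gns_slice_scaleC: "U \<in> vn_tensor t R A \<Longrightarrow>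
      gns_slice t R A \<omega> \<gamma> \<theta> (c *\<^sub>C U) = c *\<^sub>C gns_slice t R A \<omega> \<gamma> \<theta> U"
    and gns_slice_op_tensor: "r \<in> R \<Longrightarrow> a \<in> A \<Longrightarrow>
      gns_slice t R A \<omega> \<gamma> \<theta> (op_tensor t r a) = \<theta> r *\<^sub>C \<gamma> a"
proof -
  let ?D = "\<lambda>d. op_tensor t id_blinfun d"
  have sub: "csubspace (vn_tensor t R A)"
    by (rule csubspace_vn_tensor [OF t R_sub A_sub(2)])
  obtain h where h: "h \<in> vsums" "\<And>U. U \<in> vn_tensor t R A \<Longrightarrow> functional_tensor t R A \<theta> \<omega> U = h U"
    "\<And>S T. S \<in> R \<Longrightarrow> T \<in> A \<Longrightarrow> h (op_tensor t S T) = \<theta> S * \<omega> T"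
    using functional_tensor_normal [OF t R_sub A_sub normal_statesD(1) [OF \<theta>] normal_statesD(1) [OF \<omega>]] by blast
  have lin: "h (U + V) = h U + h V" "h (c *\<^sub>C U) = c * h U" for U V c
    using vsums_clinear [OF h(1), of UNIV] by (simp_all add: clinear_on_def scaleC_complex_def)
  have inner: "cinner (\<gamma> d) (gns_slice t R A \<omega> \<gamma> \<theta> U) = h (adj (?D d) o\<^sub>L U)"
    if "d \<in> A" "U \<in> vn_tensor t R A" for d U
    using gns_slice_inner [OF \<theta> that(2,1)] h(2) [OF adj_right_op_compose [OF that]] by simp
  show "gns_slice t R A \<omega> \<gamma> \<theta> (U + V) = gns_slice t R A \<omega> \<gamma> \<theta> U + gns_slice t R A \<omega> \<gamma> \<theta> V"
    if "U \<in> vn_tensor t R A" "V \<in> vn_tensor t R A"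
  proof (rule gns_eqI)
    have "U + V \<in> vn_tensor t R A"
      using sub that by (simp add: csubspace_def)
    then show "cinner (\<gamma> d) (gns_slice t R A \<omega> \<gamma> \<theta> (U + V)) =
        cinner (\<gamma> d) (gns_slice t R A \<omega> \<gamma> \<theta> U + gns_slice t R A \<omega> \<gamma> \<theta> V)" if "d \<in> A" for d
      using that \<open>U \<in> _\<close> \<open>V \<in> _\<close>
      by (simp add: inner
        cinner_add_right lin bounded_bilinear.add_right [OF bounded_bilinear_blinfun_compose])
  qed
  show "gns_slice t R A \<omega> \<gamma> \<theta> (c *\<^sub>C U) = c *\<^sub>C gns_slice t R A \<omega> \<gamma> \<theta> U" if U: "U \<in> vn_tensor t R A"
  proof (rule gns_eqI)
    fix d
    assume d: "d \<in> A"
    have "c *\<^sub>C U \<in> vn_tensor t R A"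
      using sub U by (simp add: csubspace_def)
    moreover have "adj (?D d) o\<^sub>L (c *\<^sub>C U) = c *\<^sub>C (adj (?D d) o\<^sub>L U)"
      using adj_in_bounded_ops [OF right_op_in_bounded_ops [OF d]]
      by (intro blinfun_eqI) (simp add: scaleC_blinfun.rep_eq bounded_ops_scaleC)
    ultimately show "cinner (\<gamma> d) (gns_slice t R A \<omega> \<gamma> \<theta> (c *\<^sub>C U)) =
        cinner (\<gamma> d) (c *\<^sub>C gns_slice t R A \<omega> \<gamma> \<theta> U)"
      by (simp add: inner d U cinner_scaleC_right lin)
  qed
  show "gns_slice t R A \<omega> \<gamma> \<theta> (op_tensor t r a) = \<theta> r *\<^sub>C \<gamma> a" if r: "r \<in> R" "a \<in> A"
  proof (rule gns_eqI)
    fix d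
    assume d: "d \<in> A"
    have b: "r \<in> bounded_ops" "a \<in> bounded_ops" "adj d \<in> bounded_ops" "adj d \<in> A"
      using r d R_sub A_sub vna_adj [OF A] by auto
    have "adj (?D d) o\<^sub>L op_tensor t r a = op_tensor t r (adj d o\<^sub>L a)"
      by (simp add: adj_right_op d op_tensor_compose [OF t] bounded_ops_id b)
    then show "cinner (\<gamma> d) (gns_slice t R A \<omega> \<gamma> \<theta> (op_tensor t r a)) = cinner (\<gamma> d) (\<theta> r *\<^sub>C \<gamma> a)"
      using r d b
      by (simp add: inner op_tensor_in_vn_tensor [OF t R_sub A_sub(2)] h(3) vna_compose [OF A]
          cinner_scaleC_right cinner_gns)
  qed
qed

text \<open>Contractivity is invariance of \<omega> combined with the slice estimate: the squared
  norm of the slice of \<open>\<alpha> a\<close> is at most the value of \<theta> \<otimes> \<omega>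
  at \<open>\<alpha> (adj a o\<^sub>L a)\<close>, which equals
  \<open>\<omega> (adj a o\<^sub>L a)\<close>. The bound also makes the prescription on the vectors
  \<open>\<gamma> a\<close> extend to all of H.\<close>

lemma
  assumes \<alpha>: "normal_star_hom A (vn_tensor t R A) \<alpha>" and \<theta>: "\<theta> \<in> normal_states R"
    and inv: "\<And>a. a \<in> A \<Longrightarrow> functional_tensor t R A \<theta> \<omega> (\<alpha> a) = \<omega> a"
  shows gns_slice_op_in_bounded_ops: "gns_slice_op t R A \<omega> \<gamma> \<alpha> \<theta> \<in> bounded_ops"
    and gns_slice_op_apply: "a \<in> A \<Longrightarrow>
      blinfun_apply (gns_slice_op t R A \<omega> \<gamma> \<alpha> \<theta>) (\<gamma> a) = gns_slice t R A \<omega> \<gamma> \<theta> (\<alpha> a)"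
    and norm_gns_slice_op_le: "norm (blinfun_apply (gns_slice_op t R A \<omega> \<gamma> \<alpha> \<theta>) x) \<le> norm x"
proof -
  have \<alpha>': "\<alpha> a \<in> vn_tensor t R A" "\<alpha> (a + b) = \<alpha> a + \<alpha> b" "\<alpha> (c *\<^sub>C a) = c *\<^sub>C \<alpha> a"
    "\<alpha> (a o\<^sub>L b) = \<alpha> a o\<^sub>L \<alpha> b" "\<alpha> (adj a) = adj (\<alpha> a)" if "a \<in> A" "b \<in> A" for a b c
    using \<alpha> that by (auto simp: normal_star_hom_def clinear_on_def)
  obtain \<xi> \<eta> :: "nat \<Rightarrow> 'r" where \<xi>: "sq_summable \<xi>" "sq_summable \<eta>" "\<And>S. S \<in> R \<Longrightarrow> \<theta> S = vsum \<xi> \<eta> S"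
    using normal_states_rep [OF \<theta> R_sub] by blast
  obtain \<xi>' \<eta>' :: "nat \<Rightarrow> 'a"
    where \<xi>': "sq_summable \<xi>'" "sq_summable \<eta>'" "\<And>S. S \<in> A \<Longrightarrow> \<omega> S = vsum \<xi>' \<eta>' S"
    using normal_states_rep [OF \<omega> A_sub] by blast
  note sqt = sq_summable_tens [OF t \<xi>(1) \<xi>'(1)] sq_summable_tens [OF t \<xi>(2) \<xi>'(2)]
  have bound: "norm (gns_slice t R A \<omega> \<gamma> \<theta> (\<alpha> a)) \<le> 1 * norm (\<gamma> a)" if a: "a \<in> A" for a
  proof -
    have aa: "adj a o\<^sub>L a \<in> A" "adj a \<in> A"
      using a by (simp_all add: vna_compose [OF A] vna_adj [OF A])
    have b: "\<alpha> a \<in> bounded_ops"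
      using \<alpha>'(1) [OF a a] vn_tensor_bounded [OF t R_sub A_sub(2)] by blast
    have "cinner (amp (\<alpha> a) (tens t \<xi> \<xi>')) (amp (\<alpha> a) (tens t \<eta> \<eta>')) =
        vsum (tens t \<xi> \<xi>') (tens t \<eta> \<eta>') (\<alpha> (adj a o\<^sub>L a))"
      using \<alpha>'(4) [OF aa(2) a] \<alpha>'(5) [OF a a] by (simp add: vsum_adj_eq_cinner [OF sqt b])
    also have "\<dots> = functional_tensor t R A \<theta> \<omega> (\<alpha> (adj a o\<^sub>L a))"
      by (rule functional_tensor_eq [OF t R_sub A_sub(2) \<xi>(1,2) \<xi>'(1,2) \<xi>(3) \<xi>'(3) \<alpha>'(1) [OF aa(1) a], symmetric])
    also have "\<dots> = cinner (\<gamma> a) (\<gamma> a)"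
      using aa a by (simp add: inv cinner_gns)
    finally have "(norm (gns_slice t R A \<omega> \<gamma> \<theta> (\<alpha> a)))\<^sup>2 \<le> (norm (\<gamma> a))\<^sup>2"
      using norm_gns_slice_le [OF \<theta> \<xi> \<xi>' \<alpha>'(1) [OF a a]] by (simp add: cinner_self)
    then show ?thesis
      unfolding mult_1 by (rule power2_le_imp_le) simp
  qed
  define G where "G = {(\<gamma> a, gns_slice t R A \<omega> \<gamma> \<theta> (\<alpha> a)) | a. a \<in> A}"
  have A_add: "a + b \<in> A" and A_scale: "c *\<^sub>C a \<in> A" if "a \<in> A" "b \<in> A" for a b c
    using A_sub(1) that by (auto simp: csubspace_def)
  obtain S where S: "clinear_on UNIV (blinfun_apply S)" "\<And>x y. (x, y) \<in> G \<Longrightarrow> blinfun_apply S x = y"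
    "\<And>x. norm (blinfun_apply S x) \<le> 1 * norm x"
  proof (rule extend_bounded_relation [of G 1])
    show "(x + x', y + y') \<in> G" if xy: "(x, y) \<in> G" "(x', y') \<in> G" for x x' y y'
    proof -
      obtain a b where "a \<in> A" "b \<in> A" "x = \<gamma> a" "x' = \<gamma> b"
        "y = gns_slice t R A \<omega> \<gamma> \<theta> (\<alpha> a)" "y' = gns_slice t R A \<omega> \<gamma> \<theta> (\<alpha> b)"
        using xy by (auto simp: G_def)
      then show ?thesis
        unfolding G_def by (intro CollectI exI [of _ "a + b"])
          (simp add: A_add gns_add \<alpha>' [of a b] gns_slice_add [OF \<theta>] \<alpha>'(1) [of a a] \<alpha>'(1) [of b b])
    qed
    show "(c *\<^sub>C x, c *\<^sub>C y) \<in> G" if xy: "(x, y) \<in> G" for c x y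
    proof -
      obtain a where "a \<in> A" "x = \<gamma> a" "y = gns_slice t R A \<omega> \<gamma> \<theta> (\<alpha> a)"
        using xy by (auto simp: G_def)
      then show ?thesis
        unfolding G_def by (intro CollectI exI [of _ "c *\<^sub>C a"])
          (simp add: A_scale gns_scaleC \<alpha>' [of a a] gns_slice_scaleC [OF \<theta>])
    qed
    show "norm y \<le> 1 * norm x" if "(x, y) \<in> G" for x y
      using that bound by (auto simp: G_def)
    have "fst ` G = \<gamma> ` A"
      by (force simp: G_def)
    then show "closure (fst ` G) = UNIV"
      by (simp add: gns_dense)
  qed (use that in blast)
  have S\<gamma>: "blinfun_apply S (\<gamma> a) = gns_slice t R A \<omega> \<gamma> \<theta> (\<alpha> a)" if "a \<in> A" for a
    using S(2) that by (auto simp: G_def)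
  have "gns_slice_op t R A \<omega> \<gamma> \<alpha> \<theta> = S"
    unfolding gns_slice_op_def
  proof (rule the_equality)
    show "S \<in> bounded_ops \<and> (\<forall>a\<in>A. blinfun_apply S (\<gamma> a) = gns_slice t R A \<omega> \<gamma> \<theta> (\<alpha> a))"
      using S(1) S\<gamma> by (simp add: bounded_ops_def)
    fix S'
    assume S': "S' \<in> bounded_ops \<and> (\<forall>a\<in>A. blinfun_apply S' (\<gamma> a) = gns_slice t R A \<omega> \<gamma> \<theta> (\<alpha> a))"
    have "closure (\<gamma> ` A) \<subseteq> {x. blinfun_apply S' x = blinfun_apply S x}"
      by (intro closure_minimal closed_Collect_eq continuous_intros) (auto simp: S' S\<gamma>)
    then show "S' = S"
      by (intro blinfun_eqI) (auto simp: gns_dense)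
  qed
  then show "gns_slice_op t R A \<omega> \<gamma> \<alpha> \<theta> \<in> bounded_ops"
    "a \<in> A \<Longrightarrow> blinfun_apply (gns_slice_op t R A \<omega> \<gamma> \<alpha> \<theta>) (\<gamma> a) = gns_slice t R A \<omega> \<gamma> \<theta> (\<alpha> a)"
    "norm (blinfun_apply (gns_slice_op t R A \<omega> \<gamma> \<alpha> \<theta>) x) \<le> norm x" for a x
    using S(1,3) S\<gamma> by (simp_all add: bounded_ops_def)
qed

text \<open>Norm continuity of \<open>gns_slice\<close> along strongly convergent sequences reduces this to
  elementary tensors, where both sides can be computed.\<close>

lemma cinner_gns_slice_eqI:
  assumes \<theta>: "\<theta> \<in> normal_states R" and g: "normal_functional (vn_tensor t R A) g"
    and eq: "\<And>r a. r \<in> R \<Longrightarrow> a \<in> A \<Longrightarrow> cinner k (\<theta> r *\<^sub>C \<gamma> a) = g (op_tensor t r a)"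
    and U: "U \<in> vn_tensor t R A"
  shows "cinner k (gns_slice t R A \<omega> \<gamma> \<theta> U) = g U"
proof -
  let ?M = "vn_tensor t R A" and ?s = "gns_slice t R A \<omega> \<gamma> \<theta>"
  have M: "csubspace ?M" "?M \<subseteq> bounded_ops"
    by (rule csubspace_vn_tensor [OF t R_sub A_sub(2)] vn_tensor_bounded [OF t R_sub A_sub(2)])+
  obtain \<zeta> \<kappa> :: "nat \<Rightarrow> 'ra" where \<zeta>: "sq_summable \<zeta>" "sq_summable \<kappa>" "\<And>T. T \<in> ?M \<Longrightarrow> g T = vsum \<zeta> \<kappa> T"
    using normal_functional_vsums [OF M g] unfolding vsums_def by blast
  obtain \<xi> \<eta> :: "nat \<Rightarrow> 'r" where \<xi>: "sq_summable \<xi>" "sq_summable \<eta>" "\<And>S. S \<in> R \<Longrightarrow> \<theta> S = vsum \<xi> \<eta> S"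
    using normal_states_rep [OF \<theta> R_sub] by blast
  obtain \<xi>' \<eta>' :: "nat \<Rightarrow> 'a"
    where \<xi>': "sq_summable \<xi>'" "sq_summable \<eta>'" "\<And>S. S \<in> A \<Longrightarrow> \<omega> S = vsum \<xi>' \<eta>' S"
    using normal_states_rep [OF \<omega> A_sub] by blast
  let ?\<Xi> = "tens t \<xi> \<xi>'" and ?H = "tens t \<eta> \<eta>'"
  note sqt = sq_summable_tens [OF t \<xi>(1) \<xi>'(1)] sq_summable_tens [OF t \<xi>(2) \<xi>'(2)]
  have span: "span (elem_tensors t R A) \<subseteq> ?M"
    by (rule span_elem_tensors_subset [OF t R_sub A_sub(2)])
  have "X \<in> ?M \<and> cinner k (?s X) = vsum \<zeta> \<kappa> X" if "X \<in> span (elem_tensors t R A)" for X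
    using that
  proof (induction rule: span_induct_alt)
    case base
    have "0 \<in> ?M"
      using M by (simp add: csubspace_def)
    moreover have "?s 0 = 0"
      using gns_slice_add [OF \<theta> \<open>0 \<in> ?M\<close> \<open>0 \<in> ?M\<close>] by simp
    ultimately show ?case
      by simp
  next
    case (step r X Y)
    obtain S T where X: "S \<in> R" "T \<in> A" "X = op_tensor t S T"
      using step(1) by (auto simp: elem_tensors_def)
    have XM: "X \<in> ?M" "of_real r *\<^sub>C X \<in> ?M"
      using X op_tensor_in_vn_tensor [OF t R_sub A_sub(2)] M by (auto simp: csubspace_def)
    have "cinner k (?s X) = vsum \<zeta> \<kappa> X"
      using X XM eq by (simp add: gns_slice_op_tensor [OF \<theta>] \<zeta>(3))
    moreover have "?s (of_real r *\<^sub>C X + Y) = of_real r *\<^sub>C ?s X + ?s Y"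
      using XM step(2) by (simp add: gns_slice_add [OF \<theta>] gns_slice_scaleC [OF \<theta>])
    moreover have "of_real r *\<^sub>C X + Y \<in> ?M"
      using XM step(2) M by (simp add: csubspace_def)
    ultimately show ?case
      using step
      by (simp add: vsum_add vsum_scaleC \<zeta> cinner_add_right cinner_scaleC_right
        flip: scaleC_of_real_blinfun)
  qed
  then have elem: "cinner k (?s X) = vsum \<zeta> \<kappa> X" if "X \<in> span (elem_tensors t R A)" for X
    using that by blast
  \<comment> \<open>The first two families control the slice of \<open>U - X n\<close> in norm; the
    third, \<open>\<kappa>\<close>, makes \<open>g (X n)\<close> converge to
    \<open>g U\<close>.\<close>
  obtain X where X: "\<And>n :: nat. X n \<in> span (elem_tensors t R A)" "(\<lambda>n. amp (X n) ?\<Xi>) \<longlonglongrightarrow> amp U ?\<Xi>"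
    "(\<lambda>n. amp (X n) ?H) \<longlonglongrightarrow> amp U ?H" "(\<lambda>n. amp (X n) \<kappa>) \<longlonglongrightarrow> amp U \<kappa>"
    using strong_approximation [OF csubspace_span_elem_tensors [OF t R_sub A_sub(2)] U [unfolded vn_tensor_eq] sqt \<zeta>(2)]
    by metis
  have XM: "X n \<in> ?M" for n
    using X(1) span by blast
  have diff: "U - X n \<in> ?M" "?s (U - X n) = ?s U - ?s (X n)" for n
  proof -
    define Z where "Z = complex_of_real (- 1) *\<^sub>C X n"
    have Z: "Z \<in> ?M" "?s Z = - ?s (X n)"
      using M XM gns_slice_scaleC [OF \<theta> XM, of "-1" n]
      by (simp_all add: Z_def csubspace_def scaleC.minus_left)
    have eq: "U - X n = U + Z"
      unfolding Z_def scaleC_of_real_blinfun by simp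
    show "U - X n \<in> ?M" "?s (U - X n) = ?s U - ?s (X n)"
      unfolding eq using M(1) U Z by (simp_all add: csubspace_def gns_slice_add [OF \<theta>])
  qed
  have "(\<lambda>n. Re (cinner (amp (U - X n) ?\<Xi>) (amp (U - X n) ?H))) \<longlonglongrightarrow> Re (cinner (amp U ?\<Xi> - amp U ?\<Xi>) (amp U ?H - amp U ?H))"
    unfolding amp_diff [OF sqt(1)] amp_diff [OF sqt(2)]
    by (intro tendsto_Re cinner.tendsto tendsto_diff tendsto_const X)
  then have lim: "(\<lambda>n. Re (cinner (amp (U - X n) ?\<Xi>) (amp (U - X n) ?H))) \<longlonglongrightarrow> 0"
    by simp
  \<comment> \<open>The estimate is applied to the difference itself, so strong convergence of both
    families forces norm convergence of the slices.\<close>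
  have le: "(norm (?s (U - X n)))\<^sup>2 \<le> Re (cinner (amp (U - X n) ?\<Xi>) (amp (U - X n) ?H))" for n
    by (rule norm_gns_slice_le [OF \<theta> \<xi> \<xi>' diff(1)])
  have "(\<lambda>n. (norm (?s (U - X n)))\<^sup>2) \<longlonglongrightarrow> 0"
    by (rule tendsto_sandwich [OF always_eventually always_eventually tendsto_const lim]) (simp_all
      add: le)
  then have "(\<lambda>n. sqrt ((norm (?s (U - X n)))\<^sup>2)) \<longlonglongrightarrow> sqrt 0"
    by (rule tendsto_real_sqrt)
  then have "(\<lambda>n. ?s U - ?s (X n)) \<longlonglongrightarrow> 0"
    unfolding diff(2) by (simp add: tendsto_norm_zero_iff)
  then have "(\<lambda>n. ?s U - (?s U - ?s (X n))) \<longlonglongrightarrow> ?s U - 0"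
    by (intro tendsto_diff tendsto_const)
  then have "(\<lambda>n. cinner k (?s (X n))) \<longlonglongrightarrow> cinner k (?s U)"
    unfolding diff_diff_eq2 by (intro cinner.tendsto tendsto_const) simp
  moreover have "(\<lambda>n. cinner k (?s (X n))) \<longlonglongrightarrow> g U"
    unfolding elem [OF X(1)] \<zeta>(3) [OF U] vsum_eq_cinner [OF \<zeta>(1,2)]
    by (intro cinner.tendsto tendsto_const X)
  ultimately show ?thesis
    by (rule LIMSEQ_unique)
qed


section \<open>Convolution and composition of the operators\<close>

lemma normal_functional_hom:
  assumes \<Phi>: "normal_star_hom M N \<Phi>" and g: "g \<in> vsums"
  shows "normal_functional M (\<lambda>T. g (\<Phi> T))"
proof -
  have \<Phi>': "clinear_on M \<Phi>" "continuous_map (subtopology sigma_weak M) (subtopology sigma_weak N) \<Phi>"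
    using \<Phi> by (auto simp: normal_star_hom_def)
  have "continuous_map (subtopology sigma_weak M) euclidean (g \<circ> \<Phi>)"
    by (rule continuous_map_compose [OF \<Phi>'(2)])
      (intro continuous_map_from_subtopology vsums_continuous g)
  then show ?thesis
    using \<Phi>'(1) vsums_clinear [OF g, of UNIV]
    by (simp add: normal_functional_def o_def clinear_on_def)
qed

lemma normal_functional_cong:
  assumes "csubspace M" "normal_functional M g" "\<And>T. T \<in> M \<Longrightarrow> f T = g T"
  shows "normal_functional M f"
  unfolding normal_functional_def
proof
  show "clinear_on M f"
    using assms by (simp add: normal_functional_def clinear_on_def csubspace_def)
  show "continuous_map (subtopology sigma_weak M) euclidean f"
    by (rule continuous_map_eq [of _ _ g]) (use assms in \<open>auto simp: normal_functional_def\<close>)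
qed

lemma normal_functional_diff:
  assumes "normal_functional M f" "normal_functional M g"
  shows "normal_functional M (\<lambda>T. f T - g T)"
  using assms
  by (auto simp: normal_functional_def clinear_on_def scaleC_complex_def algebra_simps
    intro: continuous_map_diff)

text \<open>The two bracketings of a triple tensor product are identified only on elementary
  vectors. That is enough here, as the families consist of such vectors and the index triples can be
  rebracketed.\<close>

lemma vsum_tens_assoc:
  assumes assoc: "\<And>x y z. t1 x (t2 y z) = t3 (t4 x y) z"
  shows "vsum (tens t1 \<xi> (tens t2 \<xi>' \<xi>'')) (tens t1 \<eta> (tens t2 \<eta>' \<eta>'')) =
    vsum (tens t3 (tens t4 \<xi> \<xi>') \<xi>'') (tens t3 (tens t4 \<eta> \<eta>') \<eta>'')"
proof
  show "vsum (tens t1 \<xi> (tens t2 \<xi>' \<xi>'')) (tens t1 \<eta> (tens t2 \<eta>' \<eta>'')) T =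
      vsum (tens t3 (tens t4 \<xi> \<xi>') \<xi>'') (tens t3 (tens t4 \<eta> \<eta>') \<eta>'') T" for T
    unfolding vsum_def
    by (rule infsum_reindex_bij_witness [where i = "\<lambda>((a, b), c). (a, (b, c))" and j = "\<lambda>(a, (b, c)). ((a, b), c)"])
      (auto simp: tens_def assoc)
qed

lemma convolution_normal:
  assumes t_rr: "hilbert_tensor t_rr" and \<Delta>: "normal_star_hom R (vn_tensor t_rr R R) \<Delta>"
    and \<theta>: "normal_functional R \<theta>" and \<phi>: "normal_functional R \<phi>"
  shows "normal_functional R (convolution t_rr R \<Delta> \<theta> \<phi>)"
proof -
  obtain h
    where h: "h \<in> vsums" "\<And>U. U \<in> vn_tensor t_rr R R \<Longrightarrow> functional_tensor t_rr R R \<theta> \<phi> U = h U"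
    using functional_tensor_normal [OF t_rr R_sub R_sub \<theta> \<phi>] by metis
  show ?thesis
    by (rule normal_functional_cong [OF R_sub(1) normal_functional_hom [OF \<Delta> h(1)]])
      (use \<Delta> h(2) in \<open>auto simp: convolution_def normal_star_hom_def\<close>)
qed

text \<open>Both sides come from one functional \<open>g\<close> on the triple tensor product, with
  factors \<theta>, \<phi> and \<open>\<lambda>b. \<omega> (adj d o\<^sub>L b)\<close>. Along
  \<open>id_\<alpha>\<close>, \<theta> acts on the first leg and the coefficient of the operator of
  \<phi> on the rest; along \<open>\<Delta>_id\<close>, the first two legs merge into the
  convolution of \<theta> and \<phi>. This explains the reversed order of the operators.\<close>

lemma gns_slice_op_compose:
  fixes t_rr :: "'r \<Rightarrow> 'r \<Rightarrow> 'rr::complex_hilbert_space"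
    and t_r_ra :: "'r \<Rightarrow> 'ra \<Rightarrow> 'rra::complex_hilbert_space"
    and t_rr_a :: "'rr \<Rightarrow> 'a \<Rightarrow> 'rra"
  assumes t_rr: "hilbert_tensor t_rr" and t_r_ra: "hilbert_tensor t_r_ra"
    and t_rr_a: "hilbert_tensor t_rr_a"
    and assoc: "\<And>x y z. t_r_ra x (t y z) = t_rr_a (t_rr x y) z"
    and \<Delta>: "normal_star_hom R (vn_tensor t_rr R R) \<Delta>"
    and \<alpha>: "normal_star_hom A (vn_tensor t R A) \<alpha>"
    and id_\<alpha>: "is_hom_tensor t R A t_r_ra R (vn_tensor t R A) id \<alpha> id_\<alpha>"
    and \<Delta>_id: "is_hom_tensor t R A t_rr_a (vn_tensor t_rr R R) A \<Delta> id \<Delta>_id"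
    and coassoc: "\<And>a. a \<in> A \<Longrightarrow> id_\<alpha> (\<alpha> a) = \<Delta>_id (\<alpha> a)"
    and inv: "\<And>\<theta> a. \<theta> \<in> normal_states R \<Longrightarrow> a \<in> A \<Longrightarrow> functional_tensor t R A \<theta> \<omega> (\<alpha> a) = \<omega> a"
    and \<theta>: "\<theta> \<in> normal_states R" and \<phi>: "\<phi> \<in> normal_states R" and a: "a \<in> A" and d: "d \<in> A"
  shows "cinner (\<gamma> d) (blinfun_apply (gns_slice_op t R A \<omega> \<gamma> \<alpha> \<phi>)
      (blinfun_apply (gns_slice_op t R A \<omega> \<gamma> \<alpha> \<theta>) (\<gamma> a))) =
    functional_tensor t R A (convolution t_rr R \<Delta> \<theta> \<phi>) \<omega> (adj (op_tensor t id_blinfun d) o\<^sub>L \<alpha> a)"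
proof -
  let ?M = "vn_tensor t R A" and ?D = "op_tensor t id_blinfun d"
  let ?T = "gns_slice_op t R A \<omega> \<gamma> \<alpha>"
  have \<alpha>M: "\<alpha> a \<in> ?M" if "a \<in> A" for a
    using \<alpha> that by (auto simp: normal_star_hom_def)
  have M: "csubspace ?M" "?M \<subseteq> bounded_ops"
    by (rule csubspace_vn_tensor [OF t R_sub A_sub(2)] vn_tensor_bounded [OF t R_sub A_sub(2)])+
  have d': "d \<in> bounded_ops" "adj d \<in> bounded_ops" "adj d \<in> A"
    using d A_sub vna_adj [OF A] by auto
  obtain \<xi> \<eta> :: "nat \<Rightarrow> 'r" where \<xi>: "sq_summable \<xi>" "sq_summable \<eta>" "\<And>S. S \<in> R \<Longrightarrow> \<theta> S = vsum \<xi> \<eta> S"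
    using normal_states_rep [OF \<theta> R_sub] by blast
  obtain \<xi>' \<eta>' :: "nat \<Rightarrow> 'r"
    where \<xi>': "sq_summable \<xi>'" "sq_summable \<eta>'" "\<And>S. S \<in> R \<Longrightarrow> \<phi> S = vsum \<xi>' \<eta>' S"
    using normal_states_rep [OF \<phi> R_sub] by blast
  obtain \<xi>'' \<eta>'' :: "nat \<Rightarrow> 'a"
    where \<xi>'': "sq_summable \<xi>''" "sq_summable \<eta>''" "\<And>S. S \<in> A \<Longrightarrow> \<omega> S = vsum \<xi>'' \<eta>'' S"
    using normal_states_rep [OF \<omega> A_sub] by blast
  \<comment> \<open>Applying \<open>d\<close> to the left family of \<omega> represents
    \<open>\<lambda>b. \<omega> (adj d o\<^sub>L b)\<close> on A.\<close>
  define \<zeta> where "\<zeta> = (\<lambda>l. blinfun_apply d (\<xi>'' l))"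
  have \<zeta>: "sq_summable \<zeta>"
    unfolding \<zeta>_def by (rule sq_summable_blinfun [OF \<xi>''(1)])
  have \<omega>d: "vsum \<zeta> \<eta>'' b = \<omega> (adj d o\<^sub>L b)" if "b \<in> A" for b
    using that d d' by (simp add: \<xi>''(3) vna_compose [OF A] vsum_compose_left adj_adj \<zeta>_def)
  \<comment> \<open>The families consist of elementary triple tensors, so \<open>g\<close> may be
    bracketed either way: \<open>g_left\<close> uses this form, \<open>g_right\<close> the form
    \<open>g'\<close>.\<close>
  define g where "g = vsum (tens t_r_ra \<xi> (tens t \<xi>' \<zeta>)) (tens t_r_ra \<eta> (tens t \<eta>' \<eta>''))"
  note inner = sq_summable_tens [OF t \<xi>'(1) \<zeta>] sq_summable_tens [OF t \<xi>'(2) \<xi>''(2)]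
    and inner' = sq_summable_tens [OF t_rr \<xi>(1) \<xi>'(1)] sq_summable_tens [OF t_rr \<xi>(2) \<xi>'(2)]
  have g': "g = vsum (tens t_rr_a (tens t_rr \<xi> \<xi>') \<zeta>) (tens t_rr_a (tens t_rr \<eta> \<eta>') \<eta>'')"
    unfolding g_def by (rule vsum_tens_assoc) (rule assoc)
  have g: "g \<in> vsums"
    unfolding g_def by (rule vsum_tens_in_vsums [OF t_r_ra \<xi>(1,2) inner])
  have g_left: "g (op_tensor t_r_ra r Y) = \<theta> r * functional_tensor t R A \<phi> \<omega> (adj ?D o\<^sub>L Y)"
    if r: "r \<in> R" and Y: "Y \<in> ?M" for r Y
  proof -
    have b: "r \<in> bounded_ops" "Y \<in> bounded_ops"
      using r Y R_sub M by auto
    have "functional_tensor t R A \<phi> \<omega> (adj ?D o\<^sub>L Y) = vsum (tens t \<xi>' \<xi>'') (tens t \<eta>' \<eta>'') (adj ?D o\<^sub>L Y)"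
      by (rule functional_tensor_eq [OF t R_sub A_sub(2) \<xi>'(1,2) \<xi>''(1,2) \<xi>'(3) \<xi>''(3) adj_right_op_compose [OF d Y]])
    also have "\<dots> = vsum (\<lambda>k. blinfun_apply ?D (tens t \<xi>' \<xi>'' k)) (tens t \<eta>' \<eta>'') Y"
      using right_op_in_bounded_ops [OF d]
      by (simp add: vsum_compose_left adj_in_bounded_ops adj_adj)
    also have "(\<lambda>k. blinfun_apply ?D (tens t \<xi>' \<xi>'' k)) = tens t \<xi>' \<zeta>"
      by (auto simp: tens_def fun_eq_iff \<zeta>_def op_tensor_apply [OF t bounded_ops_id d'(1)])
    finally show ?thesis
      by (simp add: g_def vsum_tens_op_tensor [OF t_r_ra b \<xi>(1,2) inner] \<xi>(3) r)
  qed
  have g_right: "g (op_tensor t_rr_a Y b) = functional_tensor t_rr R R \<theta> \<phi> Y * \<omega> (adj d o\<^sub>L b)"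
    if Y: "Y \<in> vn_tensor t_rr R R" and b: "b \<in> A" for Y b
  proof -
    have "Y \<in> bounded_ops" "b \<in> bounded_ops"
      using Y b A_sub vn_tensor_bounded [OF t_rr R_sub R_sub(2)] by auto
    moreover have "functional_tensor t_rr R R \<theta> \<phi> Y = vsum (tens t_rr \<xi> \<xi>') (tens t_rr \<eta> \<eta>') Y"
      by (rule functional_tensor_eq [OF t_rr R_sub R_sub(2) \<xi>(1,2) \<xi>'(1,2) \<xi>(3) \<xi>'(3) Y])
    ultimately show ?thesis
      by (simp add: g' vsum_tens_op_tensor [OF t_rr_a _ _ inner' \<zeta> \<xi>''(2)] \<omega>d b)
  qed
  have hom: "normal_functional ?M (\<lambda>X. g (id_\<alpha> X))" "normal_functional ?M (\<lambda>X. g (\<Delta>_id X))"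
    using id_\<alpha> \<Delta>_id normal_functional_hom [OF _ g] by (auto simp: is_hom_tensor_def)
  have T: "?T \<phi> \<in> bounded_ops"
    "\<And>b. b \<in> A \<Longrightarrow> blinfun_apply (?T \<phi>) (\<gamma> b) = gns_slice t R A \<omega> \<gamma> \<phi> (\<alpha> b)"
    by (rule gns_slice_op_in_bounded_ops [OF \<alpha> \<phi> inv [OF \<phi>]] gns_slice_op_apply [OF \<alpha> \<phi> inv [OF \<phi>]]; assumption)+
  \<comment> \<open>Moving \<open>?T \<phi>\<close> to the left leaves a single slice by \<theta>,
    so \<open>cinner_gns_slice_eqI\<close> reduces the identity to elementary tensors.\<close>
  have "cinner (\<gamma> d) (blinfun_apply (?T \<phi>) (blinfun_apply (?T \<theta>) (\<gamma> a))) =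
      cinner (blinfun_apply (adj (?T \<phi>)) (\<gamma> d)) (gns_slice t R A \<omega> \<gamma> \<theta> (\<alpha> a))"
    by (simp add: gns_slice_op_apply [OF \<alpha> \<theta> inv [OF \<theta>] a] cinner_adj_left T(1))
  also have "\<dots> = g (id_\<alpha> (\<alpha> a))"
  proof (rule cinner_gns_slice_eqI [OF \<theta> hom(1) _ \<alpha>M [OF a]])
    fix r b
    assume r: "r \<in> R" and b: "b \<in> A"
    have "id_\<alpha> (op_tensor t r b) = op_tensor t_r_ra r (\<alpha> b)"
      using id_\<alpha> r b by (simp add: is_hom_tensor_def)
    then show "cinner (blinfun_apply (adj (?T \<phi>)) (\<gamma> d)) (\<theta> r *\<^sub>C \<gamma> b) = g (id_\<alpha> (op_tensor t r b))"
      by (simp add: cinner_adj_left T bounded_ops_scaleC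
        cinner_scaleC_right b g_left [OF r \<alpha>M [OF b]]
          gns_slice_inner [OF \<phi> \<alpha>M [OF b] d])
  qed
  also have "\<dots> = g (\<Delta>_id (\<alpha> a))"
    by (simp add: coassoc a)
  also have "\<dots> = functional_tensor t R A (convolution t_rr R \<Delta> \<theta> \<phi>) \<omega> (adj ?D o\<^sub>L \<alpha> a)"
  proof -
    \<comment> \<open>The composite of \<open>g\<close> with \<open>\<Delta>_id\<close> is known to
      be normal on \<open>?M\<close> only; \<open>g2\<close> represents it there, so that agreement
      on elementary tensors can be used.\<close>
    obtain g2 where g2: "g2 \<in> vsums" "\<And>X. X \<in> ?M \<Longrightarrow> g (\<Delta>_id X) = g2 X"
      using normal_functional_vsums [OF M hom(2)] by blast
    note conv = convolution_normal [OF t_rr \<Delta> normal_statesD(1) [OF \<theta>] normal_statesD(1) [OF \<phi>]]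
    obtain h where h: "h \<in> vsums"
      "\<And>U. U \<in> ?M \<Longrightarrow> functional_tensor t R A (convolution t_rr R \<Delta> \<theta> \<phi>) \<omega> U = h U"
      "\<And>S T. S \<in> R \<Longrightarrow> T \<in> A \<Longrightarrow> h (op_tensor t S T) = convolution t_rr R \<Delta> \<theta> \<phi> S * \<omega> T"
      using functional_tensor_normal [OF t R_sub A_sub conv normal_statesD(1) [OF \<omega>]] by blast
    obtain \<mu> \<nu> :: "nat \<Rightarrow> 'ra" where \<mu>: "sq_summable \<mu>" "sq_summable \<nu>" "h = vsum \<mu> \<nu>"
      using h(1) unfolding vsums_def by blast
    have "(\<lambda>X. h (adj ?D o\<^sub>L X)) = vsum (\<lambda>i. blinfun_apply (adj (adj ?D)) (\<mu> i)) \<nu>"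
      using adj_in_bounded_ops [OF right_op_in_bounded_ops [OF d]]
      by (simp add: \<mu>(3) vsum_compose_left fun_eq_iff)
    then have h': "(\<lambda>X. h (adj ?D o\<^sub>L X)) \<in> vsums"
      by (simp add: vsum_in_vsums sq_summable_blinfun \<mu>)
    have "g2 (\<alpha> a) = h (adj ?D o\<^sub>L \<alpha> a)"
    proof (rule vsums_eq_on_vn_tensor [OF t R_sub A_sub(2) g2(1) h' _ \<alpha>M [OF a]])
      fix r b
      assume r: "r \<in> R" and b: "b \<in> A"
      have rb: "r \<in> bounded_ops" "b \<in> bounded_ops"
        using r b R_sub A_sub by auto
      have "\<Delta>_id (op_tensor t r b) = op_tensor t_rr_a (\<Delta> r) b" "\<Delta> r \<in> vn_tensor t_rr R R"
        using \<Delta>_id \<Delta> r b by (auto simp: is_hom_tensor_def normal_star_hom_def)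
      then have "g2 (op_tensor t r b) = convolution t_rr R \<Delta> \<theta> \<phi> r * \<omega> (adj d o\<^sub>L b)"
        using g2(2) [OF op_tensor_in_vn_tensor [OF t R_sub A_sub(2) r b]] b
        by (simp add: g_right convolution_def)
      also have "\<dots> = h (op_tensor t r (adj d o\<^sub>L b))"
        using r b d' by (simp add: h(3) vna_compose [OF A])
      also have "op_tensor t r (adj d o\<^sub>L b) = adj ?D o\<^sub>L op_tensor t r b"
        by (simp add: adj_right_op d op_tensor_compose [OF t] bounded_ops_id d' rb)
      finally show "g2 (op_tensor t r b) = h (adj ?D o\<^sub>L op_tensor t r b)" .
    qed
    then show ?thesis
      using g2(2) [OF \<alpha>M [OF a]] h(2) [OF adj_right_op_compose [OF d \<alpha>M [OF a]]] by simp
  qed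
  finally show ?thesis .
qed

end

text \<open>The net is encoded as a family \<open>\<phi>\<close> with a filter \<open>F\<close> on
  its index type. Both sides of coassociativity have to be operators on one space, hence the common
  codomain \<open>'rra\<close> of \<open>t_r_ra\<close> and \<open>t_rr_a\<close> and their
  agreement on elementary triples.\<close>

theorem theorem3p1:
  fixes R :: "('r::complex_hilbert_space \<Rightarrow>\<^sub>L 'r) set"
    and A :: "('a::complex_hilbert_space \<Rightarrow>\<^sub>L 'a) set"
    and \<omega> :: "('a \<Rightarrow>\<^sub>L 'a) \<Rightarrow> complex"
    and \<gamma> :: "('a \<Rightarrow>\<^sub>L 'a) \<Rightarrow> 'h::complex_hilbert_space"
    and t_ra :: "'r \<Rightarrow> 'a \<Rightarrow> 'ra::complex_hilbert_space"
    and t_rr :: "'r \<Rightarrow> 'r \<Rightarrow> 'rr::complex_hilbert_space"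
    and t_r_ra :: "'r \<Rightarrow> 'ra \<Rightarrow> 'rra::complex_hilbert_space"
    and t_rr_a :: "'rr \<Rightarrow> 'a \<Rightarrow> 'rra"
    and \<Delta> :: "('r \<Rightarrow>\<^sub>L 'r) \<Rightarrow> ('rr \<Rightarrow>\<^sub>L 'rr)"
    and \<alpha> :: "('a \<Rightarrow>\<^sub>L 'a) \<Rightarrow> ('ra \<Rightarrow>\<^sub>L 'ra)"
    and id_\<alpha> \<Delta>_id :: "('ra \<Rightarrow>\<^sub>L 'ra) \<Rightarrow> ('rra \<Rightarrow>\<^sub>L 'rra)"
    and \<phi> :: "'i \<Rightarrow> ('r \<Rightarrow>\<^sub>L 'r) \<Rightarrow> complex"
    and F :: "'i filter"
  defines "V \<equiv> {x. \<forall>\<theta>\<in>normal_states R.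
                   blinfun_apply (gns_slice_op t_ra R A \<omega> \<gamma> \<alpha> \<theta>) x = x}"
  assumes "von_neumann_algebra R" and "von_neumann_algebra A"
    and "\<omega> \<in> normal_states A" and "gns_construction A \<omega> \<gamma>"
    and "hilbert_tensor t_ra" and "hilbert_tensor t_rr"
    and "hilbert_tensor t_r_ra" and "hilbert_tensor t_rr_a"
    and "\<And>x y z. t_r_ra x (t_ra y z) = t_rr_a (t_rr x y) z"
    and "normal_star_hom R (vn_tensor t_rr R R) \<Delta>"
    and "normal_star_hom A (vn_tensor t_ra R A) \<alpha>"
    and "is_hom_tensor t_ra R A t_r_ra R (vn_tensor t_ra R A) id \<alpha> id_\<alpha>"
    and "is_hom_tensor t_ra R A t_rr_a (vn_tensor t_rr R R) A \<Delta> id \<Delta>_id"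
    and "\<And>a. a \<in> A \<Longrightarrow> id_\<alpha> (\<alpha> a) = \<Delta>_id (\<alpha> a)"
    and "\<And>\<theta> a. \<theta> \<in> normal_states R \<Longrightarrow> a \<in> A \<Longrightarrow> functional_tensor t_ra R A \<theta> \<omega> (\<alpha> a) = \<omega> a"
    and "F \<noteq> bot" and "\<And>i. \<phi> i \<in> normal_states R"
    and "\<And>\<theta>. \<theta> \<in> normal_states R \<Longrightarrow>
           ((\<lambda>i. functional_norm R (\<lambda>T. convolution t_rr R \<Delta> \<theta> (\<phi> i) T - \<phi> i T)) \<longlongrightarrow> 0) F"
  shows "\<forall>x y. ((\<lambda>i. cinner x (blinfun_apply (gns_slice_op t_ra R A \<omega> \<gamma> \<alpha> (\<phi> i)) y))
                  \<longlongrightarrow> cinner x (orth_proj V y)) F"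
proof -
  note R = assms(2) and A = assms(3) and \<omega> = assms(4) and \<gamma> = assms(5) and t = assms(6)
    and \<alpha> = assms(12) and inv = assms(16) and \<phi> = assms(18)
  let ?T = "gns_slice_op t_ra R A \<omega> \<gamma> \<alpha>" and ?FT = "functional_tensor t_ra R A"
  note ctx = t R A \<omega> \<gamma>
  have T: "?T \<theta> \<in> bounded_ops" "norm (blinfun_apply (?T \<theta>) x) \<le> norm x" if "\<theta> \<in> normal_states R"
    for \<theta> x
    using gns_slice_op_in_bounded_ops [OF ctx \<alpha> that inv [OF that]]
      norm_gns_slice_op_le [OF ctx \<alpha> that inv [OF that]] by auto
  have null: "((\<lambda>i. cinner x (blinfun_apply (?T (\<phi> i)) (blinfun_apply (?T \<theta>) y - y))) \<longlongrightarrow> 0) F"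
    if \<theta>: "\<theta> \<in> normal_states R" for \<theta> x y
  proof -
    \<comment> \<open>Contractivity bounds all \<open>S i\<close> by the constant 2, so by
      \<open>weak_null_closure\<close> it is enough to test against vectors
      \<open>\<gamma> d\<close> and \<open>\<gamma> a\<close>.\<close>
    define S where "S i = (?T (\<phi> i) o\<^sub>L ?T \<theta>) - ?T (\<phi> i)" for i
    have S_apply: "blinfun_apply (S i) z = blinfun_apply (?T (\<phi> i)) (blinfun_apply (?T \<theta>) z - z)"
      for i z
      by (simp add: S_def blinfun.diff_left blinfun.diff_right)
    have S_le: "norm (blinfun_apply (S i) z) \<le> 2 * norm z" for i z
    proof -
      have "norm (blinfun_apply (S i) z) \<le> norm (blinfun_apply (?T \<theta>) z - z)"
        unfolding S_apply by (rule T(2) [OF \<phi>])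
      also have "\<dots> \<le> norm (blinfun_apply (?T \<theta>) z) + norm z"
        by (rule norm_triangle_ineq4)
      finally show ?thesis
        using T(2) [OF \<theta>, of z] by simp
    qed
    have S_\<gamma>: "((\<lambda>i. cinner u (blinfun_apply (S i) z)) \<longlongrightarrow> 0) F" if uz: "u \<in> \<gamma> ` A" "z \<in> \<gamma> ` A"
      for u z
    proof -
      obtain d a where d: "d \<in> A" "u = \<gamma> d" and a: "a \<in> A" "z = \<gamma> a"
        using uz by blast
      let ?U = "adj (op_tensor t_ra id_blinfun d) o\<^sub>L \<alpha> a"
      have \<alpha>a: "\<alpha> a \<in> vn_tensor t_ra R A"
        using \<alpha> a by (auto simp: normal_star_hom_def)
      then have U: "?U \<in> vn_tensor t_ra R A"
        by (rule adj_right_op_compose [OF ctx d(1)])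
      have A': "csubspace A" "A \<subseteq> bounded_ops"
        using vna_csubspace [OF A] vna_bounded [OF A] by auto
      have n\<omega>: "normal_functional A \<omega>" and n: "\<And>f. f \<in> normal_states R \<Longrightarrow> normal_functional R f"
        using \<omega> by (auto simp: normal_states_def)
      \<comment> \<open>The same \<open>r\<close> serves every \<open>i\<close>, both for the
        convolution and for \<open>\<phi> i\<close>. The coefficient of \<open>S i\<close> is
        therefore their difference evaluated at \<open>r\<close>, which the functional norm
        controls.\<close>
      obtain r where r: "r \<in> R" "\<And>\<mu>. normal_functional R \<mu> \<Longrightarrow> ?FT \<mu> \<omega> ?U = \<mu> r"
        using slice_ex [OF t R A' n\<omega> U] by blast
      let ?c = "\<lambda>i. convolution t_rr R \<Delta> \<theta> (\<phi> i)"
      have nc: "normal_functional R (?c i)" for i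
        by (rule convolution_normal [OF ctx assms(7) assms(11) n [OF \<theta>] n [OF \<phi>]])
      have eq: "cinner u (blinfun_apply (S i) z) = ?c i r - \<phi> i r" for i
      proof -
        have "cinner u (blinfun_apply (?T (\<phi> i)) (blinfun_apply (?T \<theta>) z)) = ?c i r"
          unfolding d(2) a(2) r(2) [OF nc, symmetric]
          by (rule gns_slice_op_compose [OF ctx assms(7-15) inv \<theta> \<phi> a(1) d(1)])
        moreover have "cinner u (blinfun_apply (?T (\<phi> i)) z) = \<phi> i r"
          by (simp add: d(2) a(2) gns_slice_op_apply [OF ctx \<alpha> \<phi> inv [OF \<phi>] a(1)]
              gns_slice_inner [OF ctx \<phi> \<alpha>a d(1)] r(2) n \<phi>)
        ultimately show ?thesis
          by (simp add: S_def blinfun.diff_left cinner.diff_right)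
      qed
      have le: "norm (cinner u (blinfun_apply (S i) z)) \<le> functional_norm R (\<lambda>T. ?c i T - \<phi> i T) * norm r" for i
        unfolding eq
        by (rule cmod_le_functional_norm [OF vna_csubspace [OF R] vna_bounded [OF R]
              normal_functional_diff [OF ctx nc n [OF \<phi>]] r(1)])
      have "((\<lambda>i. functional_norm R (\<lambda>T. ?c i T - \<phi> i T) * norm r) \<longlongrightarrow> 0 * norm r) F"
        by (intro tendsto_mult tendsto_const assms(19) \<theta>)
      then show ?thesis
        by (intro Lim_null_comparison [OF _ tendsto_eq_rhs]) (auto intro: always_eventually le)
    qed
    have cl: "z \<in> closure (\<gamma> ` A)" for z
      using \<gamma> by (simp add: gns_construction_def)
    have "((\<lambda>i. cinner x (blinfun_apply (S i) y)) \<longlongrightarrow> 0) F"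
      by (rule weak_null_closure [OF S_le _ S_\<gamma> cl cl]) simp_all
    then show ?thesis
      by (simp only: S_apply)
  qed
  show ?thesis
    unfolding V_def by (intro allI weak_mean_ergodic T \<phi> null)
qed

end
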